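(* Let $(\mathbb{I},J,\omega)$ be the almost-Kähler Iwasawa manifold described in the context, with the Hermitian metric whose fundamental form is $\omega$. Then $h^{1,0}_{\bar\delta}=1$, $h^{2,0}_{\bar\delta}=1$ (spanned by $i\varphi^1\wedge\varphi^3+\varphi^2\wedge\varphi^3$), and $h^{3,0}_{\bar\delta}=0$.
   Context: General notions. For an almost-complex manifold $(X,J)$, $A^k(X)=\bigoplus_{p+q=k}A^{p,q}(X)$ and $d=\mu+\partial+\overline{\partial}+\bar\mu$ with $\mu:A^{p,q}\to A^{p+2,q-1}$, $\partial:A^{p,q}\to A^{p+1,q}$, $\overline{\partial}:A^{p,q}\to A^{p,q+1}$, $\bar\mu:A^{p,q}\to A^{p-1,q+2}$. Given a $J$-Hermitian metric on compact $X$, with $L^2$-adjoints denoted by ${}^*$, set $\bar\delta:=\overline{\partial}+\mu$, $\Delta_{\bar\delta}:=\bar\delta\bar\delta^*+\bar\delta^*\bar\delta$, and $h^{p,0}_{\bar\delta}:=\dim_{\mathbb{C}}\{\psi\in A^{p,0}(X):\Delta_{\bar\delta}\psi=0\}$. The Iwasawa manifold. $\mathbb{H}_3$ is the complex Heisenberg group of matrices $\begin{pmatrix}1&z_1&z_3\\0&1&z_2\\0&0&1\end{pmatrix}$, $z_j=x_j+iy_j\in\mathbb{C}$, $\Gamma\subset\mathbb{H}_3$ the subgroup with $z_1,z_2,z_3\in\mathbb{Z}[i]$, and $\mathbb{I}=\Gamma\backslash\mathbb{H}_3$. Left-invariant real $1$-forms: $e^1=dx_1$, $e^2=dy_1$,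 $e^3=dx_2$, $e^4=dy_2$, $e^5=dx_3-x_1dx_2+y_1dy_2$, $e^6=dy_3-x_1dy_2-y_1dx_2$, with $de^1=\dots=de^4=0$, $de^5=-e^{13}+e^{24}$, $de^6=-e^{14}-e^{23}$. $J$ is the almost-complex structure whose $(1,0)$-forms are spanned by $\varphi^1=e^1+ie^6$, $\varphi^2=e^2+ie^5$, $\varphi^3=e^3+ie^4$, and $\omega=\frac{i}{2}\sum_{j=1}^3\varphi^j\wedge\overline{\varphi^j}$, which is a $J$-compatible symplectic form. *)

theory Defs
  imports "HOL-Analysis.Analysis" "HOL-Library.Function_Algebras" "HOL-Combinatorics.Permutations"
begin

section \<open>The Iwasawa manifold as Gamma-invariant objects on H_3 = C^3\<close>

text \<open>A point (z1,z2,z3) of H_3 is identified with the matrix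
  [[1,z1,z3],[0,1,z2],[0,0,1]]; tangent vectors are elements of the same real vector space.\<close>

type_synonym pt = "complex \<times> complex \<times> complex"

definition gauss :: "complex \<Rightarrow> bool" where
  "gauss a \<longleftrightarrow> Re a \<in> \<int> \<and> Im a \<in> \<int>"

definition hmul :: "pt \<Rightarrow> pt \<Rightarrow> pt" where
  "hmul a z = (fst a + fst z, fst (snd a) + fst (snd z),
               snd (snd a) + fst a * fst (snd z) + snd (snd z))"

definition Gamma :: "pt set" where
  "Gamma = {a. gauss (fst a) \<and> gauss (fst (snd a)) \<and> gauss (snd (snd a))}"

definition ginv :: "(pt \<Rightarrow> complex) \<Rightarrow> bool" where
  "ginv f \<longleftrightarrow> (\<forall>a\<in>Gamma. \<forall>z. f (hmul a z) = f z)"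

fun iderv :: "(pt \<Rightarrow> complex) \<Rightarrow> pt list \<Rightarrow> pt \<Rightarrow> complex" where
  "iderv f [] = f"
| "iderv f (v # vs) = (\<lambda>p. frechet_derivative (iderv f vs) (at p) v)"

definition smooth :: "(pt \<Rightarrow> complex) \<Rightarrow> bool" where
  "smooth f \<longleftrightarrow> (\<forall>vs p. iderv f vs differentiable (at p))"

text \<open>The left-invariant coframe e^1..e^6 evaluated at the point p on the tangent vector v:
  e1=dx1, e2=dy1, e3=dx2, e4=dy2, e5=dx3-x1 dx2+y1 dy2, e6=dy3-x1 dy2-y1 dx2.\<close>
definition ecov :: "nat \<Rightarrow> pt \<Rightarrow> pt \<Rightarrow> real" where
  "ecov k p v =
    (let x1 = Re (fst p); y1 = Im (fst p) in
     if k = 1 then Re (fst v)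
     else if k = 2 then Im (fst v)
     else if k = 3 then Re (fst (snd v))
     else if k = 4 then Im (fst (snd v))
     else if k = 5 then Re (snd (snd v)) - x1 * Re (fst (snd v)) + y1 * Im (fst (snd v))
     else if k = 6 then Im (snd (snd v)) - x1 * Im (fst (snd v)) - y1 * Re (fst (snd v))
     else 0)"

definition Efr :: "nat \<Rightarrow> pt \<Rightarrow> pt" where
  "Efr k p = (THE v. \<forall>j\<in>{1..6}. ecov j p v = (if j = k then 1 else 0))"

text \<open>A form is given by its coefficient functions: alpha I is the coefficient of
  e^{i1} wedge ... wedge e^{ik} where I = {i1 < ... < ik} is a subset of {1..6}.\<close>
type_synonym form = "nat set \<Rightarrow> pt \<Rightarrow> complex"

definition fsc :: "complex \<Rightarrow> form \<Rightarrow> form" where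
  "fsc c \<alpha> = (\<lambda>I p. c * \<alpha> I p)"

definition fmul :: "(pt \<Rightarrow> complex) \<Rightarrow> form \<Rightarrow> form" where
  "fmul f \<alpha> = (\<lambda>I p. f p * \<alpha> I p)"

definition fadd :: "form \<Rightarrow> form \<Rightarrow> form" where
  "fadd \<alpha> \<beta> = (\<lambda>I p. \<alpha> I p + \<beta> I p)"

definition fzero :: form where
  "fzero = (\<lambda>I p. 0)"

definition wsign :: "nat set \<Rightarrow> nat set \<Rightarrow> complex" where
  "wsign I J = (-1) ^ card {(i, j). i \<in> I \<and> j \<in> J \<and> j < i}"

definition wedge :: "form \<Rightarrow> form \<Rightarrow> form" where
  "wedge \<alpha> \<beta> = (\<lambda>K p. \<Sum>I\<in>Pow K. wsign I (K - I) * \<alpha> I p * \<beta> (K - I) p)"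

definition eb :: "nat \<Rightarrow> form" where
  "eb k = (\<lambda>I p. if I = {k} then 1 else 0)"

definition one_form :: form where
  "one_form = (\<lambda>I p. if I = {} then 1 else 0)"

fun eL :: "nat list \<Rightarrow> form" where
  "eL [] = one_form"
| "eL (k # ks) = wedge (eb k) (eL ks)"

definition de :: "nat \<Rightarrow> form" where
  "de k = (if k = 5 then fadd (fsc (-1) (wedge (eb 1) (eb 3))) (wedge (eb 2) (eb 4))
           else if k = 6 then fadd (fsc (-1) (wedge (eb 1) (eb 4))) (fsc (-1) (wedge (eb 2) (eb 3)))
           else fzero)"

fun dL :: "nat list \<Rightarrow> form" where
  "dL [] = fzero"
| "dL (k # ks) = fadd (wedge (de k) (eL ks)) (fsc (-1) (wedge (eb k) (dL ks)))"

definition dfun :: "(pt \<Rightarrow> complex) \<Rightarrow> form" where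
  "dfun f = (\<lambda>K p. \<Sum>k\<in>{1..6}. frechet_derivative f (at p) (Efr k p) * eb k K p)"

definition dform :: "form \<Rightarrow> form" where
  "dform \<alpha> = (\<lambda>K p. \<Sum>I\<in>Pow {1..6}.
      fadd (wedge (dfun (\<alpha> I)) (eL (sorted_list_of_set I)))
           (fmul (\<alpha> I) (dL (sorted_list_of_set I))) K p)"

text \<open>Complex coframe theta^1..theta^6 = phi^1, phi^2, phi^3, conj phi^1, conj phi^2, conj phi^3,
  with phi^1 = e^1 + i e^6, phi^2 = e^2 + i e^5, phi^3 = e^3 + i e^4.\<close>
definition theta :: "nat \<Rightarrow> form" where
  "theta j = (if j = 1 then fadd (eb 1) (fsc \<i> (eb 6))
         else if j = 2 then fadd (eb 2) (fsc \<i> (eb 5))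
         else if j = 3 then fadd (eb 3) (fsc \<i> (eb 4))
         else if j = 4 then fadd (eb 1) (fsc (-\<i>) (eb 6))
         else if j = 5 then fadd (eb 2) (fsc (-\<i>) (eb 5))
         else if j = 6 then fadd (eb 3) (fsc (-\<i>) (eb 4))
         else fzero)"

fun thL :: "nat list \<Rightarrow> form" where
  "thL [] = one_form"
| "thL (j # js) = wedge (theta j) (thL js)"

text \<open>Complex tangent vectors: coefficient vectors w (w k is the coefficient of E_k).
  Z j p is the complex frame dual to theta.\<close>
definition Zfr :: "nat \<Rightarrow> pt \<Rightarrow> (nat \<Rightarrow> complex)" where
  "Zfr j p = (THE w. (\<forall>k. k \<notin> {1..6} \<longrightarrow> w k = 0) \<and>
      (\<forall>l\<in>{1..6}. (\<Sum>k\<in>{1..6}. theta l {k} p * w k) = (if l = j then 1 else 0)))"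

text \<open>Evaluation of a form on a list of complex tangent vectors (determinant convention,
  consistent with the wedge product above).\<close>
definition detm :: "nat list \<Rightarrow> (nat \<Rightarrow> complex) list \<Rightarrow> complex" where
  "detm js ws = (\<Sum>\<sigma> | \<sigma> permutes {0..<length ws}.
      of_int (sign \<sigma>) * (\<Prod>a<length ws. (ws ! (\<sigma> a)) (js ! a)))"

definition evalf :: "form \<Rightarrow> (nat \<Rightarrow> complex) list \<Rightarrow> pt \<Rightarrow> complex" where
  "evalf \<alpha> ws p = (\<Sum>J\<in>{J\<in>Pow {1..6}. card J = length ws}.
      \<alpha> J p * detm (sorted_list_of_set J) ws)"

definition tcoef :: "form \<Rightarrow> nat set \<Rightarrow> pt \<Rightarrow> complex" where
  "tcoef \<alpha> I p = evalf \<alpha> (map (\<lambda>i. Zfr i p) (sorted_list_of_set I)) p"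

definition bitype :: "nat \<Rightarrow> nat \<Rightarrow> nat set set" where
  "bitype a b = {I\<in>Pow {1..6}. card (I \<inter> {1,2,3}) = a \<and> card (I \<inter> {4,5,6}) = b}"

definition proj :: "nat \<Rightarrow> nat \<Rightarrow> form \<Rightarrow> form" where
  "proj a b \<alpha> = (\<lambda>K p. \<Sum>I\<in>bitype a b. tcoef \<alpha> I p * thL (sorted_list_of_set I) K p)"

definition dbar :: "form \<Rightarrow> form" where
  "dbar \<alpha> = (\<lambda>K x. \<Sum>(p, q)\<in>{0..3} \<times> {0..3}.
      proj p (q + 1) (dform (proj p q \<alpha>)) K x)"

definition mu :: "form \<Rightarrow> form" where
  "mu \<alpha> = (\<lambda>K x. \<Sum>(p, q)\<in>{0..3} \<times> {1..3}.
      proj (p + 2) (q - 1) (dform (proj p q \<alpha>)) K x)"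

definition bdelta :: "form \<Rightarrow> form" where
  "bdelta \<alpha> = fadd (dbar \<alpha>) (mu \<alpha>)"

definition Aall :: "form set" where
  "Aall = {\<alpha>. (\<forall>I. \<not> I \<subseteq> {1..6} \<longrightarrow> \<alpha> I = (\<lambda>p. 0)) \<and>
               (\<forall>I. smooth (\<alpha> I) \<and> ginv (\<alpha> I))}"

definition Apq :: "nat \<Rightarrow> nat \<Rightarrow> form set" where
  "Apq a b = {\<alpha>\<in>Aall. proj a b \<alpha> = \<alpha>}"

definition fdom :: "pt set" where
  "fdom = {z. Re (fst z) \<in> {0..1} \<and> Im (fst z) \<in> {0..1} \<and>
              Re (fst (snd z)) \<in> {0..1} \<and> Im (fst (snd z)) \<in> {0..1} \<and>
              Re (snd (snd z)) \<in> {0..1} \<and> Im (snd (snd z)) \<in> {0..1}}"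

text \<open>The metric g = sum (e^k)^2 (so that g(.,.) = omega(., J .)) makes e^1..e^6
  orthonormal; the volume form e^{123456} is Lebesgue measure in the coordinates.\<close>
definition l2 :: "form \<Rightarrow> form \<Rightarrow> complex" where
  "l2 \<alpha> \<beta> = integral fdom (\<lambda>p. \<Sum>I\<in>Pow {1..6}. \<alpha> I p * cnj (\<beta> I p))"

definition is_adj :: "(form \<Rightarrow> form) \<Rightarrow> (form \<Rightarrow> form) \<Rightarrow> bool" where
  "is_adj T S \<longleftrightarrow> (\<forall>\<alpha>\<in>Aall. S \<alpha> \<in> Aall) \<and>
     (\<forall>\<alpha>\<in>Aall. \<forall>\<beta>\<in>Aall. l2 (T \<alpha>) \<beta> = l2 \<alpha> (S \<beta>))"

definition harm :: "nat \<Rightarrow> form set" where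
  "harm p = {\<psi>\<in>Apq p 0. \<exists>S. is_adj bdelta S \<and>
      fadd (bdelta (S \<psi>)) (S (bdelta \<psi>)) = fzero}"

definition hdim :: "nat \<Rightarrow> nat" where
  "hdim p = vector_space.dim fsc (harm p)"

definition psi0 :: form where
  "psi0 = fadd (fsc \<i> (wedge (theta 1) (theta 3))) (wedge (theta 2) (theta 3))"

end

theory Submission
  imports Defs "Jordan_Normal_Form.Determinant"
begin

text \<open>
  A form of type (p,0) is harmonic iff it is killed by \<open>bdelta\<close> and orthogonal to the image of
  \<open>bdelta\<close>; this needs an adjoint of \<open>bdelta\<close>, which exists because \<open>bdelta\<close> has constant
  coefficients in the left-invariant frame and left-invariant fields integrate to zero over the
  fundamental domain. On (p,0)-forms the first condition is \<open>dbar \<psi> = 0\<close> and the second is the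
  pointwise linear condition \<open>mu* \<psi> = 0\<close>.

  The fields dual to the real and imaginary part of each \<open>\<phi>\<^sup>j\<close> commute, so a function killed by the
  (0,1)-fields \<open>Zbar\<^sub>1, Zbar\<^sub>2, Zbar\<^sub>3\<close> is killed by all left-invariant fields and hence constant, while
  a constant of the form \<open>Zbar\<^sub>j f\<close> vanishes because its integral does. For p = 1 these two facts,
  applied first to \<open>f\<^sub>1 - i f\<^sub>2\<close>, leave only the multiples of \<open>\<phi>\<^sup>3\<close>. For p = 2, \<open>mu* \<psi> = 0\<close> reads
  \<open>f\<^sub>1\<^sub>3 = i f\<^sub>2\<^sub>3\<close>, and \<open>dbar \<psi> = 0\<close> makes \<open>f\<^sub>1\<^sub>2\<close> vanish and \<open>f\<^sub>2\<^sub>3\<close> constant. For p = 3,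
  \<open>mu* \<psi> = 0\<close> already forces \<open>\<psi> = 0\<close>.
\<close>

section \<open>Smooth functions and left-invariant vector fields\<close>

text \<open>The condition coming from mu* is pointwise because a (p,0)-coefficient of
  \<open>bdelta\<close> can only come from d of the (p-2,1)-part. There every derivative term keeps
  a conjugate coframe factor, so only the structure constants in \<open>de 5\<close> and
  \<open>de 6\<close> survive; a suitable test form then turns orthogonality into the vanishing of
  an integral of |g|^2. The brackets of the frame are read off from \<open>de 5\<close> and
  \<open>de 6\<close>, which contain the index pairs 13, 24, 14, 23. The pairs 16, 25, 34 joined by
  J avoid them, and this is the source of the commuting fields that take the place of elliptic
  theory although J is not integrable. Coefficients are evaluated in the frame dual to
  \<open>theta\<close> by moving contractions through exterior products with the anticommutation
  relations, so that the structure constants come out by rewriting instead of by expanding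
  determinants over the 64 index sets. Each covector \<open>theta j\<close> has squared length 2,
  the origin of the powers of 2.\<close>

lemma smooth_coinduct:
  assumes "f \<in> X"
    and "\<And>g p. g \<in> X \<Longrightarrow> g differentiable (at p)"
    and "\<And>g v. g \<in> X \<Longrightarrow> (\<lambda>p. frechet_derivative g (at p) v) \<in> X"
  shows "smooth f"
proof -
  have "iderv f vs \<in> X" for vs by (induction vs) (auto intro: assms)
  then show ?thesis unfolding smooth_def using assms(2) by blast
qed

lemma smooth_differentiable: "smooth f \<Longrightarrow> f differentiable (at p)"
  unfolding smooth_def by (metis iderv.simps(1))

lemma smooth_has_derivative: "smooth f \<Longrightarrow> (f has_derivative frechet_derivative f (at p)) (at p)"
  using smooth_differentiable frechet_derivative_works by blast

text \<open>\<open>iderv\<close> differentiates first in the direction at the end of its list, which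
  is why the new direction is appended.\<close>

lemma iderv_derivative: "iderv (\<lambda>p. frechet_derivative f (at p) v) vs = iderv f (vs @ [v])"
  by (induction vs) auto

lemma smooth_derivative: "smooth f \<Longrightarrow> smooth (\<lambda>p. frechet_derivative f (at p) v)"
  unfolding smooth_def iderv_derivative by blast

lemma smooth_continuous: "smooth f \<Longrightarrow> continuous_on S f"
  by (meson continuous_at_imp_continuous_on differentiable_imp_continuous_within smooth_differentiable)

text \<open>The product rule leads from products to sums of products. Closing under constants,
  linear maps, conjugation, sums and products gives a set stable under directional derivatives, and
  \<open>smooth_coinduct\<close> then yields smoothness of all its members without an induction over
  lists of directions.\<close>

inductive_set smooth_closure :: "(pt \<Rightarrow> complex) set" where
  base: "smooth f \<Longrightarrow> f \<in> smooth_closure"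
| const: "(\<lambda>p. c) \<in> smooth_closure"
| linear: "bounded_linear f \<Longrightarrow> f \<in> smooth_closure"
| cnj: "f \<in> smooth_closure \<Longrightarrow> (\<lambda>p. cnj (f p)) \<in> smooth_closure"
| add: "f \<in> smooth_closure \<Longrightarrow> g \<in> smooth_closure \<Longrightarrow> (\<lambda>p. f p + g p) \<in> smooth_closure"
| mult: "f \<in> smooth_closure \<Longrightarrow> g \<in> smooth_closure \<Longrightarrow> (\<lambda>p. f p * g p) \<in> smooth_closure"

lemma smooth_closure_derivative:
  assumes "f \<in> smooth_closure"
  shows "\<exists>f'. (\<forall>p. (f has_derivative f' p) (at p)) \<and> (\<forall>v. (\<lambda>p. f' p v) \<in> smooth_closure)"
  using assms
proof induction
  case (base f)
  then show ?case
    by (intro exI[of _ "\<lambda>p. frechet_derivative f (at p)"])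
      (auto intro: smooth_has_derivative smooth_closure.base smooth_derivative)
next
  case (const c)
  then show ?case by (intro exI[of _ "\<lambda>p v. 0"]) (auto intro: smooth_closure.const)
next
  case (linear f)
  then show ?case
    by (intro exI[of _ "\<lambda>p. f"]) (auto intro: smooth_closure.const bounded_linear_imp_has_derivative)
next
  case (cnj f)
  then obtain f' where "\<And>p. (f has_derivative f' p) (at p)" "\<And>v. (\<lambda>p. f' p v) \<in> smooth_closure" by blast
  then show ?case
    by (intro exI[of _ "\<lambda>p v. cnj (f' p v)"]) (auto intro: smooth_closure.cnj has_derivative_cnj)
next
  case (add f g)
  then obtain f' g' where "\<And>p. (f has_derivative f' p) (at p)" "\<And>v. (\<lambda>p. f' p v) \<in> smooth_closure"
    "\<And>p. (g has_derivative g' p) (at p)" "\<And>v. (\<lambda>p. g' p v) \<in> smooth_closure" by blast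
  then show ?case
    by (intro exI[of _ "\<lambda>p v. f' p v + g' p v"]) (auto intro: smooth_closure.add has_derivative_add)
next
  case (mult f g)
  then obtain f' g' where "\<And>p. (f has_derivative f' p) (at p)" "\<And>v. (\<lambda>p. f' p v) \<in> smooth_closure"
    "\<And>p. (g has_derivative g' p) (at p)" "\<And>v. (\<lambda>p. g' p v) \<in> smooth_closure" by blast
  then show ?case using mult
    by (intro exI[of _ "\<lambda>p v. f p * g' p v + f' p v * g p"])
      (auto intro!: smooth_closure.add smooth_closure.mult has_derivative_mult)
qed

lemma smooth_closure_smooth: "f \<in> smooth_closure \<Longrightarrow> smooth f"
proof (erule smooth_coinduct)
  show "g differentiable (at p)" if "g \<in> smooth_closure" for g p
    using smooth_closure_derivative[OF that] differentiableI by blast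
  show "(\<lambda>p. frechet_derivative g (at p) v) \<in> smooth_closure" if gc: "g \<in> smooth_closure" for g v
  proof -
    obtain g' where g': "\<And>p. (g has_derivative g' p) (at p)" "\<And>v. (\<lambda>p. g' p v) \<in> smooth_closure"
      using smooth_closure_derivative[OF gc] by blast
    have "frechet_derivative g (at p) = g' p" for p
      using frechet_derivative_at[OF g'(1)] by simp
    then show ?thesis using g'(2) by simp
  qed
qed

lemma smooth_const: "smooth (\<lambda>p. c)"
  by (rule smooth_closure_smooth[OF smooth_closure.const])

lemma smooth_linear: "bounded_linear f \<Longrightarrow> smooth f"
  by (rule smooth_closure_smooth[OF smooth_closure.linear])

lemma smooth_cnj: "smooth f \<Longrightarrow> smooth (\<lambda>p. cnj (f p))"
  by (rule smooth_closure_smooth[OF smooth_closure.cnj[OF smooth_closure.base]])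

lemma smooth_add: "smooth f \<Longrightarrow> smooth g \<Longrightarrow> smooth (\<lambda>p. f p + g p)"
  by (rule smooth_closure_smooth[OF smooth_closure.add[OF smooth_closure.base smooth_closure.base]])

lemma smooth_mult: "smooth f \<Longrightarrow> smooth g \<Longrightarrow> smooth (\<lambda>p. f p * g p)"
  by (rule smooth_closure_smooth[OF smooth_closure.mult[OF smooth_closure.base smooth_closure.base]])

lemma smooth_cmult : "smooth f \<Longrightarrow> smooth (\<lambda>p. c * f p)"
  by (intro smooth_mult smooth_const)

lemma smooth_sum: "(\<And>i. i \<in> A \<Longrightarrow> smooth (f i)) \<Longrightarrow> smooth (\<lambda>p. \<Sum>i\<in>A. f i p)"
  by (induction A rule: infinite_finite_induct) (simp_all add: smooth_const smooth_add)

text \<open>\<open>e^5 + i e^6\<close> is \<open>dz_3 - z_1 dz_2\<close>, so the fields dual to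
  \<open>e^3\<close> and \<open>e^4\<close> must move \<open>z_3\<close> by \<open>z_1\<close> times
  the motion of \<open>z_2\<close>; the other four fields are constant.\<close>

definition invfield :: "nat \<Rightarrow> pt \<Rightarrow> pt" where
  "invfield k p = (if k = 1 then (1,0,0) else if k = 2 then (\<i>,0,0)
     else if k = 3 then (0,1,fst p) else if k = 4 then (0,\<i>,\<i> * fst p)
     else if k = 5 then (0,0,1) else (0,0,\<i>))"

lemma atLeast1_atMost6: "{1..6::nat} = {1,2,3,4,5,6}"
  by auto

lemma Efr_eq: "k \<in> {1..6} \<Longrightarrow> Efr k p = invfield k p"
  unfolding Efr_def
proof (rule the_equality)
  assume k: "k \<in> {1..6}"
  then show "\<forall>j\<in>{1..6}. ecov j p (invfield k p) = (if j = k then 1 else 0)"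
    unfolding atLeast1_atMost6 by (auto simp: ecov_def invfield_def Let_def)
  fix v assume "\<forall>j\<in>{1..6}. ecov j p v = (if j = k then 1 else 0)"
  then show "v = invfield k p" using k unfolding atLeast1_atMost6
    by (auto simp: ecov_def invfield_def Let_def prod_eq_iff complex_eq_iff)
qed

definition Ederiv :: "nat \<Rightarrow> (pt \<Rightarrow> complex) \<Rightarrow> pt \<Rightarrow> complex" where
  "Ederiv k f p = frechet_derivative f (at p) (Efr k p)"

lemma linear_frechet: "smooth f \<Longrightarrow> linear (frechet_derivative f (at p))"
  using smooth_differentiable linear_frechet_derivative by blast

text \<open>The derivative is only real linear, so the point-dependent third component of
  \<open>E_3\<close> and \<open>E_4\<close> is split into real and imaginary part. Their derivations
  become combinations of derivatives in fixed directions, with coefficients that are real linear in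
  \<open>z_1\<close>.\<close>

lemma frechet_pair3:
  assumes "smooth f"
  shows "frechet_derivative f (at p) (0, b, w) = frechet_derivative f (at p) (0, b, 0)
    + complex_of_real (Re w) * frechet_derivative f (at p) (0, 0, 1)
    + complex_of_real (Im w) * frechet_derivative f (at p) (0, 0, \<i>)"
proof -
  have "(0, b, w) = (0, b, 0) + Re w *\<^sub>R (0, 0, 1) + Im w *\<^sub>R (0::complex, 0::complex, \<i>)"
    by (auto simp: complex_eq_iff)
  then have "frechet_derivative f (at p) (0, b, w)
      = frechet_derivative f (at p) ((0, b, 0) + Re w *\<^sub>R (0, 0, 1) + Im w *\<^sub>R (0::complex, 0::complex, \<i>))"
    by simp
  also have "\<dots> = frechet_derivative f (at p) (0, b, 0)
    + complex_of_real (Re w) * frechet_derivative f (at p) (0, 0, 1)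
    + complex_of_real (Im w) * frechet_derivative f (at p) (0, 0, \<i>)"
    using linear_frechet[OF assms, of p]
    by (simp only: linear_add linear_scale scaleR_conv_of_real)
  finally show ?thesis .
qed

lemma bounded_linear_of_real_Re_fst:
  "bounded_linear (\<lambda>p::pt. complex_of_real (Re (c * fst p)))"
  "bounded_linear (\<lambda>p::pt. complex_of_real (Im (c * fst p)))"
  by (intro bounded_linear_intros bounded_linear_compose[OF bounded_linear_of_real]
      bounded_linear_compose[OF bounded_linear_Re] bounded_linear_compose[OF bounded_linear_Im]
      bounded_linear_compose[OF bounded_linear_mult_right] bounded_linear_fst)+

lemma smooth_Ederiv:
  assumes f: "smooth f" and k: "k \<in> {1..6}"
  shows "smooth (Ederiv k f)"
proof -
  have *: "smooth (\<lambda>p. frechet_derivative f (at p) (0, b, b * fst p))" for b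
    unfolding frechet_pair3[OF f, of _ _ "_ * _"]
    by (intro smooth_add smooth_mult smooth_derivative f smooth_linear bounded_linear_of_real_Re_fst)
  show ?thesis
    using k *[of 1] *[of \<i>] unfolding atLeast1_atMost6
    by (auto simp: Ederiv_def[abs_def] Efr_eq[unfolded atLeast1_atMost6] invfield_def
        intro!: smooth_derivative f)
qed

lemma Ederiv_const [simp]: "Ederiv k (\<lambda>p. c) = (\<lambda>p. 0)"
  by (auto simp: Ederiv_def)

lemma Ederiv_add:
  "smooth f \<Longrightarrow> smooth g \<Longrightarrow> Ederiv k (\<lambda>p. f p + g p) p = Ederiv k f p + Ederiv k g p"
  unfolding Ederiv_def
  by (subst frechet_derivative_at[symmetric, OF has_derivative_add[OF smooth_has_derivative smooth_has_derivative]]) auto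

lemma Ederiv_mult:
  "smooth f \<Longrightarrow> smooth g \<Longrightarrow> Ederiv k (\<lambda>p. f p * g p) p = f p * Ederiv k g p + Ederiv k f p * g p"
  unfolding Ederiv_def
  by (subst frechet_derivative_at[symmetric, OF has_derivative_mult[OF smooth_has_derivative smooth_has_derivative]]) auto

lemma Ederiv_cnj: "smooth f \<Longrightarrow> Ederiv k (\<lambda>p. cnj (f p)) p = cnj (Ederiv k f p)"
  unfolding Ederiv_def
  by (subst frechet_derivative_at[symmetric, OF has_derivative_cnj[OF smooth_has_derivative]]) auto

lemma Ederiv_cmult: "smooth f \<Longrightarrow> Ederiv k (\<lambda>p. c * f p) p = c * Ederiv k f p"
  by (simp add: Ederiv_mult smooth_const)

lemma Ederiv_sum:
  "(\<And>i. i \<in> A \<Longrightarrow> smooth (f i)) \<Longrightarrow> Ederiv k (\<lambda>p. \<Sum>i\<in>A. f i p) p = (\<Sum>i\<in>A. Ederiv k (f i) p)"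
  by (induction A rule: infinite_finite_induct) (auto simp: Ederiv_add smooth_sum)

text \<open>The differential \<open>?L\<close> of left translation by \<open>a\<close> carries the
  frame at \<open>z\<close> to the frame at \<open>hmul a z\<close>; the chain rule applied to
  \<open>f (hmul a x) = f x\<close> gives the claim.\<close>

lemma ginv_Ederiv:
  assumes f: "smooth f" "ginv f" and k: "k \<in> {1..6}"
  shows "ginv (Ederiv k f)"
  unfolding ginv_def
proof (intro ballI allI)
  fix a z assume a: "a \<in> Gamma"
  let ?L = "\<lambda>v::pt. (fst v, fst (snd v), fst a * fst (snd v) + snd (snd v))"
  have L: "(hmul a has_derivative ?L) (at z)"
    unfolding hmul_def by (auto intro!: derivative_eq_intros)
  have D: "((\<lambda>x. f (hmul a x)) has_derivative (\<lambda>v. frechet_derivative f (at (hmul a z)) (?L v))) (at z)"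
    using diff_chain_at[OF L smooth_has_derivative[OF f(1)]] by (simp add: o_def)
  have "(\<lambda>x. f (hmul a x)) = f" using f(2) a by (auto simp: ginv_def)
  then have "frechet_derivative f (at z) = (\<lambda>v. frechet_derivative f (at (hmul a z)) (?L v))"
    using frechet_derivative_at[OF D] by simp
  moreover have "?L (invfield k z) = invfield k (hmul a z)"
    by (simp add: invfield_def hmul_def algebra_simps)
  ultimately show "Ederiv k f (hmul a z) = Ederiv k f z"
    by (simp add: Ederiv_def Efr_eq[OF k])
qed

lemma ginv_const: "ginv (\<lambda>p. c)"
  and ginv_add: "ginv f \<Longrightarrow> ginv g \<Longrightarrow> ginv (\<lambda>p. f p + g p)"
  and ginv_mult: "ginv f \<Longrightarrow> ginv g \<Longrightarrow> ginv (\<lambda>p. f p * g p)"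
  and ginv_cnj: "ginv f \<Longrightarrow> ginv (\<lambda>p. cnj (f p))"
  and ginv_sum: "(\<And>i. i \<in> A \<Longrightarrow> ginv (h i)) \<Longrightarrow> ginv (\<lambda>p. \<Sum>i\<in>A. h i p)"
  by (auto simp: ginv_def)

section \<open>Symmetry of second derivatives and the commuting pairs of fields\<close>

lemma has_vector_derivative_along:
  assumes "smooth f"
  shows "((\<lambda>s. f (q + s *\<^sub>R u)) has_vector_derivative frechet_derivative f (at (q + s *\<^sub>R u)) u) (at s within S)"
proof -
  have "((\<lambda>s. q + s *\<^sub>R u) has_derivative (\<lambda>h. h *\<^sub>R u)) (at s within S)"
    by (auto intro!: derivative_eq_intros)
  from has_derivative_compose[OF this smooth_has_derivative[OF assms]]
  show ?thesis unfolding has_vector_derivative_def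
    using linear_frechet[OF assms] by (simp add: linear_scale)
qed

text \<open>Differentiating \<open>f (q + s u) - f q = \<integral> D\<^sub>u f (q + r u) dr\<close> in the direction v under the
  integral sign, and then in s at 0, exchanges the two derivatives.\<close>
lemma smooth_second_derivative_symmetric:
  assumes f: "smooth f"
  shows "frechet_derivative (\<lambda>p. frechet_derivative f (at p) u) (at q) v
       = frechet_derivative (\<lambda>p. frechet_derivative f (at p) v) (at q) u"
proof -
  define fu where "fu = (\<lambda>p. frechet_derivative f (at p) u)"
  define fv where "fv = (\<lambda>p. frechet_derivative f (at p) v)"
  define fuv where "fuv = (\<lambda>p. frechet_derivative fu (at p) v)"
  have su: "smooth fu" and sv: "smooth fv" and suv: "smooth fuv"
    unfolding fu_def fv_def fuv_def by (intro smooth_derivative f)+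
  have cont: "continuous_on S (\<lambda>x. g (h x))" if "smooth g" "continuous_on S h"
    for g and h :: "'a::topological_space \<Rightarrow> pt" and S
    using continuous_on_compose2[OF smooth_continuous[OF that(1)] that(2)] by blast
  have ftc: "integral (cbox 0 s) (\<lambda>r. fu (q' + r *\<^sub>R u)) = f (q' + s *\<^sub>R u) - f q'" if "0 \<le> s" for q' s
    using fundamental_theorem_of_calculus[OF that has_vector_derivative_along[OF f, of q' u]]
    by (simp add: fu_def integral_unique)
  have key: "integral {0..s} (\<lambda>r. fuv (q + r *\<^sub>R u)) = fv (q + s *\<^sub>R u) - fv q" if s: "0 \<le> s" for s
  proof -
    have "((\<lambda>t. integral (cbox 0 s) (\<lambda>r. fu (q + r *\<^sub>R u + t *\<^sub>R v))) has_vector_derivative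
        integral (cbox 0 s) (\<lambda>r. fuv (q + r *\<^sub>R u + 0 *\<^sub>R v))) (at 0 within UNIV)"
    proof (rule leibniz_rule_vector_derivative)
      show "((\<lambda>t. fu (q + r *\<^sub>R u + t *\<^sub>R v)) has_vector_derivative fuv (q + r *\<^sub>R u + t *\<^sub>R v)) (at t)" for t r
        unfolding fuv_def by (rule has_vector_derivative_along[OF su])
      show "(\<lambda>r. fu (q + r *\<^sub>R u + t *\<^sub>R v)) integrable_on cbox 0 s" for t
        by (intro integrable_continuous cont su continuous_intros)
      show "continuous_on (UNIV \<times> cbox 0 s) (\<lambda>(t, r). fuv (q + r *\<^sub>R u + t *\<^sub>R v))"
        unfolding split_beta by (intro cont suv continuous_intros)
    qed auto
    moreover have "(\<lambda>t. integral (cbox 0 s) (\<lambda>r. fu (q + r *\<^sub>R u + t *\<^sub>R v)))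
        = (\<lambda>t. f (q + s *\<^sub>R u + t *\<^sub>R v) - f (q + t *\<^sub>R v))"
      using ftc[OF s, of "q + t *\<^sub>R v" for t] by (simp add: add.commute add.left_commute)
    moreover have "((\<lambda>t. f (q + s *\<^sub>R u + t *\<^sub>R v) - f (q + t *\<^sub>R v)) has_vector_derivative
        fv (q + s *\<^sub>R u + 0 *\<^sub>R v) - fv (q + 0 *\<^sub>R v)) (at 0)"
      unfolding fv_def by (intro has_vector_derivative_diff has_vector_derivative_along f)
    ultimately show ?thesis by (simp add: vector_derivative_unique_at)
  qed
  have "((\<lambda>s. integral {0..s} (\<lambda>r. fuv (q + r *\<^sub>R u))) has_vector_derivative fuv (q + 0 *\<^sub>R u)) (at 0 within {0..1})"
    by (rule integral_has_vector_derivative) (auto intro!: cont suv continuous_intros)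
  then have "((\<lambda>s. fv (q + s *\<^sub>R u) - fv q) has_vector_derivative fuv (q + 0 *\<^sub>R u)) (at 0 within {0..1})"
    by (rule has_vector_derivative_transform[rotated 2]) (auto simp: key)
  moreover have "((\<lambda>s. fv (q + s *\<^sub>R u) - fv q) has_vector_derivative
      frechet_derivative fv (at (q + 0 *\<^sub>R u)) u - 0) (at 0 within {0..1})"
    by (intro has_vector_derivative_diff has_vector_derivative_along sv has_vector_derivative_const)
  ultimately have "fuv q = frechet_derivative fv (at q) u"
    using vector_derivative_unique_within[of 0 "{0..1::real}"]
    by (simp add: at_within_Icc_at_right trivial_limit_at_right_real)
  then show ?thesis by (simp add: fuv_def fu_def fv_def)
qed

lemma Ederiv_commute:
  assumes f: "smooth f" and jk: "(j, k) \<in> {(1, 6), (2, 5), (3, 4)}"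
  shows "Ederiv j (Ederiv k f) p = Ederiv k (Ederiv j f) p"
proof -
  \<comment> \<open>A direction with zero first component leaves \<open>z_1\<close> fixed, so the
    coefficient of \<open>E_3\<close> or \<open>E_4\<close> may be frozen at \<open>p\<close>. This
    reduces the pair (3, 4) to second derivatives in fixed directions.\<close>
  have const: "frechet_derivative (\<lambda>q. frechet_derivative f (at q) (0, b, b * fst q)) (at p) (0, c, d)
     = frechet_derivative (\<lambda>q. frechet_derivative f (at q) (0, b, b * fst p)) (at p) (0, c, d)" for b c d
  proof -
    have "smooth (\<lambda>q. frechet_derivative f (at q) (0, b, b * fst q))"
      unfolding frechet_pair3[OF f, of _ _ "_ * _"]
      by (intro smooth_add smooth_mult smooth_derivative f smooth_linear bounded_linear_of_real_Re_fst)
    from has_vector_derivative_along[OF this, of p "(0,c,d)" 0 UNIV]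
      has_vector_derivative_along[OF smooth_derivative[OF f, of "(0, b, b * fst p)"], of p "(0,c,d)" 0 UNIV]
    show ?thesis
      by (simp only: fst_add fst_scaleR fst_conv scaleR_zero_right add_0_right) (drule (1) vector_derivative_unique_at, simp add: zero_prod_def[symmetric])
  qed
  note sym = smooth_second_derivative_symmetric[OF f]
  consider "j = 1" "k = 6" | "j = 2" "k = 5" | "j = 3" "k = 4" using jk by auto
  then show ?thesis
  proof cases
    case 1
    then show ?thesis
      using sym[of "(0,0,\<i>)" p "(1,0,0)"] by (simp add: Ederiv_def[abs_def] Efr_eq invfield_def)
  next
    case 2
    then show ?thesis
      using sym[of "(0,0,1)" p "(\<i>,0,0)"] by (simp add: Ederiv_def[abs_def] Efr_eq invfield_def)
  next
    case 3
    have "Ederiv 3 (Ederiv 4 f) p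
        = frechet_derivative (\<lambda>q. frechet_derivative f (at q) (0, \<i>, \<i> * fst p)) (at p) (0, 1, fst p)"
      using const[of \<i> 1 "fst p"] by (simp add: Ederiv_def[abs_def] Efr_eq invfield_def)
    also have "\<dots> = frechet_derivative (\<lambda>q. frechet_derivative f (at q) (0, 1, 1 * fst p)) (at p) (0, \<i>, \<i> * fst p)"
      using sym by simp
    also have "\<dots> = Ederiv 4 (Ederiv 3 f) p"
      using const[of 1 \<i> "\<i> * fst p"] by (simp add: Ederiv_def[abs_def] Efr_eq invfield_def)
    finally show ?thesis using 3 by simp
  qed
qed

section \<open>Integration over the fundamental domain\<close>

abbreviation unit_square :: "complex set" where "unit_square \<equiv> cbox 0 (Complex 1 1)"

lemma fdom_eq_cbox: "fdom = cbox (0, 0, 0) (Complex 1 1, Complex 1 1, Complex 1 1)"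
  by (auto simp: fdom_def in_cbox_complex_iff cbox_Pair_iff)

lemma content_cbox_complex:
  "measure lborel (cbox a b :: complex set) = measure lborel (cbox (Re a, Im a) (Re b, Im b))"
proof (cases "cbox a b = {}")
  case True
  then have "\<not> (Re a \<le> Re b \<and> Im a \<le> Im b)"
    using in_cbox_complex_iff[of a a b] by auto
  with True show ?thesis by (auto simp: content_Pair)
next
  case False
  then have "Re a \<le> Re b" "Im a \<le> Im b"
    by (auto simp: in_cbox_complex_iff)
  with False show ?thesis
    by (simp add: content_cbox' content_Pair Basis_complex_def)
qed

text \<open>Identifying complex numbers with pairs of reals preserves boxes and their content, so
  \<open>has_integral_twiddle\<close> moves the integral to the product, where Fubini
  applies.\<close>

lemma integral_complex_iterated:
  fixes F :: "complex \<Rightarrow> complex"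
  assumes "continuous_on UNIV F"
  shows "integral (cbox a b) F
    = integral (cbox (Re a) (Re b)) (\<lambda>x. integral (cbox (Im a) (Im b)) (\<lambda>y. F (Complex x y)))"
proof -
  let ?g = "\<lambda>(x, y). Complex x y" and ?h = "\<lambda>z. (Re z, Im z)"
  have g: "?g ` cbox u v = cbox (Complex (fst u) (snd u)) (Complex (fst v) (snd v))" for u v
  proof -
    have "z \<in> ?g ` cbox u v \<longleftrightarrow> (Re z, Im z) \<in> cbox u v" for z
      by (force simp: image_iff)
    then show ?thesis
      by (cases u; cases v) (auto simp: in_cbox_complex_iff cbox_Pair_iff simp del: image_iff)
  qed
  have h: "?h ` cbox u v = cbox (Re u, Im u) (Re v, Im v)" for u v
  proof -
    have "p \<in> ?h ` cbox u v \<longleftrightarrow> Complex (fst p) (snd p) \<in> cbox u v" for p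
      by (force simp: image_iff prod_eq_iff complex_eq_iff)
    then show ?thesis
      by (auto simp: in_cbox_complex_iff cbox_Pair_iff simp del: image_iff)
  qed
  have int: "(F has_integral integral (cbox a b) F) (cbox a b)"
    using assms continuous_on_subset integrable_continuous integrable_integral by blast
  have contg: "continuous_on UNIV ?g"
    unfolding split_beta Complex_eq by (intro continuous_intros)
  have "((\<lambda>p. F (?g p)) has_integral (1 / 1) *\<^sub>R integral (cbox a b) F) (?h ` cbox a b)"
  proof (rule has_integral_twiddle[OF _ _ _ _ _ _ _ int])
    show "continuous (at p) ?g" for p
      using contg by (simp add: continuous_on_eq_continuous_at del: split_paired_All)
    show "measure lborel (?g ` cbox u v) = 1 * measure lborel (cbox u v)" for u v
      unfolding g content_cbox_complex by (cases u; cases v) simp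
    show "\<exists>w z. ?g ` cbox u v = cbox w z" for u v using g by blast
    show "\<exists>w z. ?h ` cbox u v = cbox w z" for u v using h by blast
  qed auto
  then have "integral (cbox a b) F = integral (cbox (Re a, Im a) (Re b, Im b)) (\<lambda>p. F (?g p))"
    unfolding h by (simp add: integral_unique)
  also have "continuous_on (cbox (Re a, Im a) (Re b, Im b)) (\<lambda>p. F (?g p))"
    by (rule continuous_on_compose2[OF assms continuous_on_subset[OF contg]]) auto
  note integral_prod_continuous[OF this]
  finally show ?thesis by simp
qed

lemma integral_periodic_shift:
  fixes g :: "real \<Rightarrow> complex"
  assumes cont: "continuous_on UNIV g" and per: "\<And>x. g (x + 1) = g x"
  shows "integral {0..1} (\<lambda>x. g (x + t)) = integral {0..1} g"
proof -
  \<comment> \<open>Whole periods of \<open>t\<close> do not matter. For the remaining shift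
    \<open>s\<close> the window [s, 1 + s] is cut at 1 and its right piece is moved back by one
    period.\<close>
  define s where "s = frac t"
  have s: "0 \<le> s" "s \<le> 1" by (auto simp: s_def frac_lt_1 less_imp_le)
  have nat: "g (x + real n) = g x" for n x
    by (induction n) (simp_all add: per add.assoc[symmetric] add.commute[of 1])
  have int: "g (x + of_int n) = g x" for n x
    using nat[of x "nat n"] nat[of "x + of_int n" "nat (- n)"] by (cases "n \<ge> 0") auto
  have io: "g integrable_on {a..b}" for a b
    using cont continuous_on_subset integrable_continuous_interval by blast
  have shift: "integral {a..b} (\<lambda>x. g (x + c)) = integral {a+c..b+c} g" for a b c
    using integral_shift_cbox_plus[of a b g c] by (simp add: o_def add.commute)
  have "integral {0..1} (\<lambda>x. g (x + t)) = integral {0..1} (\<lambda>x. g (x + s))"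
    using int[of "_ + s" "\<lfloor>t\<rfloor>"] by (simp add: s_def frac_def add.assoc)
  also have "\<dots> = integral {s..1 + s} g" by (simp add: shift)
  also have "\<dots> = integral {s..1} g + integral {1..1 + s} g"
    using Henstock_Kurzweil_Integration.integral_combine[of s 1 "1 + s" g] s io by simp
  also have "integral {1..1 + s} g = integral {0..s} g"
    using shift[of 0 s 1] per by (simp add: add.commute)
  also have "integral {s..1} g + integral {0..s} g = integral {0..1} g"
    using Henstock_Kurzweil_Integration.integral_combine[of 0 s 1 g] s io by (simp add: add.commute)
  finally show ?thesis .
qed

text \<open>A lattice translation in \<open>z_1\<close> shears \<open>z_3\<close> by a multiple of
  \<open>z_2\<close>, an arbitrary complex number rather than a lattice point. This lemma absorbs
  that shear.\<close>

lemma integral_unit_square_shift: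
  fixes F :: "complex \<Rightarrow> complex"
  assumes cont: "continuous_on UNIV F" and per: "\<And>z. F (z + 1) = F z" "\<And>z. F (z + \<i>) = F z"
  shows "integral unit_square (\<lambda>z. F (z + w)) = integral unit_square F"
proof -
  have contC: "continuous_on S (\<lambda>x. F (h x))" if "continuous_on S h" for h :: "'a::topological_space \<Rightarrow> complex" and S
    by (rule continuous_on_compose2[OF cont that]) auto
  define H where "H x = integral {0..1} (\<lambda>y. F (Complex x y))" for x
  have "integral unit_square (\<lambda>z. F (z + w))
      = integral {0..1} (\<lambda>x. integral {0..1} (\<lambda>y. F (Complex (x + Re w) (y + Im w))))"
    by (subst integral_complex_iterated) (auto intro!: contC continuous_intros simp: plus_complex.code)
  also have "\<dots> = integral {0..1} (\<lambda>x. H (x + Re w))"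
    unfolding H_def
  proof (rule Henstock_Kurzweil_Integration.integral_cong, rule integral_periodic_shift)
    show "continuous_on UNIV (\<lambda>y. F (Complex x y))" for x
      unfolding Complex_eq by (intro contC continuous_intros)
    show "F (Complex x (y + 1)) = F (Complex x y)" for x y
      using per(2)[of "Complex x y"] by (simp add: plus_complex.code)
  qed
  also have "\<dots> = integral {0..1} H"
  proof (rule integral_periodic_shift)
    have "continuous_on UNIV (\<lambda>x. integral (cbox 0 1) (\<lambda>y. F (Complex x y)))"
      by (rule integral_continuous_on_param)
        (auto simp: split_beta Complex_eq intro!: contC continuous_intros)
    then show "continuous_on UNIV H" by (simp add: H_def)
    show "H (x + 1) = H x" for x
      using per(1)[of "Complex x _"] by (simp add: H_def plus_complex.code)
  qed
  also have "\<dots> = integral unit_square F"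
    by (subst integral_complex_iterated[OF cont]) (simp add: H_def[abs_def])
  finally show ?thesis .
qed

text \<open>The fundamental theorem of calculus in the direction \<open>u\<close> leaves the
  difference of two opposite edges, parametrised by the other unit direction. The edges are not
  cancelled here because each coordinate of the group has its own kind of periodicity.\<close>

lemma integral_unit_square_derivative:
  fixes F F' :: "complex \<Rightarrow> complex"
  assumes u: "u \<in> {1, \<i>}" and cont: "continuous_on UNIV F'"
    and D: "\<And>z t. ((\<lambda>t. F (z + t *\<^sub>R u)) has_vector_derivative F' (z + t *\<^sub>R u)) (at t)"
  shows "integral unit_square F'
    = integral {0..1} (\<lambda>t. F (u + t *\<^sub>R (if u = 1 then \<i> else 1)) - F (t *\<^sub>R (if u = 1 then \<i> else 1)))"
proof -
  have contC: "continuous_on S (\<lambda>x. F' (h x))" if "continuous_on S h" for h :: "'a::topological_space \<Rightarrow> complex" and S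
    by (rule continuous_on_compose2[OF cont that]) auto
  have ftc: "integral {0..1} (\<lambda>t. F' (z + t *\<^sub>R u)) = F (z + u) - F z" for z
  proof -
    have "((\<lambda>t. F' (z + t *\<^sub>R u)) has_integral F (z + 1 *\<^sub>R u) - F (z + 0 *\<^sub>R u)) {0..1}"
      by (rule fundamental_theorem_of_calculus[OF _ has_vector_derivative_at_within[OF D]]) simp
    then show ?thesis by (simp add: integral_unique)
  qed
  have it: "integral unit_square F' = integral {0..1} (\<lambda>x. integral {0..1} (\<lambda>y. F' (Complex x y)))"
    by (subst integral_complex_iterated[OF cont]) simp
  consider "u = 1" | "u = \<i>" using u by blast
  then show ?thesis
  proof cases
    case 1
    have "integral unit_square F' = integral {0..1} (\<lambda>y. integral {0..1} (\<lambda>x. F' (Complex x y)))"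
      unfolding it using integral_swap_continuous[of 0 0 1 1 "\<lambda>x y. F' (Complex x y)"]
      by (simp add: split_beta Complex_eq contC continuous_intros)
    also have "\<dots> = integral {0..1} (\<lambda>y. integral {0..1} (\<lambda>x. F' (y *\<^sub>R \<i> + x *\<^sub>R u)))"
      by (simp add: 1 Complex_eq scaleR_conv_of_real mult.commute add.commute)
    finally show ?thesis unfolding ftc by (simp add: 1 add.commute)
  next
    case 2
    have "integral unit_square F' = integral {0..1} (\<lambda>x. integral {0..1} (\<lambda>y. F' (x *\<^sub>R 1 + y *\<^sub>R u)))"
      unfolding it by (simp add: 2 Complex_eq scaleR_conv_of_real mult.commute)
    then show ?thesis unfolding ftc by (simp add: 2 add.commute)
  qed
qed

section \<open>Derivatives of invariant functions along the frame integrate to zero\<close>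

lemma integral_fdom_iterated:
  fixes H :: "pt \<Rightarrow> complex"
  assumes "continuous_on UNIV H"
  shows "integral fdom H = integral unit_square (\<lambda>z1. integral unit_square (\<lambda>z2. integral unit_square (\<lambda>z3. H (z1, z2, z3))))"
proof -
  have cont: "continuous_on S (\<lambda>x. H (h x))" if "continuous_on S h" for h :: "'a::topological_space \<Rightarrow> pt" and S
    by (rule continuous_on_compose2[OF assms that]) auto
  show ?thesis unfolding fdom_eq_cbox
    by (subst integral_prod_continuous, (intro cont continuous_intros),
        subst integral_prod_continuous, (intro cont continuous_intros)) simp
qed

context
  fixes h :: "pt \<Rightarrow> complex"
  assumes smooth: "smooth h" and ginv: "ginv h"
begin

lemma period_translate:
  assumes "gauss g"
  shows "h (z1 + g, z2, z3 + g * z2) = h (z1, z2, z3)"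
    and "h (z1, z2 + g, z3) = h (z1, z2, z3)"
    and "h (z1, z2, z3 + g) = h (z1, z2, z3)"
proof -
  have "h (hmul a z) = h z" if "a \<in> Gamma" for a z
    using ginv that unfolding ginv_def by blast
  from this[of "(g, 0, 0)" "(z1, z2, z3)"] this[of "(0, g, 0)" "(z1, z2, z3)"] this[of "(0, 0, g)" "(z1, z2, z3)"]
  show "h (z1 + g, z2, z3 + g * z2) = h (z1, z2, z3)"
    and "h (z1, z2 + g, z3) = h (z1, z2, z3)"
    and "h (z1, z2, z3 + g) = h (z1, z2, z3)"
    using assms by (auto simp: Gamma_def hmul_def gauss_def add.commute)
qed

lemma continuous_on_compose_derivative:
  fixes q :: "'a::topological_space \<Rightarrow> pt"
  assumes "continuous_on S q"
  shows "continuous_on S (\<lambda>x. h (q x))"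
    and "continuous_on S (\<lambda>x. frechet_derivative h (at (q x)) v)"
  by (rule continuous_on_compose2[OF smooth_continuous assms]; use smooth smooth_derivative in auto)+

lemma integral_dz3:
  assumes "u \<in> {1, \<i>}"
  shows "integral unit_square (\<lambda>z3. frechet_derivative h (at (z1, z2, z3)) (0, 0, u)) = 0"
proof -
  have "integral unit_square (\<lambda>z3. frechet_derivative h (at (z1, z2, z3)) (0, 0, u))
      = integral {0..1} (\<lambda>t. h (z1, z2, u + t *\<^sub>R (if u = 1 then \<i> else 1)) - h (z1, z2, t *\<^sub>R (if u = 1 then \<i> else 1)))"
    using has_vector_derivative_along[OF smooth, of "(z1, z2, _)" "(0, 0, u)"]
    by (intro integral_unit_square_derivative[OF assms])
      (auto intro!: continuous_on_compose_derivative continuous_intros)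
  also have "\<dots> = 0"
  proof -
    have "h (z1, z2, u + z) = h (z1, z2, z)" for z
      using assms period_translate(3)[of u z1 z2 z] by (auto simp: gauss_def add.commute)
    then show ?thesis by simp
  qed
  finally show ?thesis .
qed

lemma integral_dz2:
  assumes "u \<in> {1, \<i>}"
  shows "integral unit_square (\<lambda>z2. frechet_derivative h (at (z1, z2, z3)) (0, u, 0)) = 0"
proof -
  have "integral unit_square (\<lambda>z2. frechet_derivative h (at (z1, z2, z3)) (0, u, 0))
      = integral {0..1} (\<lambda>t. h (z1, u + t *\<^sub>R (if u = 1 then \<i> else 1), z3) - h (z1, t *\<^sub>R (if u = 1 then \<i> else 1), z3))"
    using has_vector_derivative_along[OF smooth, of "(z1, _, z3)" "(0, u, 0)"]
    by (intro integral_unit_square_derivative[OF assms, where F = "\<lambda>z. h (z1, z, z3)"])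
      (auto intro!: continuous_on_compose_derivative continuous_intros)
  also have "\<dots> = 0"
  proof -
    have "h (z1, u + z, z3) = h (z1, z, z3)" for z
      using assms period_translate(2)[of u z1 z z3] by (auto simp: gauss_def add.commute)
    then show ?thesis by simp
  qed
  finally show ?thesis .
qed

text \<open>\<open>h\<close> need not be periodic in \<open>z_1\<close> alone: opposite faces are
  glued by a translation of \<open>z_3\<close> that depends on \<open>z_2\<close>. The
  \<open>z_1\<close> integration is therefore done innermost, and the face difference cancels only
  after integrating over \<open>z_3\<close>, where that translation becomes invisible.\<close>

lemma integral_dz1:
  assumes "u \<in> {1, \<i>}"
  shows "integral fdom (\<lambda>p. frechet_derivative h (at p) (u, 0, 0)) = 0"
proof -
  define u' where "u' = (if u = 1 then \<i> else 1)"
  let ?Q = "cbox (0, 0) (Complex 1 1, Complex 1 1)"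
  have Q: "integral ?Q g = integral unit_square (\<lambda>z2. integral unit_square (\<lambda>z3. g (z2, z3)))"
    if "continuous_on ?Q g" for g :: "complex \<times> complex \<Rightarrow> complex"
    by (rule integral_prod_continuous[OF that])
  have "integral fdom (\<lambda>p. frechet_derivative h (at p) (u, 0, 0))
      = integral unit_square (\<lambda>z1. integral ?Q (\<lambda>q. frechet_derivative h (at (z1, q)) (u, 0, 0)))"
    unfolding fdom_eq_cbox
    by (rule integral_prod_continuous) (auto intro!: continuous_on_compose_derivative continuous_intros)
  also have "\<dots> = integral ?Q (\<lambda>q. integral unit_square (\<lambda>z1. frechet_derivative h (at (z1, q)) (u, 0, 0)))"
    by (rule integral_swap_continuous)
      (auto simp: split_beta intro!: continuous_on_compose_derivative continuous_intros)
  also have "\<dots> = integral ?Q (\<lambda>q. integral {0..1} (\<lambda>t. h (u + t *\<^sub>R u', q) - h (t *\<^sub>R u', q)))"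
  proof (rule Henstock_Kurzweil_Integration.integral_cong)
    fix q
    show "integral unit_square (\<lambda>z1. frechet_derivative h (at (z1, q)) (u, 0, 0))
        = integral {0..1} (\<lambda>t. h (u + t *\<^sub>R u', q) - h (t *\<^sub>R u', q))"
      unfolding u'_def
      using has_vector_derivative_along[OF smooth, of "(_, q)" "(u, 0, 0)"]
      by (intro integral_unit_square_derivative[OF assms, where F = "\<lambda>z. h (z, q)"])
        (auto intro!: continuous_on_compose_derivative continuous_intros simp: zero_prod_def[symmetric])
  qed
  also have "\<dots> = integral (cbox 0 1) (\<lambda>t. integral ?Q (\<lambda>q. h (u + t *\<^sub>R u', q) - h (t *\<^sub>R u', q)))"
    unfolding cbox_interval[symmetric]
    by (rule integral_swap_continuous)
      (auto simp: split_beta intro!: continuous_on_compose_derivative continuous_intros)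
  also have "\<dots> = integral (cbox 0 1) (\<lambda>t::real. 0::complex)"
  proof (rule Henstock_Kurzweil_Integration.integral_cong)
    fix t :: real
    have per: "h (z1, z2, z + 1) = h (z1, z2, z)" "h (z1, z2, z + \<i>) = h (z1, z2, z)" for z1 z2 z
      using period_translate(3)[of 1] period_translate(3)[of \<i>] by (auto simp: gauss_def)
    have g: "gauss u" using assms by (auto simp: gauss_def)
    have "integral ?Q (\<lambda>q. h (u + t *\<^sub>R u', q)) = integral unit_square (\<lambda>z2. integral unit_square (\<lambda>z3. h (u + t *\<^sub>R u', z2, z3)))"
      by (rule Q) (intro continuous_on_compose_derivative continuous_intros)
    also have "\<dots> = integral unit_square (\<lambda>z2. integral unit_square (\<lambda>z3. h (t *\<^sub>R u', z2, z3 + - u * z2)))"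
    proof -
      have "h (u + t *\<^sub>R u', z2, z3) = h (t *\<^sub>R u', z2, z3 + - u * z2)" for z2 z3
        using period_translate(1)[OF g, of "t *\<^sub>R u'" z2 "z3 - u * z2"] by (simp add: add.commute)
      then show ?thesis by simp
    qed
    also have "\<dots> = integral unit_square (\<lambda>z2. integral unit_square (\<lambda>z3. h (t *\<^sub>R u', z2, z3)))"
      by (intro Henstock_Kurzweil_Integration.integral_cong integral_unit_square_shift per)
        (intro continuous_on_compose_derivative continuous_intros)
    also have "\<dots> = integral ?Q (\<lambda>q. h (t *\<^sub>R u', q))"
      by (rule Q[symmetric]) (intro continuous_on_compose_derivative continuous_intros)
    finally show "integral ?Q (\<lambda>q. h (u + t *\<^sub>R u', q) - h (t *\<^sub>R u', q)) = 0"
      by (subst Henstock_Kurzweil_Integration.integral_diff)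
        (auto intro!: integrable_continuous continuous_on_compose_derivative continuous_intros)
  qed
  finally show ?thesis by simp
qed

text \<open>The factor \<open>c\<close> stands for the coefficients of the \<open>z_3\<close>
  directions in \<open>E_3\<close> and \<open>E_4\<close>; as it depends on \<open>z_1\<close> only,
  it is constant in the inner integral over \<open>z_3\<close>.\<close>

lemma integral_fdom_dz3:
  assumes "u \<in> {1, \<i>}" "continuous_on UNIV c"
  shows "integral fdom (\<lambda>p. c (fst p) * frechet_derivative h (at p) (0, 0, u)) = 0"
  by (subst integral_fdom_iterated)
    (auto intro!: continuous_intros continuous_on_compose_derivative continuous_on_compose2[OF assms(2)]
      simp: integral_dz3[OF assms(1)])

lemma integral_fdom_dz2:
  assumes "u \<in> {1, \<i>}"
  shows "integral fdom (\<lambda>p. frechet_derivative h (at p) (0, u, 0)) = 0"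
proof -
  have "integral unit_square (\<lambda>z2. integral unit_square (\<lambda>z3. frechet_derivative h (at (z1, z2, z3)) (0, u, 0))) = 0" for z1
    by (subst integral_swap_continuous)
      (auto simp: split_beta integral_dz2[OF assms] intro!: continuous_intros continuous_on_compose_derivative)
  then show ?thesis
    by (subst integral_fdom_iterated) (auto intro!: continuous_intros continuous_on_compose_derivative)
qed

lemma integral_Ederiv:
  assumes k: "k \<in> {1..6}"
  shows "integral fdom (Ederiv k h) = 0"
proof -
  have int: "H integrable_on fdom" if "continuous_on UNIV H" for H :: "pt \<Rightarrow> complex"
    unfolding fdom_eq_cbox using continuous_on_subset[OF that] integrable_continuous by blast
  have k34: "integral fdom (\<lambda>p. frechet_derivative h (at p) (0, u, u * fst p)) = 0" if u: "u \<in> {1, \<i>}" for u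
  proof -
    have c: "continuous_on UNIV (\<lambda>z. complex_of_real (Re (u * z)))" "continuous_on UNIV (\<lambda>z. complex_of_real (Im (u * z)))"
      by (intro continuous_intros)+
    show ?thesis
      unfolding frechet_pair3[OF smooth, of _ _ "_ * _"]
      using integral_fdom_dz3[OF _ c(1), of 1] integral_fdom_dz3[OF _ c(2), of \<i>] integral_fdom_dz2[OF u]
      by (subst Henstock_Kurzweil_Integration.integral_add Henstock_Kurzweil_Integration.integral_add;
          (intro int continuous_intros continuous_on_compose_derivative)?)+ simp
  qed
  have k56: "integral fdom (\<lambda>p. frechet_derivative h (at p) (0, 0, u)) = 0" if u: "u \<in> {1, \<i>}" for u
    using integral_fdom_dz3[OF u, of "\<lambda>_. 1"] by simp
  show ?thesis
    using k k34[of 1] k34[of \<i>] k56 integral_dz1 unfolding atLeast1_atMost6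
    by (auto simp: Ederiv_def[abs_def] Efr_eq[unfolded atLeast1_atMost6] invfield_def)
qed

end

section \<open>Vanishing and constancy of invariant functions\<close>

lemma fdom_translate: "\<exists>a\<in>Gamma. hmul a z \<in> fdom"
proof -
  obtain z1 z2 z3 where z: "z = (z1, z2, z3)" by (cases z)
  define fl where "fl w = Complex (of_int \<lfloor>Re w\<rfloor>) (of_int \<lfloor>Im w\<rfloor>)" for w
  have fl: "gauss (- fl w)" "0 \<le> Re (- fl w + w)" "Re (- fl w + w) \<le> 1" "0 \<le> Im (- fl w + w)" "Im (- fl w + w) \<le> 1" for w
    by (auto simp: fl_def gauss_def) linarith+
  define a1 where "a1 = - fl z1"
  \<comment> \<open>Translating \<open>z_1\<close> by \<open>a1\<close> already changes
    \<open>z_3\<close> into \<open>w\<close>, so the third floor is taken of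
    \<open>w\<close>.\<close>
  define w where "w = z3 + a1 * z2"
  have "hmul (a1, - fl z2, - fl w) z = (a1 + z1, - fl z2 + z2, - fl w + w)"
    by (simp add: hmul_def z w_def)
  moreover have "(a1, - fl z2, - fl w) \<in> Gamma" using fl by (auto simp: Gamma_def a1_def)
  moreover have "(a1 + z1, - fl z2 + z2, - fl w + w) \<in> fdom"
    using fl unfolding fdom_def a1_def by simp
  ultimately show ?thesis by metis
qed

lemma integrable_on_fdom:
  fixes f :: "pt \<Rightarrow> 'a::banach"
  shows "continuous_on UNIV f \<Longrightarrow> f integrable_on fdom"
  unfolding fdom_eq_cbox using continuous_on_subset integrable_continuous by blast

text \<open>A nonnegative continuous function with zero integral vanishes on the closed fundamental
  domain, whose translates cover the group.\<close>

lemma ginv_eq_zero_of_integral: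
  fixes f :: "pt \<Rightarrow> real"
  assumes cont: "continuous_on UNIV f" and nn: "\<And>p. f p \<ge> 0" and int: "integral fdom f = 0"
    and inv: "\<And>a z. a \<in> Gamma \<Longrightarrow> f (hmul a z) = f z"
  shows "f p = 0"
proof -
  have "box (0, 0, 0) (Complex 1 1, Complex 1 1, Complex 1 1) \<noteq> {}"
    by (auto simp: box_ne_empty Basis_complex_def Basis_prod_def)
  then have "\<forall>x\<in>fdom. f x = 0"
    using int unfolding fdom_eq_cbox
    by (subst (asm) integral_cbox_eq_0_iff) (auto intro: continuous_on_subset[OF cont] nn)
  moreover obtain a where "a \<in> Gamma" "hmul a p \<in> fdom" using fdom_translate by blast
  ultimately show ?thesis using inv by metis
qed

lemma Ederiv_integration_by_parts:
  assumes f: "smooth f" "ginv f" and g: "smooth g" "ginv g" and k: "k \<in> {1..6}"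
  shows "integral fdom (\<lambda>p. Ederiv k f p * cnj (g p)) = - integral fdom (\<lambda>p. f p * cnj (Ederiv k g p))"
proof -
  note sm = smooth_cnj[OF g(1)] smooth_Ederiv[OF f(1) k] smooth_cnj[OF smooth_Ederiv[OF g(1) k]]
  have "0 = integral fdom (Ederiv k (\<lambda>p. f p * cnj (g p)))"
    by (rule integral_Ederiv[symmetric]) (intro smooth_mult ginv_mult ginv_cnj f g sm k)+
  also have "\<dots> = integral fdom (\<lambda>p. f p * cnj (Ederiv k g p) + Ederiv k f p * cnj (g p))"
    by (intro Henstock_Kurzweil_Integration.integral_cong) (simp add: Ederiv_mult Ederiv_cnj f g sm)
  also have "\<dots> = integral fdom (\<lambda>p. f p * cnj (Ederiv k g p)) + integral fdom (\<lambda>p. Ederiv k f p * cnj (g p))"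
    by (intro Henstock_Kurzweil_Integration.integral_add integrable_on_fdom smooth_continuous smooth_mult sm f)
  finally show ?thesis by (simp add: eq_neg_iff_add_eq_0 add.commute)
qed

text \<open>For commuting fields X, Y one has \<open>\<integral>|X f + i Y f|\<^sup>2 = \<integral>|X f|\<^sup>2 + |Y f|\<^sup>2\<close>.\<close>
lemma Ederiv_eq_zero_of_CR:
  assumes f: "smooth f" "ginv f" and jk: "(j, k) \<in> {(1, 6), (2, 5), (3, 4)}"
    and CR: "\<And>p. Ederiv j f p + \<i> * Ederiv k f p = 0"
  shows "Ederiv j f p = 0" "Ederiv k f p = 0"
proof -
  have j: "j \<in> {1..6}" and k: "k \<in> {1..6}" using jk by auto
  note sj = smooth_Ederiv[OF f(1) j] and sk = smooth_Ederiv[OF f(1) k]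
  note gj = ginv_Ederiv[OF f j] and gk = ginv_Ederiv[OF f k]
  define I where "I a b = integral fdom (\<lambda>p. Ederiv a f p * cnj (Ederiv b f p))" for a b
  have "I j k = - integral fdom (\<lambda>p. f p * cnj (Ederiv j (Ederiv k f) p))"
    unfolding I_def by (rule Ederiv_integration_by_parts[OF f sk gk j])
  also have "\<dots> = - integral fdom (\<lambda>p. f p * cnj (Ederiv k (Ederiv j f) p))"
    by (simp only: Ederiv_commute[OF f(1) jk])
  also have "\<dots> = I k j"
    unfolding I_def by (rule Ederiv_integration_by_parts[OF f sj gj k, symmetric])
  finally have sym: "I j k = I k j" .
  have Ej: "Ederiv j f p = - \<i> * Ederiv k f p" for p
    using CR[of p] by (simp add: add_eq_0_iff)
  \<comment> \<open>The factor \<open>- \<i>\<close> is conjugated in the second slot only, so the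
    two cross terms have opposite signs and their equality forces \<open>I k k = 0\<close>.\<close>
  have "I j k = - \<i> * I k k" "I k j = \<i> * I k k"
    unfolding I_def Ej
    by (simp_all add: mult.assoc mult.left_commute)
  with sym have "I k k = 0" by (simp add: complex_eq_iff)
  moreover have "I k k = integral fdom (\<lambda>p. of_real ((cmod (Ederiv k f p))\<^sup>2))"
    unfolding I_def complex_norm_square by (rule refl)
  ultimately have "of_real (integral fdom (\<lambda>p. (cmod (Ederiv k f p))\<^sup>2)) = (0::complex)"
    using integral_linear[OF integrable_on_fdom bounded_linear_of_real[where 'a=complex], of "\<lambda>p. (cmod (Ederiv k f p))\<^sup>2"]
      smooth_continuous[OF sk] by (simp add: o_def continuous_intros)
  then have "(cmod (Ederiv k f p))\<^sup>2 = 0" for p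
    by (intro ginv_eq_zero_of_integral[where f = "\<lambda>p. (cmod (Ederiv k f p))\<^sup>2"])
      (use gk in \<open>auto simp: ginv_def intro!: continuous_intros smooth_continuous sk\<close>)
  then show "Ederiv k f p = 0" "Ederiv j f p = 0" by (auto simp: Ej)
qed

lemma constant_of_Ederiv_eq_zero:
  assumes f: "smooth f" and z: "\<And>k p. k \<in> {1..6} \<Longrightarrow> Ederiv k f p = 0"
  shows "f p = f q"
proof -
  have "frechet_derivative f (at p) v = 0" for p v
  proof -
    let ?D = "frechet_derivative f (at p)"
    have lin: "linear ?D" by (rule linear_frechet[OF f])
    have E: "?D (invfield k p) = 0" if "k \<in> {1..6}" for k
      using z[OF that, of p] by (simp add: Ederiv_def Efr_eq[OF that])
    obtain z1 z2 z3 where v: "v = (z1, z2, z3)" by (cases v)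
    \<comment> \<open>\<open>E_3\<close> and \<open>E_4\<close> together already contribute
      \<open>z2 * fst p\<close> to the third slot; \<open>w\<close> is what remains for
      \<open>E_5\<close> and \<open>E_6\<close>.\<close>
    define w where "w = z3 - z2 * fst p"
    have "v = Re z1 *\<^sub>R invfield 1 p + Im z1 *\<^sub>R invfield 2 p + Re z2 *\<^sub>R invfield 3 p
        + Im z2 *\<^sub>R invfield 4 p + Re w *\<^sub>R invfield 5 p + Im w *\<^sub>R invfield 6 p"
      by (auto simp: v invfield_def w_def complex_eq_iff algebra_simps)
    then have "?D v = ?D (Re z1 *\<^sub>R invfield 1 p + Im z1 *\<^sub>R invfield 2 p + Re z2 *\<^sub>R invfield 3 p
        + Im z2 *\<^sub>R invfield 4 p + Re w *\<^sub>R invfield 5 p + Im w *\<^sub>R invfield 6 p)" by (rule arg_cong)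
    also have "\<dots> = 0" using lin E by (simp add: linear_add linear_scale)
    finally show ?thesis .
  qed
  then have "(f has_derivative (\<lambda>v. 0)) (at x within UNIV)" for x
    using smooth_has_derivative[OF f, of x] by presburger
  then show ?thesis
    using has_derivative_zero_constant[of UNIV f] by (metis UNIV_I convex_UNIV)
qed

section \<open>Adjoints and the characterisation of harmonic forms\<close>

declare split_paired_All [simp del] One_nat_def [simp del]

lemma Aall_iff:
  "\<alpha> \<in> Aall \<longleftrightarrow> (\<forall>I p. \<not> I \<subseteq> {1..6} \<longrightarrow> \<alpha> I p = 0) \<and> (\<forall>I. smooth (\<alpha> I)) \<and> (\<forall>I. ginv (\<alpha> I))"
  by (auto simp: Aall_def fun_eq_iff)

lemma Aall_fzero: "fzero \<in> Aall"
  by (simp add: Aall_iff fzero_def smooth_const ginv_const)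

lemma Aall_fadd: "\<alpha> \<in> Aall \<Longrightarrow> \<beta> \<in> Aall \<Longrightarrow> fadd \<alpha> \<beta> \<in> Aall"
  by (simp add: Aall_iff fadd_def smooth_add ginv_add)

lemma Aall_fsc: "\<alpha> \<in> Aall \<Longrightarrow> fsc c \<alpha> \<in> Aall"
  by (simp add: Aall_iff fsc_def smooth_cmult ginv_mult ginv_const)

lemma continuous_on_l2_term:
  "\<alpha> \<in> Aall \<Longrightarrow> \<beta> \<in> Aall \<Longrightarrow> continuous_on UNIV (\<lambda>p. \<alpha> I p * cnj (\<beta> I p))"
  by (intro smooth_continuous smooth_mult smooth_cnj) (auto simp: Aall_iff)

lemma l2_eq_sum:
  "\<alpha> \<in> Aall \<Longrightarrow> \<beta> \<in> Aall \<Longrightarrow> l2 \<alpha> \<beta> = (\<Sum>I\<in>Pow {1..6}. integral fdom (\<lambda>p. \<alpha> I p * cnj (\<beta> I p)))"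
  unfolding l2_def by (intro integral_sum integrable_on_fdom continuous_on_l2_term) auto

lemma l2_fadd_left:
  "\<alpha> \<in> Aall \<Longrightarrow> \<beta> \<in> Aall \<Longrightarrow> \<gamma> \<in> Aall \<Longrightarrow> l2 (fadd \<alpha> \<beta>) \<gamma> = l2 \<alpha> \<gamma> + l2 \<beta> \<gamma>"
  by (simp add: l2_eq_sum Aall_fadd)
    (simp add: fadd_def distrib_right sum.distrib[symmetric]
      Henstock_Kurzweil_Integration.integral_add integrable_on_fdom continuous_on_l2_term)

lemma l2_cnj: "\<alpha> \<in> Aall \<Longrightarrow> \<beta> \<in> Aall \<Longrightarrow> l2 \<beta> \<alpha> = cnj (l2 \<alpha> \<beta>)"
proof -
  assume a: "\<alpha> \<in> Aall" "\<beta> \<in> Aall"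
  have "integral fdom (\<lambda>p. \<beta> I p * cnj (\<alpha> I p)) = cnj (integral fdom (\<lambda>p. \<alpha> I p * cnj (\<beta> I p)))" for I
    using integral_linear[OF integrable_on_fdom[OF continuous_on_l2_term[OF a, of I]] bounded_linear_cnj]
    by (simp add: o_def mult.commute)
  then show ?thesis using a by (simp add: l2_eq_sum)
qed

lemma l2_fadd_right:
  "\<alpha> \<in> Aall \<Longrightarrow> \<beta> \<in> Aall \<Longrightarrow> \<gamma> \<in> Aall \<Longrightarrow> l2 \<gamma> (fadd \<alpha> \<beta>) = l2 \<gamma> \<alpha> + l2 \<gamma> \<beta>"
  using l2_cnj[of "fadd \<alpha> \<beta>" \<gamma>] l2_cnj[of \<alpha> \<gamma>] l2_cnj[of \<beta> \<gamma>]
  by (simp add: Aall_fadd l2_fadd_left)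

lemma l2_fzero [simp]: "l2 fzero \<alpha> = 0" "l2 \<alpha> fzero = 0"
  by (simp_all add: l2_def fzero_def)

lemma l2_self:
  assumes "\<alpha> \<in> Aall"
  shows "l2 \<alpha> \<alpha> = complex_of_real (integral fdom (\<lambda>p. \<Sum>I\<in>Pow {1..6}. (cmod (\<alpha> I p))\<^sup>2))"
proof -
  have c: "continuous_on UNIV (\<lambda>p. \<Sum>I\<in>Pow {1..6}. (cmod (\<alpha> I p))\<^sup>2)"
    using assms by (auto simp: Aall_iff intro!: continuous_intros smooth_continuous)
  show ?thesis
    using integral_linear[OF integrable_on_fdom[OF c] bounded_linear_of_real[where 'a=complex]]
    by (simp add: l2_def o_def complex_norm_square[symmetric])
qed

lemma l2_self_nonneg:
  assumes "\<alpha> \<in> Aall"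
  shows "Re (l2 \<alpha> \<alpha>) \<ge> 0"
proof -
  have c: "continuous_on UNIV (\<lambda>p. \<Sum>I\<in>Pow {1..6}. (cmod (\<alpha> I p))\<^sup>2)"
    using assms by (auto simp: Aall_iff intro!: continuous_intros smooth_continuous)
  show ?thesis
    unfolding l2_self[OF assms] Re_complex_of_real
    by (intro Henstock_Kurzweil_Integration.integral_nonneg integrable_on_fdom[OF c] sum_nonneg) auto
qed

lemma l2_self_eq_zero:
  assumes "\<alpha> \<in> Aall" "l2 \<alpha> \<alpha> = 0"
  shows "\<alpha> = fzero"
proof -
  have c: "continuous_on UNIV (\<lambda>p. \<Sum>I\<in>Pow {1..6}. (cmod (\<alpha> I p))\<^sup>2)"
    using assms by (auto simp: Aall_iff intro!: continuous_intros smooth_continuous)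
  have "(\<Sum>I\<in>Pow {1..6}. (cmod (\<alpha> I p))\<^sup>2) = 0" for p
    by (rule ginv_eq_zero_of_integral[OF c])
      (use assms in \<open>auto simp: l2_self sum_nonneg Aall_iff ginv_def simp del: split_paired_All\<close>)
  then have "\<alpha> I p = 0" if "I \<subseteq> {1..6}" for I p
    using that by (simp add: sum_nonneg_eq_0_iff)
  moreover have "\<alpha> I p = 0" if "\<not> I \<subseteq> {1..6}" for I p
    using that assms(1) by (simp add: Aall_iff)
  ultimately show ?thesis unfolding fzero_def by blast
qed

text \<open>Stability of \<open>Aall\<close> is bundled with the existence of an adjoint because the
  adjoint identity is only required on \<open>Aall\<close>; together they make the class closed
  under composition.\<close>

definition has_adj :: "(form \<Rightarrow> form) \<Rightarrow> bool" where
  "has_adj T \<longleftrightarrow> (\<forall>\<alpha>\<in>Aall. T \<alpha> \<in> Aall) \<and> (\<exists>S. is_adj T S)"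

lemma has_adjI:
  assumes "\<And>\<alpha>. \<alpha> \<in> Aall \<Longrightarrow> T \<alpha> \<in> Aall" "\<And>\<alpha>. \<alpha> \<in> Aall \<Longrightarrow> S \<alpha> \<in> Aall"
    "\<And>\<alpha> \<beta>. \<alpha> \<in> Aall \<Longrightarrow> \<beta> \<in> Aall \<Longrightarrow> l2 (T \<alpha>) \<beta> = l2 \<alpha> (S \<beta>)"
  shows "has_adj T"
  unfolding has_adj_def is_adj_def using assms by blast

lemma has_adj_Aall: "has_adj T \<Longrightarrow> \<alpha> \<in> Aall \<Longrightarrow> T \<alpha> \<in> Aall"
  by (simp add: has_adj_def)

lemma has_adj_cong: "has_adj T \<Longrightarrow> (\<And>\<alpha>. \<alpha> \<in> Aall \<Longrightarrow> T \<alpha> = T' \<alpha>) \<Longrightarrow> has_adj T'"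
  by (simp add: has_adj_def is_adj_def)

lemma has_adj_compose:
  assumes "has_adj T" "has_adj T'"
  shows "has_adj (\<lambda>\<alpha>. T (T' \<alpha>))"
proof -
  obtain S S' where "is_adj T S" "is_adj T' S'" using assms by (auto simp: has_adj_def)
  with assms show ?thesis
    by (intro has_adjI[where S = "\<lambda>\<alpha>. S' (S \<alpha>)"]) (auto simp: has_adj_def is_adj_def)
qed

lemma has_adj_fadd:
  assumes "has_adj T" "has_adj T'"
  shows "has_adj (\<lambda>\<alpha>. fadd (T \<alpha>) (T' \<alpha>))"
proof -
  obtain S S' where "is_adj T S" "is_adj T' S'" using assms by (auto simp: has_adj_def)
  with assms show ?thesis
    by (intro has_adjI[where S = "\<lambda>\<alpha>. fadd (S \<alpha>) (S' \<alpha>)"])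
      (auto simp: has_adj_def is_adj_def Aall_fadd l2_fadd_left l2_fadd_right)
qed

lemma has_adj_fzero: "has_adj (\<lambda>\<alpha>. fzero)"
  by (rule has_adjI[where S = "\<lambda>\<alpha>. fzero"]) (auto simp: Aall_fzero)

lemma has_adj_sum:
  assumes "\<And>i. i \<in> A \<Longrightarrow> has_adj (T i)"
  shows "has_adj (\<lambda>\<alpha> K p. \<Sum>i\<in>A. T i \<alpha> K p)"
  using assms
proof (induction A rule: infinite_finite_induct)
  case (insert x F)
  then show ?case using has_adj_fadd[of "T x" "\<lambda>\<alpha> K p. \<Sum>i\<in>F. T i \<alpha> K p"]
    by (simp add: fadd_def)
qed (use has_adj_fzero in \<open>simp_all add: fzero_def\<close>)

text \<open>A zeroth-order operator with a constant matrix in the coframe. Since the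
  \<open>e^I\<close> are orthonormal, its adjoint has the conjugate transpose as matrix. The cut-off
  keeps the image supported on subsets of \<open>{1..6}\<close>, as \<open>Aall\<close>
  demands.\<close>

definition Mop :: "(nat set \<Rightarrow> nat set \<Rightarrow> complex) \<Rightarrow> form \<Rightarrow> form" where
  "Mop m \<alpha> = (\<lambda>K p. if K \<subseteq> {1..6} then \<Sum>I\<in>Pow {1..6}. m K I * \<alpha> I p else 0)"

lemma Mop_Aall: "\<alpha> \<in> Aall \<Longrightarrow> Mop m \<alpha> \<in> Aall"
proof -
  assume a: "\<alpha> \<in> Aall"
  have "smooth (Mop m \<alpha> K)" "ginv (Mop m \<alpha> K)" for K
    using a unfolding Mop_def
    by (cases "K \<subseteq> {1..6}"; auto simp: Aall_iff intro!: smooth_const smooth_sum smooth_cmult ginv_const ginv_sum ginv_mult)+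
  then show ?thesis by (simp add: Aall_iff) (simp add: Mop_def)
qed

lemma has_adj_Mop: "has_adj (Mop m)"
proof (rule has_adjI[where S = "Mop (\<lambda>K I. cnj (m I K))"])
  fix \<alpha> \<beta> assume ab: "\<alpha> \<in> Aall" "\<beta> \<in> Aall"
  have "(\<Sum>K\<in>Pow {1..6}. Mop m \<alpha> K p * cnj (\<beta> K p))
      = (\<Sum>K\<in>Pow {1..6}. \<Sum>I\<in>Pow {1..6}. m K I * \<alpha> I p * cnj (\<beta> K p))" for p
    by (simp add: Mop_def sum_distrib_right)
  also have "\<dots> p = (\<Sum>I\<in>Pow {1..6}. \<Sum>K\<in>Pow {1..6}. m K I * \<alpha> I p * cnj (\<beta> K p))" for p
    by (rule sum.swap)
  also have "\<dots> p = (\<Sum>I\<in>Pow {1..6}. \<alpha> I p * cnj (Mop (\<lambda>K I. cnj (m I K)) \<beta> I p))" for p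
    by (simp add: Mop_def sum_distrib_left mult_ac)
  finally show "l2 (Mop m \<alpha>) \<beta> = l2 \<alpha> (Mop (\<lambda>K I. cnj (m I K)) \<beta>)"
    by (simp add: l2_def)
qed (simp_all add: Mop_Aall)

definition Eop :: "nat \<Rightarrow> form \<Rightarrow> form" where
  "Eop k \<alpha> = (\<lambda>I. Ederiv k (\<alpha> I))"

lemma Eop_Aall:
  assumes k: "k \<in> {1..6}" and a: "\<alpha> \<in> Aall"
  shows "Eop k \<alpha> \<in> Aall"
proof -
  have "Ederiv k (\<alpha> I) p = 0" if "\<not> I \<subseteq> {1..6}" for I p
  proof -
    have "\<alpha> I = (\<lambda>p. 0)" using a that by (auto simp: Aall_iff)
    then show ?thesis by simp
  qed
  then show ?thesis using assms by (simp add: Aall_iff Eop_def smooth_Ederiv ginv_Ederiv)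
qed

text \<open>The frame fields are real and divergence free, so integration by parts gives minus the
  same operator as adjoint.\<close>

lemma has_adj_Eop:
  assumes k: "k \<in> {1..6}"
  shows "has_adj (Eop k)"
proof (rule has_adjI[where S = "\<lambda>\<alpha>. fsc (-1) (Eop k \<alpha>)"])
  show neg: "fsc (-1) (Eop k \<alpha>) \<in> Aall" if "\<alpha> \<in> Aall" for \<alpha>
    by (intro Aall_fsc Eop_Aall k that)
  fix \<alpha> \<beta> assume ab: "\<alpha> \<in> Aall" "\<beta> \<in> Aall"
  then show "l2 (Eop k \<alpha>) \<beta> = l2 \<alpha> (fsc (-1) (Eop k \<beta>))"
    using Ederiv_integration_by_parts[of "\<alpha> _" "\<beta> _", OF _ _ _ _ k]
    by (simp add: l2_eq_sum Eop_Aall[OF k] neg) (simp add: Eop_def fsc_def Aall_iff)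
qed (rule Eop_Aall[OF k])

section \<open>Left-invariant forms and the dual complex frame\<close>

definition fsup :: "form \<Rightarrow> bool" where
  "fsup \<alpha> \<longleftrightarrow> (\<forall>K p. \<not> K \<subseteq> {1..6} \<longrightarrow> \<alpha> K p = 0)"

definition fconst :: "form \<Rightarrow> bool" where
  "fconst \<alpha> \<longleftrightarrow> (\<forall>K p q. \<alpha> K p = \<alpha> K q)"

lemma fsup_wedge: 
  assumes "fsup \<alpha>" "fsup \<beta>" shows "fsup (wedge \<alpha> \<beta>)"
  unfolding fsup_def wedge_def
proof (intro allI impI sum.neutral ballI)
  fix K I :: "nat set" and p assume "\<not> K \<subseteq> {1..6}" "I \<in> Pow K"
  then have "\<not> I \<subseteq> {1..6} \<or> \<not> K - I \<subseteq> {1..6}" by auto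
  then show "wsign I (K - I) * \<alpha> I p * \<beta> (K - I) p = 0"
    using assms unfolding fsup_def by (elim disjE) simp_all
qed

lemma fsup_simps:
  "fsup \<alpha> \<Longrightarrow> fsup \<beta> \<Longrightarrow> fsup (fadd \<alpha> \<beta>)" "fsup \<alpha> \<Longrightarrow> fsup (fsc c \<alpha>)" "fsup \<alpha> \<Longrightarrow> fsup (fmul f \<alpha>)"
  "fsup fzero" "fsup one_form" "k \<in> {1..6} \<Longrightarrow> fsup (eb k)"
  by (auto simp: fsup_def fadd_def fsc_def fmul_def fzero_def one_form_def eb_def)

lemma fsup_de: "fsup (de k)" and fsup_theta: "fsup (theta j)"
  by (auto simp: de_def theta_def intro!: fsup_wedge fsup_simps)

lemma fsup_eL: "set ks \<subseteq> {1..6} \<Longrightarrow> fsup (eL ks)"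
  by (induction ks) (auto intro!: fsup_wedge fsup_simps)

lemma fsup_dL: "set ks \<subseteq> {1..6} \<Longrightarrow> fsup (dL ks)"
  by (induction ks) (auto intro!: fsup_wedge fsup_simps fsup_de fsup_eL)

lemma fsup_thL: "fsup (thL js)"
  by (induction js) (auto intro!: fsup_wedge fsup_simps fsup_theta)

lemma fconst_wedge: "fconst \<alpha> \<Longrightarrow> fconst \<beta> \<Longrightarrow> fconst (wedge \<alpha> \<beta>)"
  unfolding fconst_def wedge_def by (intro allI sum.cong refl arg_cong2[where f = "(*)"]) auto

lemma fconst_simps:
  "fconst \<alpha> \<Longrightarrow> fconst \<beta> \<Longrightarrow> fconst (fadd \<alpha> \<beta>)" "fconst \<alpha> \<Longrightarrow> fconst (fsc c \<alpha>)"
  "fconst fzero" "fconst one_form" "fconst (eb k)"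
  unfolding fconst_def fadd_def fsc_def fzero_def one_form_def eb_def
  by (intro allI arg_cong2[where f = "(+)"] arg_cong2[where f = "(*)"]; blast)+ 

lemma fconst_de: "fconst (de k)" and fconst_theta: "fconst (theta j)"
  by (auto simp: de_def theta_def intro!: fconst_wedge fconst_simps)

lemma fconst_eL: "fconst (eL ks)"
  by (induction ks) (auto intro!: fconst_wedge fconst_simps)

lemma fconst_dL: "fconst (dL ks)"
  by (induction ks) (auto intro!: fconst_wedge fconst_simps fconst_de fconst_eL)

lemma fconst_thL: "fconst (thL js)"
  by (induction js) (auto intro!: fconst_wedge fconst_simps fconst_theta)

text \<open>The frame dual to \<open>theta\<close>: \<open>Z_1 = (E_1 - i E_6)/2\<close>,
  \<open>Z_2 = (E_2 - i E_5)/2\<close>, \<open>Z_3 = (E_3 - i E_4)/2\<close>, with conjugates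
  \<open>Z_4\<close>, \<open>Z_5\<close>, \<open>Z_6\<close>. Its components do not depend on the
  point, so the type projections have constant coefficients.\<close>

definition Zvec :: "nat \<Rightarrow> nat \<Rightarrow> complex" where
  "Zvec j k = (let d = (\<lambda>l. if l = j then 1 else 0) in
     if k = 1 then (d 1 + d 4) / 2 else if k = 6 then - \<i> * (d 1 - d 4) / 2
     else if k = 2 then (d 2 + d 5) / 2 else if k = 5 then - \<i> * (d 2 - d 5) / 2
     else if k = 3 then (d 3 + d 6) / 2 else if k = 4 then - \<i> * (d 3 - d 6) / 2 else 0)"

lemma theta_pairing:
  "(\<Sum>k\<in>{1..6}. theta l {k} p * w k)
   = (if l = 1 then w 1 + \<i> * w 6 else if l = 2 then w 2 + \<i> * w 5 else if l = 3 then w 3 + \<i> * w 4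
      else if l = 4 then w 1 - \<i> * w 6 else if l = 5 then w 2 - \<i> * w 5 else if l = 6 then w 3 - \<i> * w 4 else 0)"
  unfolding atLeast1_atMost6 by (simp add: theta_def fadd_def fsc_def eb_def fzero_def)

lemma Zfr_eq: "Zfr j p = Zvec j"
  unfolding Zfr_def
proof (rule the_equality)
  define d :: "nat \<Rightarrow> complex" where "d l = (if l = j then 1 else 0)" for l
  have Z: "Zvec j 1 = (d 1 + d 4) / 2" "Zvec j 6 = - \<i> * (d 1 - d 4) / 2"
     "Zvec j 2 = (d 2 + d 5) / 2" "Zvec j 5 = - \<i> * (d 2 - d 5) / 2"
     "Zvec j 3 = (d 3 + d 6) / 2" "Zvec j 4 = - \<i> * (d 3 - d 6) / 2"
    unfolding Zvec_def Let_def d_def by simp_all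
  have outside: "\<forall>k. k \<notin> {1..6} \<longrightarrow> Zvec j k = 0"
    by (auto simp: Zvec_def Let_def)
  show "(\<forall>k. k \<notin> {1..6} \<longrightarrow> Zvec j k = 0) \<and>
      (\<forall>l\<in>{1..6}. (\<Sum>k\<in>{1..6}. theta l {k} p * Zvec j k) = (if l = j then 1 else 0))"
    using outside unfolding theta_pairing Z d_def[symmetric]
    by (simp add: atLeast1_atMost6 field_simps)
next
  fix w
  assume w: "(\<forall>k. k \<notin> {1..6} \<longrightarrow> w k = 0) \<and>
      (\<forall>l\<in>{1..6}. (\<Sum>k\<in>{1..6}. theta l {k} p * w k) = (if l = j then 1 else 0))"
  define d :: "nat \<Rightarrow> complex" where "d l = (if l = j then 1 else 0)" for l
  have pair: "l \<in> {1..6} \<Longrightarrow> (if l = 1 then w 1 + \<i> * w 6 else if l = 2 then w 2 + \<i> * w 5 else if l = 3 then w 3 + \<i> * w 4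
      else if l = 4 then w 1 - \<i> * w 6 else if l = 5 then w 2 - \<i> * w 5 else if l = 6 then w 3 - \<i> * w 4 else 0) = d l" for l
    using w unfolding theta_pairing d_def by blast
  have e: "w 1 + \<i> * w 6 = d 1" "w 2 + \<i> * w 5 = d 2" "w 3 + \<i> * w 4 = d 3"
     "w 1 - \<i> * w 6 = d 4" "w 2 - \<i> * w 5 = d 5" "w 3 - \<i> * w 4 = d 6"
    using pair[of 1] pair[of 2] pair[of 3] pair[of 4] pair[of 5] pair[of 6] by simp_all
  have solve: "a = (x + y) / 2 \<and> b = - \<i> * (x - y) / 2" if "a + \<i> * b = x" "a - \<i> * b = y" for a b x y :: complex
    using that by (auto simp: field_simps)
  show "w = Zvec j"
  proof
    fix k
    show "w k = Zvec j k"
      using w solve[OF e(1,4)] solve[OF e(2,5)] solve[OF e(3,6)]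
      unfolding Zvec_def Let_def d_def[symmetric] atLeast1_atMost6 by auto
  qed
qed

lemma tcoef_eq_sum:
  "tcoef \<alpha> I p = (\<Sum>J\<in>{J\<in>Pow {1..6}. card J = card I}.
      \<alpha> J p * detm (sorted_list_of_set J) (map Zvec (sorted_list_of_set I)))"
  if "finite I"
  using that by (simp add: tcoef_def evalf_def Zfr_eq)

text \<open>The dual frame and the coefficients of \<open>thL\<close> are both independent of the
  point, hence the base point 0. The test on cardinalities extends the sum in \<open>evalf\<close>
  to all subsets, the range over which \<open>Mop\<close> sums.\<close>

lemma proj_eq_Mop:
  assumes "\<alpha> \<in> Aall"
  shows "proj a b \<alpha> = Mop (\<lambda>K J. \<Sum>I\<in>bitype a b. (if card J = card I then
      detm (sorted_list_of_set J) (map Zvec (sorted_list_of_set I)) else 0) * thL (sorted_list_of_set I) K 0) \<alpha>"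
proof (intro ext)
  fix K p
  have fin: "finite I" if "I \<in> bitype a b" for I
    using that by (auto simp: bitype_def intro: finite_subset)
  have tc: "tcoef \<alpha> I p = (\<Sum>J\<in>Pow {1..6}. \<alpha> J p * (if card J = card I then
      detm (sorted_list_of_set J) (map Zvec (sorted_list_of_set I)) else 0))" if "I \<in> bitype a b" for I
    unfolding tcoef_eq_sum[OF fin[OF that]]
    by (intro sum.mono_neutral_cong_left) auto
  have c: "thL js K p = thL js K 0" for js using fconst_thL[of js] by (auto simp: fconst_def simp del: split_paired_All)
  show "proj a b \<alpha> K p = Mop (\<lambda>K J. \<Sum>I\<in>bitype a b. (if card J = card I then
      detm (sorted_list_of_set J) (map Zvec (sorted_list_of_set I)) else 0) * thL (sorted_list_of_set I) K 0) \<alpha> K p"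
  proof (cases "K \<subseteq> {1..6}")
    case True
    show ?thesis
      unfolding proj_def Mop_def c[of "sorted_list_of_set _"]
      by (simp add: True tc sum_distrib_right sum_distrib_left)
        (subst sum.swap, simp add: mult_ac)
  next
    case False
    then have "thL js K p = 0" for js using fsup_thL by (auto simp: fsup_def simp del: split_paired_All)
    then show ?thesis using False by (simp add: proj_def Mop_def)
  qed
qed

lemma wedge_dfun: "wedge (dfun f) \<beta> K p = (\<Sum>k\<in>{1..6}. Ederiv k f p * wedge (eb k) \<beta> K p)"
proof -
  have "wedge (dfun f) \<beta> K p
      = (\<Sum>I\<in>Pow K. \<Sum>k\<in>{1..6}. Ederiv k f p * (wsign I (K - I) * eb k I p * \<beta> (K - I) p))"
    by (simp add: wedge_def dfun_def Ederiv_def[symmetric] sum_distrib_left sum_distrib_right mult_ac)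
  then show ?thesis
    by (subst (asm) sum.swap) (simp add: wedge_def sum_distrib_left)
qed

text \<open>The first-order part and the part made of structure constants, arranged so that
  \<open>dform\<close> becomes a sum of compositions of \<open>Mop\<close> and \<open>Eop\<close>
  and thereby acquires an adjoint.\<close>

lemma dform_eq:
  "dform \<alpha> K p = (\<Sum>k\<in>{1..6}. \<Sum>I\<in>Pow {1..6}. Eop k \<alpha> I p * wedge (eb k) (eL (sorted_list_of_set I)) K p)
    + (\<Sum>I\<in>Pow {1..6}. \<alpha> I p * dL (sorted_list_of_set I) K p)"
  unfolding dform_def fadd_def fmul_def sum.distrib wedge_dfun Eop_def
  by (subst sum.swap) simp

lemma has_adj_proj: "has_adj (proj a b)"
  by (rule has_adj_cong[OF has_adj_Mop]) (simp add: proj_eq_Mop)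

lemma has_adj_dform: "has_adj dform"
proof -
  define W where "W k K I = wedge (eb k) (eL (sorted_list_of_set I)) K 0" for k K I
  define D where "D K I = dL (sorted_list_of_set I) K 0" for K I
  have "has_adj (\<lambda>\<alpha>. fadd (\<lambda>K p. \<Sum>k\<in>{1..6}. Mop (W k) (Eop k \<alpha>) K p) (Mop D \<alpha>))"
    by (intro has_adj_fadd has_adj_sum has_adj_Mop has_adj_compose[OF has_adj_Mop has_adj_Eop])
  then show ?thesis
  proof (rule has_adj_cong, intro ext)
    fix \<alpha> K p
    have fin: "set (sorted_list_of_set I) \<subseteq> {1..6}" if "I \<in> Pow {1..6}" for I :: "nat set"
      using that finite_subset[of I "{1..6}"] by auto
    have W: "wedge (eb k) (eL (sorted_list_of_set I)) K p = W k K I" for k I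
      using fconst_wedge[OF fconst_simps(5) fconst_eL] unfolding W_def fconst_def by blast
    have D: "dL (sorted_list_of_set I) K p = D K I" for I
      using fconst_dL unfolding D_def fconst_def by blast
    have W0: "W k K I = 0" if "\<not> K \<subseteq> {1..6}" "k \<in> {1..6}" "I \<in> Pow {1..6}" for k I
      using fsup_wedge[OF fsup_simps(6)[OF that(2)] fsup_eL[OF fin[OF that(3)]]] that(1)
      unfolding W_def fsup_def by blast
    have D0: "D K I = 0" if "\<not> K \<subseteq> {1..6}" "I \<in> Pow {1..6}" for I
      using fsup_dL[OF fin[OF that(2)]] that(1) unfolding D_def fsup_def by blast
    show "fadd (\<lambda>K p. \<Sum>k\<in>{1..6}. Mop (W k) (Eop k \<alpha>) K p) (Mop D \<alpha>) K p = dform \<alpha> K p"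
    proof (cases "K \<subseteq> {1..6}")
      case True
      then show ?thesis by (simp add: dform_eq W D fadd_def Mop_def mult.commute)
    next
      case False
      then have "dform \<alpha> K p = 0" unfolding dform_eq W D by (simp add: W0 D0)
      with False show ?thesis by (simp add: fadd_def Mop_def)
    qed
  qed
qed

lemma has_adj_bdelta: "has_adj bdelta"
proof -
  have "has_adj (\<lambda>\<alpha> K x. \<Sum>i\<in>{0..3} \<times> {0..3}. proj (fst i) (snd i + 1) (dform (proj (fst i) (snd i) \<alpha>)) K x)"
    by (intro has_adj_sum has_adj_compose[OF has_adj_proj] has_adj_compose[OF has_adj_dform] has_adj_proj)
  moreover have "has_adj (\<lambda>\<alpha> K x. \<Sum>i\<in>{0..3} \<times> {1..3}. proj (fst i + 2) (snd i - 1) (dform (proj (fst i) (snd i) \<alpha>)) K x)"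
    by (intro has_adj_sum has_adj_compose[OF has_adj_proj] has_adj_compose[OF has_adj_dform] has_adj_proj)
  ultimately show ?thesis
    using has_adj_fadd[of dbar mu]
    unfolding bdelta_def[abs_def] dbar_def[abs_def] mu_def[abs_def] split_beta by blast
qed

lemma bdelta_Aall: "\<alpha> \<in> Aall \<Longrightarrow> bdelta \<alpha> \<in> Aall"
  by (rule has_adj_Aall[OF has_adj_bdelta])

lemma proj_fzero: "proj a b fzero = fzero"
  by (simp add: proj_def tcoef_def evalf_def fzero_def)

lemma dform_fzero: "dform fzero = fzero"
  by (intro ext) (simp add: dform_eq Eop_def fzero_def)

lemma bdelta_fzero: "bdelta fzero = fzero"
  by (intro ext) (simp add: bdelta_def dbar_def mu_def fadd_def proj_fzero dform_fzero, simp add: fzero_def split_beta)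

text \<open>Pairing the Laplacian with \<open>\<psi>\<close> gives the sum of the squared norms of
  \<open>S \<psi>\<close> and \<open>bdelta \<psi>\<close>. Expressing
  \<open>S \<psi> = fzero\<close> as orthogonality to the image removes the adjoint from the
  right-hand side, so its choice in \<open>harm\<close> does not matter.\<close>

lemma harm_iff:
  "\<psi> \<in> harm n \<longleftrightarrow> \<psi> \<in> Apq n 0 \<and> bdelta \<psi> = fzero \<and> (\<forall>\<alpha>\<in>Aall. l2 (bdelta \<alpha>) \<psi> = 0)"
proof
  assume "\<psi> \<in> harm n"
  then obtain S where \<psi>: "\<psi> \<in> Apq n 0" and S: "is_adj bdelta S"
    and z: "fadd (bdelta (S \<psi>)) (S (bdelta \<psi>)) = fzero"
    by (auto simp: harm_def)
  have A: "\<psi> \<in> Aall" using \<psi> by (simp add: Apq_def)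
  have SA: "S \<alpha> \<in> Aall" if "\<alpha> \<in> Aall" for \<alpha> using S that by (simp add: is_adj_def)
  have adj: "l2 (bdelta \<alpha>) \<beta> = l2 \<alpha> (S \<beta>)" if "\<alpha> \<in> Aall" "\<beta> \<in> Aall" for \<alpha> \<beta>
    using S that by (simp add: is_adj_def)
  have "0 = l2 \<psi> (fadd (bdelta (S \<psi>)) (S (bdelta \<psi>)))" by (simp add: z)
  also have "\<dots> = l2 \<psi> (bdelta (S \<psi>)) + l2 \<psi> (S (bdelta \<psi>))"
    by (simp add: l2_fadd_right A SA bdelta_Aall)
  also have "l2 \<psi> (bdelta (S \<psi>)) = cnj (l2 (S \<psi>) (S \<psi>))"
    by (simp add: l2_cnj[of "bdelta (S \<psi>)" \<psi>] A SA bdelta_Aall adj)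
  also have "l2 \<psi> (S (bdelta \<psi>)) = l2 (bdelta \<psi>) (bdelta \<psi>)"
    by (simp add: adj A bdelta_Aall)
  finally have "Re (l2 (S \<psi>) (S \<psi>)) + Re (l2 (bdelta \<psi>) (bdelta \<psi>)) = 0"
    by (simp add: complex_eq_iff)
  moreover have "Re (l2 (S \<psi>) (S \<psi>)) \<ge> 0" "Re (l2 (bdelta \<psi>) (bdelta \<psi>)) \<ge> 0"
    by (simp_all add: l2_self_nonneg A SA bdelta_Aall)
  ultimately have "Re (l2 (S \<psi>) (S \<psi>)) = 0" "Re (l2 (bdelta \<psi>) (bdelta \<psi>)) = 0" by linarith+
  then have "S \<psi> = fzero" "bdelta \<psi> = fzero"
    by (intro l2_self_eq_zero; simp add: A SA bdelta_Aall; simp add: l2_self A SA bdelta_Aall)+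
  then show "\<psi> \<in> Apq n 0 \<and> bdelta \<psi> = fzero \<and> (\<forall>\<alpha>\<in>Aall. l2 (bdelta \<alpha>) \<psi> = 0)"
    using \<psi> A by (simp add: adj)
next
  assume h: "\<psi> \<in> Apq n 0 \<and> bdelta \<psi> = fzero \<and> (\<forall>\<alpha>\<in>Aall. l2 (bdelta \<alpha>) \<psi> = 0)"
  then have A: "\<psi> \<in> Aall" by (simp add: Apq_def)
  obtain S where S: "is_adj bdelta S" using has_adj_bdelta by (auto simp: has_adj_def)
  \<comment> \<open>\<open>is_adj\<close> does not include linearity, so
    \<open>S fzero = fzero\<close> is obtained from the same orthogonality argument as
    \<open>S \<psi> = fzero\<close>.\<close>
  have "S \<phi> = fzero" if "\<phi> \<in> Aall" "\<forall>\<alpha>\<in>Aall. l2 (bdelta \<alpha>) \<phi> = 0" for \<phi>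
    using S that l2_self_eq_zero[of "S \<phi>"] unfolding is_adj_def by metis
  then have "S \<psi> = fzero" "S fzero = fzero" using h A by (auto simp: Aall_fzero)
  then show "\<psi> \<in> harm n"
    using h S by (auto simp: harm_def bdelta_fzero intro!: exI[of _ S]) (simp add: fadd_def fzero_def)
qed

section \<open>Contraction and exterior multiplication\<close>

text \<open>The sign for moving \<open>e^k\<close> past the factors of \<open>e^K\<close> with
  smaller index.\<close>

definition esign :: "nat \<Rightarrow> nat set \<Rightarrow> complex" where
  "esign k K = (-1) ^ card {j \<in> K. j < k}"

lemma esign_mult_self [simp]: "esign k K * esign k K = 1" "esign k K * (esign k K * x) = x"
  by (simp_all add: esign_def power_add[symmetric] mult.assoc[symmetric])

lemma esign_insert:
  assumes "finite K" "l \<notin> K"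
  shows "esign k (insert l K) = (if l < k then - esign k K else esign k K)"
proof -
  have "{j \<in> insert l K. j < k} = (if l < k then insert l {j \<in> K. j < k} else {j \<in> K. j < k})"
    by auto
  with assms show ?thesis by (simp add: esign_def)
qed

lemma esign_insert_self [simp]: "esign k (insert k K) = esign k K"
  by (auto simp: esign_def intro!: arg_cong[where f = card] arg_cong[where f = "(^) (-1)"])

lemma esign_remove_self [simp]: "esign k (K - {k}) = esign k K"
  by (auto simp: esign_def intro!: arg_cong[where f = card] arg_cong[where f = "(^) (-1)"])

lemma wsign_insert:
  assumes "finite I" "finite M" "i \<notin> I"
  shows "wsign (insert i I) M = esign i M * wsign I M"
proof -
  have eq: "{(a, b). a \<in> insert i I \<and> b \<in> M \<and> b < a}
      = Pair i ` {j \<in> M. j < i} \<union> {(a, b). a \<in> I \<and> b \<in> M \<and> b < a}" by auto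
  have fin: "finite {(a, b). a \<in> I \<and> b \<in> M \<and> b < a}"
    by (rule finite_subset[of _ "I \<times> M"]) (use assms in auto)
  have "card {(a, b). a \<in> insert i I \<and> b \<in> M \<and> b < a}
      = card {j \<in> M. j < i} + card {(a, b). a \<in> I \<and> b \<in> M \<and> b < a}"
    unfolding eq using assms fin
    by (subst card_Un_disjoint) (auto simp: card_image inj_on_def)
  then show ?thesis by (simp add: wsign_def esign_def power_add)
qed

lemma wsign_empty [simp]: "wsign {} M = 1"
  by (simp add: wsign_def)

lemma wedge_infinite [simp]: "infinite K \<Longrightarrow> wedge \<alpha> \<beta> K p = 0"
  by (simp add: wedge_def)

text \<open>For infinite \<open>K\<close> the power set is infinite and the sum in
  \<open>wedge\<close> takes its default value 0, whence the guard.\<close>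

lemma wedge_eb:
  "wedge (eb k) \<alpha> K p = (if finite K \<and> k \<in> K then esign k K * \<alpha> (K - {k}) p else 0)"
proof (cases "finite K")
  case True
  have "wedge (eb k) \<alpha> K p = (\<Sum>I\<in>Pow K. if I = {k} then wsign {k} (K - {k}) * \<alpha> (K - {k}) p else 0)"
    unfolding wedge_def by (rule sum.cong) (auto simp: eb_def)
  also have "\<dots> = (if k \<in> K then esign k K * \<alpha> (K - {k}) p else 0)"
    using True by (simp add: wsign_insert)
  finally show ?thesis using True by simp
qed simp

lemma wedge_eb_anticommute:
  "wedge (eb i) (wedge (eb j) \<alpha>) K p = - wedge (eb j) (wedge (eb i) \<alpha>) K p"
proof (cases "finite K \<and> i \<in> K \<and> j \<in> K \<and> i \<noteq> j")
  case True
  define M where "M = K - {i, j}"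
  have K: "K = insert i (insert j M)" "i \<notin> M" "j \<notin> M" "finite M" "i \<noteq> j" using True by (auto simp: M_def)
  have d: "K - {i} = insert j M" "K - {j} = insert i M" "insert j M - {j} = M" "insert i M - {i} = M"
    using K by auto
  have "esign i K = esign i (insert j M)" "esign j K = esign j (insert i M)"
    using d by (metis esign_remove_self)+
  then show ?thesis using True K(2-5)
    by (simp add: wedge_eb d) (auto simp: esign_insert)
next
  case False
  then show ?thesis by (auto simp: wedge_eb)
qed

lemma wedge_eb_eb:
  "wedge (eb i) (eb j) I p = (if I = {i, j} \<and> i \<noteq> j then esign i {j} else 0)"
proof (cases "finite I \<and> i \<in> I \<and> I - {i} = {j}")
  case True
  then have "I = {i, j}" "i \<noteq> j" by auto
  moreover from this have "{i, j} - {i} = {j}" by auto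
  ultimately show ?thesis by (simp add: wedge_eb) (simp add: eb_def)
next
  case False
  then have "wedge (eb i) (eb j) I p = 0" unfolding wedge_eb by (auto simp: eb_def)
  moreover have "\<not> (I = {i, j} \<and> i \<noteq> j)" using False by auto
  ultimately show ?thesis by auto
qed

text \<open>The case of associativity that lets a product with \<open>de 5\<close> or
  \<open>de 6\<close> be expanded into successive multiplications by basis covectors.\<close>

lemma wedge_eb_assoc: "wedge (wedge (eb i) (eb j)) \<beta> = wedge (eb i) (wedge (eb j) \<beta>)"
proof (intro ext)
  fix K p
  show "wedge (wedge (eb i) (eb j)) \<beta> K p = wedge (eb i) (wedge (eb j) \<beta>) K p"
  proof (cases "finite K")
    case fin: True
    have "wedge (wedge (eb i) (eb j)) \<beta> K p
        = (\<Sum>I\<in>Pow K. if I = {i, j} then (if i \<noteq> j then wsign I (K - I) * esign i {j} * \<beta> (K - I) p else 0) else 0)"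
      unfolding wedge_def[of "wedge (eb i) (eb j)"] by (rule sum.cong) (auto simp: wedge_eb_eb)
    also have "\<dots> = (if i \<in> K \<and> j \<in> K \<and> i \<noteq> j then wsign {i, j} (K - {i, j}) * esign i {j} * \<beta> (K - {i, j}) p else 0)"
      using fin by simp
    also have "\<dots> = wedge (eb i) (wedge (eb j) \<beta>) K p"
    proof (cases "i \<in> K \<and> j \<in> K \<and> i \<noteq> j")
      case True
      define M where "M = K - {i, j}"
      have M: "i \<notin> M" "j \<notin> M" "finite M" "i \<noteq> j" using True fin by (auto simp: M_def)
      have d: "K - {i} = insert j M" "insert j M - {j} = M" using True M by (auto simp: M_def)
      have "esign i K = esign i (insert j M)" using d by (metis esign_remove_self)
      moreover have "esign i {j} = (if j < i then -1 else 1)"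
        using esign_insert[of "{}" j i] by (simp add: esign_def)
      ultimately show ?thesis using True M fin
        by (simp add: wedge_eb d M_def[symmetric] wsign_insert esign_insert)
    next
      case False
      then show ?thesis by (auto simp: wedge_eb)
    qed
    finally show ?thesis .
  qed simp
qed

lemma wedge_fadd_left: "wedge (fadd \<alpha> \<alpha>') \<beta> = fadd (wedge \<alpha> \<beta>) (wedge \<alpha>' \<beta>)"
  and wedge_fadd_right: "wedge \<beta> (fadd \<alpha> \<alpha>') = fadd (wedge \<beta> \<alpha>) (wedge \<beta> \<alpha>')"
  and wedge_fsc_left: "wedge (fsc c \<alpha>) \<beta> = fsc c (wedge \<alpha> \<beta>)"
  and wedge_fsc_right: "wedge \<beta> (fsc c \<alpha>) = fsc c (wedge \<beta> \<alpha>)"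
  and wedge_fmul_right: "wedge \<beta> (fmul f \<alpha>) = fmul f (wedge \<beta> \<alpha>)"
  and wedge_fzero_left: "wedge fzero \<beta> = fzero"
  and wedge_fzero_right: "wedge \<beta> fzero = fzero"
  by (simp_all add: wedge_def fadd_def fsc_def fmul_def fzero_def sum.distrib sum_distrib_left algebra_simps)

lemma wedge_sum_right:
  "wedge \<beta> (\<lambda>K p. \<Sum>i\<in>A. c i p * \<alpha> i K p) K p = (\<Sum>i\<in>A. c i p * wedge \<beta> (\<alpha> i) K p)"
  unfolding wedge_def sum_distrib_left by (subst sum.swap) (simp add: mult_ac)

lemma wedge_de: "wedge (de k) \<beta> = (if k = 5 then fadd (fsc (-1) (wedge (eb 1) (wedge (eb 3) \<beta>))) (wedge (eb 2) (wedge (eb 4) \<beta>))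
    else if k = 6 then fadd (fsc (-1) (wedge (eb 1) (wedge (eb 4) \<beta>))) (fsc (-1) (wedge (eb 2) (wedge (eb 3) \<beta>)))
    else fzero)"
  by (simp add: de_def wedge_fadd_left wedge_fsc_left wedge_eb_assoc wedge_fzero_left)

text \<open>The interior product with the complex vector \<open>w\<close>, signed so that
  \<open>w\<close> fills the first slot.\<close>

definition ctr :: "(nat \<Rightarrow> complex) \<Rightarrow> form \<Rightarrow> form" where
  "ctr w \<alpha> = (\<lambda>K p. \<Sum>k\<in>{1..6} - K. esign k K * w k * \<alpha> (insert k K) p)"

lemma ctr_fadd: "ctr w (fadd \<alpha> \<beta>) = fadd (ctr w \<alpha>) (ctr w \<beta>)"
  and ctr_fsc: "ctr w (fsc c \<alpha>) = fsc c (ctr w \<alpha>)"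
  and ctr_fmul: "ctr w (fmul f \<alpha>) = fmul f (ctr w \<alpha>)"
  and ctr_fzero: "ctr w fzero = fzero"
  and ctr_one_form: "ctr w one_form = fzero"
  by (simp_all add: ctr_def fadd_def fsc_def fmul_def fzero_def one_form_def sum.distrib sum_distrib_left algebra_simps)

lemma ctr_sum:
  "ctr w (\<lambda>K p. \<Sum>i\<in>A. c i p * \<alpha> i K p) K p = (\<Sum>i\<in>A. c i p * ctr w (\<alpha> i) K p)"
  unfolding ctr_def sum_distrib_left by (subst sum.swap) (simp add: mult_ac)

lemma ctr_vector_sum:
  "ctr (\<lambda>k. \<Sum>i\<in>A. c i * w i k) \<alpha> K p = (\<Sum>i\<in>A. c i * ctr (w i) \<alpha> K p)"
  unfolding ctr_def sum_distrib_left sum_distrib_right by (subst sum.swap) (simp add: mult_ac)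

lemma fsup_ctr: "fsup \<alpha> \<Longrightarrow> fsup (ctr w \<alpha>)"
  unfolding fsup_def ctr_def by (intro allI impI sum.neutral ballI) auto

text \<open>The anticommutation relation between contraction and exterior multiplication, on which
  the later coefficient computations rest.\<close>

lemma ctr_wedge_eb:
  assumes k: "k \<in> {1..6}" and sup: "fsup \<alpha>"
  shows "ctr w (wedge (eb k) \<alpha>) = fadd (fsc (w k) \<alpha>) (fsc (-1) (wedge (eb k) (ctr w \<alpha>)))"
proof (intro ext)
  fix K p
  show "ctr w (wedge (eb k) \<alpha>) K p = fadd (fsc (w k) \<alpha>) (fsc (-1) (wedge (eb k) (ctr w \<alpha>))) K p"
  proof (cases "K \<subseteq> {1..6}")
    case False
    have "fsup (ctr w (wedge (eb k) \<alpha>))" "fsup (fadd (fsc (w k) \<alpha>) (fsc (-1) (wedge (eb k) (ctr w \<alpha>))))"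
      by (intro fsup_ctr fsup_wedge fsup_simps k sup)+
    then show ?thesis using False by (simp add: fsup_def)
  next
    case True
    then have fin: "finite K" by (rule finite_subset) simp
    show ?thesis
    proof (cases "k \<in> K")
      case False
      have "ctr w (wedge (eb k) \<alpha>) K p = (\<Sum>l\<in>{1..6} - K. if l = k then w k * \<alpha> K p else 0)"
        unfolding ctr_def
        by (rule sum.cong) (use False fin in \<open>auto simp: wedge_eb mult_ac\<close>)
      also have "\<dots> = w k * \<alpha> K p" using k False by simp
      finally show ?thesis using False by (simp add: fadd_def fsc_def wedge_eb)
    next
      case kK: True
      \<comment> \<open>For \<open>k\<close> in \<open>K\<close>, the term of index \<open>k\<close>
        in the contraction at \<open>K - {k}\<close> cancels \<open>w k * \<alpha> K p\<close>. The
        remaining terms match those on the left, since exactly one of the two signs changes when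
        \<open>k\<close> and \<open>l\<close> are exchanged.\<close>
      have ins: "{1..6} - (K - {k}) = insert k ({1..6} - K)" using k kK by auto
      have "ctr w \<alpha> (K - {k}) p
          = esign k K * w k * \<alpha> K p + (\<Sum>l\<in>{1..6} - K. esign l (K - {k}) * w l * \<alpha> (insert l (K - {k})) p)"
        unfolding ctr_def ins using kK by (simp add: insert_absorb)
      moreover have "esign l K * esign k (insert l K) = - (esign k K * esign l (K - {k}))" if "l \<notin> K" for l
      proof -
        have "esign l K = (if k < l then - esign l (K - {k}) else esign l (K - {k}))"
          using esign_insert[of "K - {k}" k l] fin kK by (simp add: insert_absorb)
        moreover have "k \<noteq> l" using that kK by auto
        ultimately show ?thesis using that fin by (auto simp: esign_insert)
      qed
      moreover have "ctr w (wedge (eb k) \<alpha>) K p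
          = (\<Sum>l\<in>{1..6} - K. (esign l K * esign k (insert l K)) * w l * \<alpha> (insert l (K - {k})) p)"
        unfolding ctr_def
      proof (rule sum.cong)
        fix l assume "l \<in> {1..6} - K"
        then have "insert l K - {k} = insert l (K - {k})" using kK by auto
        then show "esign l K * w l * wedge (eb k) \<alpha> (insert l K) p
            = (esign l K * esign k (insert l K)) * w l * \<alpha> (insert l (K - {k})) p"
          using kK fin by (simp add: wedge_eb mult_ac)
      qed simp
      ultimately show ?thesis
        using kK fin
        by (simp add: fadd_def fsc_def wedge_eb distrib_left sum_distrib_left sum_negf[symmetric] mult_ac)
    qed
  qed
qed

section \<open>Evaluation of forms as iterated contraction\<close>

lemma sorted_list_of_set_nth_card:
  fixes J :: "nat set"
  assumes "finite J" "i < card J"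
  shows "card {j \<in> J. j < sorted_list_of_set J ! i} = i"
proof -
  let ?xs = "sorted_list_of_set J"
  have xs: "sorted_wrt (<) ?xs" "length ?xs = card J" "set ?xs = J"
    using assms by auto
  have "{j \<in> J. j < ?xs ! i} = (!) ?xs ` {..<i}"
  proof safe
    fix j assume "j \<in> J" and lt: "j < ?xs ! i"
    then obtain a where a: "a < card J" "j = ?xs ! a" using xs by (metis in_set_conv_nth)
    have "\<not> i < a" using lt a xs(1,2) sorted_wrt_nth_less[of "(<)" ?xs i a] by auto
    moreover have "a \<noteq> i" using lt a by auto
    ultimately have "a < i" by linarith
    then show "j \<in> (!) ?xs ` {..<i}" using a by auto
  next
    fix a assume "a < i"
    then show "?xs ! a \<in> J" "?xs ! a < ?xs ! i"
      using xs(1,2) assms nth_mem[of a ?xs] sorted_wrt_nth_less[of "(<)" ?xs a i] by auto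
  qed
  moreover have "inj_on ((!) ?xs) {..<i}"
    using xs assms by (intro inj_on_nth) auto
  ultimately show ?thesis by (simp add: card_image)
qed

lemma sorted_list_of_set_remove_nth:
  fixes J :: "nat set"
  assumes "finite J" "i < card J"
  shows "sorted_list_of_set (J - {sorted_list_of_set J ! i})
    = take i (sorted_list_of_set J) @ drop (Suc i) (sorted_list_of_set J)"
proof -
  let ?xs = "sorted_list_of_set J"
  have len: "i < length ?xs" and d: "distinct ?xs" using assms by auto
  have dec: "?xs = take i ?xs @ ?xs ! i # drop (Suc i) ?xs" by (rule id_take_nth_drop[OF len])
  have "remove1 (?xs ! i) ?xs = remove1 (?xs ! i) (take i ?xs @ ?xs ! i # drop (Suc i) ?xs)"
    using dec by simp
  also have "?xs ! i \<notin> set (take i ?xs)"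
    using d len by (auto simp: in_set_conv_nth nth_eq_iff_index_eq)
  then have "remove1 (?xs ! i) (take i ?xs @ ?xs ! i # drop (Suc i) ?xs) = take i ?xs @ drop (Suc i) ?xs"
    by (simp add: remove1_append)
  finally show ?thesis using assms by (simp add: sorted_list_of_set_remove)
qed

text \<open>Makes the Laplace expansion of \<open>det\<close> available for the Leibniz sum in
  \<open>detm\<close>; the columns are the vectors and the rows the selected coordinates.\<close>

lemma detm_eq_det:
  "detm js ws = det (mat (length ws) (length ws) (\<lambda>(a, b). (ws ! b) (js ! a)))"
proof -
  let ?n = "length ws"
  have "det (mat ?n ?n (\<lambda>(a, b). (ws ! b) (js ! a)))
      = (\<Sum>\<sigma> | \<sigma> permutes {0..<?n}. of_int (sign \<sigma>) * (\<Prod>a = 0..<?n. mat ?n ?n (\<lambda>(a, b). (ws ! b) (js ! a)) $$ (a, \<sigma> a)))"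
    by (simp add: det_def)
  also have "\<dots> = detm js ws"
    unfolding detm_def atLeast0LessThan[symmetric]
  proof (intro sum.cong refl arg_cong2[where f = "(*)"] prod.cong)
    fix \<sigma> a assume "\<sigma> \<in> {\<sigma>. \<sigma> permutes {0..<?n}}" and a: "a \<in> {0..<?n}"
    then have "\<sigma> a \<in> {0..<?n}" by (simp only: mem_Collect_eq permutes_in_image)
    with a show "mat ?n ?n (\<lambda>(a, b). (ws ! b) (js ! a)) $$ (a, \<sigma> a) = (ws ! \<sigma> a) (js ! a)" by simp
  qed
  finally show ?thesis by simp
qed

text \<open>Laplace expansion along the first column. Row \<open>i\<close> belongs to the element of
  \<open>J\<close> that has \<open>i\<close> smaller ones, so the cofactor sign
  \<open>(-1) ^ i\<close> is its \<open>esign\<close>.\<close>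

lemma detm_Cons:
  assumes J: "finite J" "card J = Suc (length ws)"
  shows "detm (sorted_list_of_set J) (w # ws)
    = (\<Sum>k\<in>J. esign k J * w k * detm (sorted_list_of_set (J - {k})) ws)"
proof -
  let ?xs = "sorted_list_of_set J" and ?n = "length ws"
  let ?A = "mat (Suc ?n) (Suc ?n) (\<lambda>(a, b). ((w # ws) ! b) (?xs ! a))"
  have "detm ?xs (w # ws) = (\<Sum>i<Suc ?n. ?A $$ (i, 0) * cofactor ?A i 0)"
    unfolding detm_eq_det by (simp add: laplace_expansion_column[of _ "Suc ?n" 0])
  also have "\<dots> = (\<Sum>i<Suc ?n. esign (?xs ! i) J * w (?xs ! i) * detm (sorted_list_of_set (J - {?xs ! i})) ws)"
  proof (rule sum.cong)
    fix i assume "i \<in> {..<Suc ?n}"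
    then have i: "i < Suc ?n" by simp
    have len: "length ?xs = Suc ?n" using J by simp
    have "mat_delete ?A i 0 = mat ?n ?n (\<lambda>(a, b). (ws ! b) (sorted_list_of_set (J - {?xs ! i}) ! a))"
      using i len J
      by (intro eq_matI) (auto simp: mat_delete_def sorted_list_of_set_remove_nth nth_append)
    moreover have "esign (?xs ! i) J = (-1) ^ i"
      using sorted_list_of_set_nth_card[of J i] i J by (simp add: esign_def)
    ultimately show "?A $$ (i, 0) * cofactor ?A i 0
        = esign (?xs ! i) J * w (?xs ! i) * detm (sorted_list_of_set (J - {?xs ! i})) ws"
      using i by (simp add: cofactor_def detm_eq_det)
  qed simp
  also have "\<dots> = (\<Sum>k\<in>J. esign k J * w k * detm (sorted_list_of_set (J - {k})) ws)"
  proof (rule sum.reindex_bij_betw)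
    show "bij_betw ((!) ?xs) {..<Suc ?n} J"
      using J by (intro bij_betw_nth) auto
  qed
  finally show ?thesis .
qed

lemma evalf_Nil [simp]: "evalf \<alpha> [] p = \<alpha> {} p"
proof -
  have "{J \<in> Pow {1..6::nat}. card J = 0} = {{}}"
    by (auto dest: finite_subset)
  then show ?thesis by (simp add: evalf_def detm_def)
qed

text \<open>Filling the first slot is contraction. Hence a coefficient \<open>tcoef\<close> is a
  chain of contractions followed by evaluation at the empty set.\<close>

lemma evalf_Cons: "evalf \<alpha> (w # ws) p = evalf (ctr w \<alpha>) ws p"
proof -
  let ?n = "length ws"
  let ?S = "\<lambda>m. {J \<in> Pow {1..6::nat}. card J = m}"
  have fin: "finite J" if "J \<in> ?S m" for J m using that by (auto intro: finite_subset)
  have "evalf \<alpha> (w # ws) p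
      = (\<Sum>J\<in>?S (Suc ?n). \<Sum>k\<in>J. \<alpha> J p * (esign k J * w k * detm (sorted_list_of_set (J - {k})) ws))"
    unfolding evalf_def using fin by (intro sum.cong) (auto simp: detm_Cons sum_distrib_left)
  also have "\<dots> = (\<Sum>(J, k)\<in>(SIGMA J:?S (Suc ?n). J). \<alpha> J p * (esign k J * w k * detm (sorted_list_of_set (J - {k})) ws))"
    using fin by (intro sum.Sigma) auto
  also have "\<dots> = (\<Sum>(L, k)\<in>(SIGMA L:?S ?n. {1..6} - L). esign k L * w k * \<alpha> (insert k L) p * detm (sorted_list_of_set L) ws)"
  proof (rule sum.reindex_bij_witness[where i = "\<lambda>(L, k). (insert k L, k)" and j = "\<lambda>(J, k). (J - {k}, k)"])
    fix x assume "x \<in> (SIGMA J:?S (Suc ?n). J)"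
    then obtain J k where x: "x = (J, k)" "J \<in> ?S (Suc ?n)" "k \<in> J" by auto
    then show "(case case x of (J, k) \<Rightarrow> (J - {k}, k) of (L, k) \<Rightarrow> (insert k L, k)) = x"
      "(case x of (J, k) \<Rightarrow> (J - {k}, k)) \<in> (SIGMA L:?S ?n. {1..6} - L)"
      "(case case x of (J, k) \<Rightarrow> (J - {k}, k) of (L, k) \<Rightarrow> esign k L * w k * \<alpha> (insert k L) p * detm (sorted_list_of_set L) ws)
        = (case x of (J, k) \<Rightarrow> \<alpha> J p * (esign k J * w k * detm (sorted_list_of_set (J - {k})) ws))"
      using fin[OF x(2)] by (auto simp: insert_absorb mult_ac)
  next
    fix x assume "x \<in> (SIGMA L:?S ?n. {1..6} - L)"
    then obtain L k where x: "x = (L, k)" "L \<in> ?S ?n" "k \<in> {1..6}" "k \<notin> L" by auto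
    then show "(case case x of (L, k) \<Rightarrow> (insert k L, k) of (J, k) \<Rightarrow> (J - {k}, k)) = x"
      "(case x of (L, k) \<Rightarrow> (insert k L, k)) \<in> (SIGMA J:?S (Suc ?n). J)"
      using fin[OF x(2)] by auto
  qed
  also have "\<dots> = (\<Sum>L\<in>?S ?n. \<Sum>k\<in>{1..6} - L. esign k L * w k * \<alpha> (insert k L) p * detm (sorted_list_of_set L) ws)"
    by (intro sum.Sigma[symmetric]) auto
  also have "\<dots> = evalf (ctr w \<alpha>) ws p"
    by (simp add: evalf_def ctr_def sum_distrib_right)
  finally show ?thesis .
qed

section \<open>The exterior derivative in the complex coframe\<close>

lemma eL_sorted:
  assumes "finite I"
  shows "eL (sorted_list_of_set I) = (\<lambda>K p. if K = I then 1 else 0)"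
proof -
  have "eL ks = (\<lambda>K p. if K = set ks then 1 else 0)" if "sorted_wrt (<) ks" for ks
    using that
  proof (induction ks)
    case Nil
    then show ?case by (auto simp: one_form_def)
  next
    case (Cons k ks)
    then have IH: "eL ks = (\<lambda>K p. if K = set ks then 1 else 0)" and lt: "\<forall>l\<in>set ks. k < l" by auto
    then have nk: "k \<notin> set ks" by auto
    have "esign k (set ks) = 1"
    proof -
      have e: "{j \<in> set ks. j < k} = {}" using lt by auto
      show ?thesis unfolding esign_def e by simp
    qed
    moreover have "K - {k} = set ks \<longleftrightarrow> K = insert k (set ks)" if "k \<in> K" for K
      using that nk by auto
    ultimately show ?case
      by (intro ext) (auto simp: wedge_eb IH nk finite_subset)
  qed
  from this[of "sorted_list_of_set I"] show ?thesis using assms by simp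
qed

abbreviation uvec :: "nat \<Rightarrow> nat \<Rightarrow> complex" where
  "uvec k \<equiv> \<lambda>l. if l = k then 1 else 0"

text \<open>The exterior derivative on left-invariant forms. As an antiderivation it is the sum over
  \<open>k\<close> of \<open>de k\<close> times the contraction with \<open>E_k\<close>, and only
  \<open>e^5\<close> and \<open>e^6\<close> fail to be closed.\<close>

definition dconst :: "form \<Rightarrow> form" where
  "dconst \<alpha> = fadd (wedge (de 5) (ctr (uvec 5) \<alpha>)) (wedge (de 6) (ctr (uvec 6) \<alpha>))"

text \<open>A two-form has even degree, so the two sign changes cancel.\<close>

lemma wedge_eb_commute_de: "wedge (de m) (wedge (eb k) \<beta>) = wedge (eb k) (wedge (de m) \<beta>)"
proof -
  have "wedge (eb i) (wedge (eb j) (wedge (eb k) \<beta>)) = wedge (eb k) (wedge (eb i) (wedge (eb j) \<beta>))" for i j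
  proof (intro ext)
    fix K p
    have "wedge (eb j) (wedge (eb k) \<beta>) = fsc (-1) (wedge (eb k) (wedge (eb j) \<beta>))"
      by (intro ext) (subst wedge_eb_anticommute, simp add: fsc_def)
    then have "wedge (eb i) (wedge (eb j) (wedge (eb k) \<beta>)) = fsc (-1) (wedge (eb i) (wedge (eb k) (wedge (eb j) \<beta>)))"
      by (simp only: wedge_fsc_right)
    then show "wedge (eb i) (wedge (eb j) (wedge (eb k) \<beta>)) K p = wedge (eb k) (wedge (eb i) (wedge (eb j) \<beta>)) K p"
      by (simp add: fsc_def wedge_eb_anticommute[of i k])
  qed
  then show ?thesis
    by (simp add: wedge_de wedge_fadd_right wedge_fsc_right wedge_fzero_right)
qed

text \<open>Both sides obey the recursion of an antiderivation: the term of
  \<open>ctr_wedge_eb\<close> in which the contraction hits \<open>e^k\<close> supplies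
  \<open>de k\<close>, the other term the recursive call.\<close>

lemma dL_eq_dconst: "set ks \<subseteq> {1..6} \<Longrightarrow> dL ks = dconst (eL ks)"
proof (induction ks)
  case Nil
  then show ?case
    by (simp add: dconst_def ctr_one_form wedge_fzero_right) (simp add: fadd_def fzero_def)
next
  case (Cons k ks)
  have k: "k \<in> {1..6}" and sup: "fsup (eL ks)" using Cons.prems fsup_eL by auto
  have W: "wedge (de m) (ctr (uvec m) (wedge (eb k) (eL ks)))
     = fadd (if k = m then wedge (de m) (eL ks) else fzero) (fsc (-1) (wedge (eb k) (wedge (de m) (ctr (uvec m) (eL ks)))))" for m
    unfolding ctr_wedge_eb[OF k sup] wedge_fadd_right wedge_fsc_right wedge_eb_commute_de
    by (simp add: fsc_def fadd_def fzero_def)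
  have z: "wedge (de k) (eL ks) = fzero" if "k \<noteq> 5" "k \<noteq> 6" using that by (simp add: wedge_de)
  have "dconst (eL (k # ks)) = fadd (wedge (de k) (eL ks)) (fsc (-1) (wedge (eb k) (dconst (eL ks))))"
    unfolding dconst_def wedge_fadd_right eL.simps W
    using z by (auto simp: fadd_def fsc_def fzero_def fun_eq_iff algebra_simps)
  then show ?case using Cons by simp
qed

lemma dconst_sum:
  "dconst (\<lambda>K p. \<Sum>i\<in>A. c i p * \<alpha> i K p) K p = (\<Sum>i\<in>A. c i p * dconst (\<alpha> i) K p)"
proof -
  have "ctr w (\<lambda>K p. \<Sum>i\<in>A. c i p * \<alpha> i K p) = (\<lambda>K p. \<Sum>i\<in>A. c i p * ctr w (\<alpha> i) K p)" for w
    by (intro ext) (rule ctr_sum)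
  then show ?thesis
    by (simp add: dconst_def fadd_def wedge_sum_right sum.distrib distrib_left)
qed

lemma fsup_eq_sum_eL:
  assumes "fsup \<alpha>"
  shows "\<alpha> = (\<lambda>K p. \<Sum>I\<in>Pow {1..6}. \<alpha> I p * eL (sorted_list_of_set I) K p)"
proof (intro ext)
  fix K p
  have "(\<Sum>I\<in>Pow {1..6}. \<alpha> I p * eL (sorted_list_of_set I) K p)
      = (\<Sum>I\<in>Pow {1..6}. if I = K then \<alpha> K p else 0)"
    by (rule sum.cong) (auto simp: eL_sorted finite_subset)
  also have "\<dots> = \<alpha> K p" using assms by (simp add: fsup_def)
  finally show "\<alpha> K p = (\<Sum>I\<in>Pow {1..6}. \<alpha> I p * eL (sorted_list_of_set I) K p)" by simp
qed

lemma dform_formula: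
  assumes "fsup \<alpha>"
  shows "dform \<alpha> K p = (\<Sum>k\<in>{1..6}. wedge (eb k) (Eop k \<alpha>) K p) + dconst \<alpha> K p"
proof -
  have "fsup (Eop k \<alpha>)" for k
  proof -
    have "\<alpha> I = (\<lambda>p. 0)" if "\<not> I \<subseteq> {1..6}" for I using assms that by (simp add: fsup_def fun_eq_iff)
    then show ?thesis by (simp add: fsup_def Eop_def)
  qed
  then have "(\<Sum>I\<in>Pow {1..6}. Eop k \<alpha> I p * wedge (eb k) (eL (sorted_list_of_set I)) K p) = wedge (eb k) (Eop k \<alpha>) K p" for k
    by (subst (2) fsup_eq_sum_eL) (simp_all add: wedge_sum_right)
  moreover have "(\<Sum>I\<in>Pow {1..6}. \<alpha> I p * dL (sorted_list_of_set I) K p) = dconst \<alpha> K p"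
  proof -
    have "(\<Sum>I\<in>Pow {1..6}. \<alpha> I p * dL (sorted_list_of_set I) K p)
        = (\<Sum>I\<in>Pow {1..6}. \<alpha> I p * dconst (eL (sorted_list_of_set I)) K p)"
    proof (rule sum.cong)
      fix I :: "nat set" assume "I \<in> Pow {1..6}"
      then have "set (sorted_list_of_set I) \<subseteq> {1..6}" using finite_subset[of I "{1..6}"] by auto
      then show "\<alpha> I p * dL (sorted_list_of_set I) K p = \<alpha> I p * dconst (eL (sorted_list_of_set I)) K p"
        by (simp add: dL_eq_dconst)
    qed simp
    also have "\<dots> = dconst \<alpha> K p"
      by (subst (2) fsup_eq_sum_eL[OF assms]) (simp add: dconst_sum)
    finally show ?thesis .
  qed
  ultimately show ?thesis by (simp add: dform_eq)
qed

section \<open>Exterior algebra in the complex coframe\<close>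

lemma Zvec_values:
  "Zvec j k = (if k = 1 then (if j = 1 \<or> j = 4 then 1/2 else 0)
     else if k = 6 then (if j = 1 then - \<i>/2 else if j = 4 then \<i>/2 else 0)
     else if k = 2 then (if j = 2 \<or> j = 5 then 1/2 else 0)
     else if k = 5 then (if j = 2 then - \<i>/2 else if j = 5 then \<i>/2 else 0)
     else if k = 3 then (if j = 3 \<or> j = 6 then 1/2 else 0)
     else if k = 4 then (if j = 3 then - \<i>/2 else if j = 6 then \<i>/2 else 0) else 0)"
  by (simp add: Zvec_def Let_def)

text \<open>The coefficient vector of \<open>theta j\<close> is twice the conjugate of
  \<open>Zvec j\<close>: the covector has squared length 2, the dual vector 1/2.\<close>

lemma wedge_theta:
  "j \<in> {1..6} \<Longrightarrow> wedge (theta j) \<alpha> K p = (\<Sum>k\<in>{1..6}. 2 * cnj (Zvec j k) * wedge (eb k) \<alpha> K p)"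
  unfolding atLeast1_atMost6
  by (elim insertE; simp add: theta_def wedge_fadd_left wedge_fsc_left; simp add: fadd_def fsc_def Zvec_values)

lemma Zvec_orthonormal:
  assumes "i \<in> {1..6}" "j \<in> {1..6}"
  shows "(\<Sum>k\<in>{1..6}. 2 * cnj (Zvec i k) * Zvec j k) = (if i = j then 1 else 0)"
  using assms unfolding atLeast1_atMost6 by (elim insertE; simp add: Zvec_values)

lemma Zvec_orthonormal':
  assumes "k \<in> {1..6}" "l \<in> {1..6}"
  shows "(\<Sum>j\<in>{1..6}. Zvec j k * (2 * cnj (Zvec j l))) = (if k = l then 1 else 0)"
  using assms unfolding atLeast1_atMost6 by (elim insertE; simp add: Zvec_values)

lemma wedge_eb_theta:
  assumes "k \<in> {1..6}"
  shows "wedge (eb k) \<alpha> K p = (\<Sum>j\<in>{1..6}. Zvec j k * wedge (theta j) \<alpha> K p)"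
proof -
  have "(\<Sum>j\<in>{1..6}. Zvec j k * wedge (theta j) \<alpha> K p)
      = (\<Sum>l\<in>{1..6}. (\<Sum>j\<in>{1..6}. Zvec j k * (2 * cnj (Zvec j l))) * wedge (eb l) \<alpha> K p)"
    unfolding sum_distrib_right by (subst sum.swap) (simp add: wedge_theta sum_distrib_left mult_ac)
  also have "\<dots> = (\<Sum>l\<in>{1..6}. if l = k then wedge (eb k) \<alpha> K p else 0)"
    by (rule sum.cong) (use assms Zvec_orthonormal' in auto)
  finally show ?thesis using assms by simp
qed

abbreviation tw :: "nat \<Rightarrow> form \<Rightarrow> form" where "tw j \<equiv> wedge (theta j)"
abbreviation cz :: "nat \<Rightarrow> form \<Rightarrow> form" where "cz j \<equiv> ctr (Zvec j)"

text \<open>The anticommutation relations in the complex frame. Used as a rewrite rule they push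
  contractions inwards to \<open>one_form\<close>, where they vanish.\<close>

lemma cz_tw:
  assumes ij: "i \<in> {1..6}" "j \<in> {1..6}" and sup: "fsup \<alpha>"
  shows "cz j (tw i \<alpha>) = fadd (if i = j then \<alpha> else fzero) (fsc (-1) (tw i (cz j \<alpha>)))"
proof (intro ext)
  fix K p
  have "cz j (tw i \<alpha>) = cz j (\<lambda>K p. \<Sum>k\<in>{1..6}. 2 * cnj (Zvec i k) * wedge (eb k) \<alpha> K p)"
    using wedge_theta[OF ij(1)] by presburger
  then have "cz j (tw i \<alpha>) K p = (\<Sum>k\<in>{1..6}. 2 * cnj (Zvec i k) * cz j (wedge (eb k) \<alpha>) K p)"
    by (simp only: ctr_sum)
  also have "\<dots> = (\<Sum>k\<in>{1..6}. 2 * cnj (Zvec i k) * (Zvec j k * \<alpha> K p - wedge (eb k) (cz j \<alpha>) K p))"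
    by (intro sum.cong) (simp_all add: ctr_wedge_eb[OF _ sup] fadd_def fsc_def)
  also have "\<dots> = (\<Sum>k\<in>{1..6}. 2 * cnj (Zvec i k) * Zvec j k) * \<alpha> K p - tw i (cz j \<alpha>) K p"
    by (simp add: wedge_theta[OF ij(1)] right_diff_distrib sum_subtractf sum_distrib_right sum_distrib_left mult_ac)
  also have "\<dots> = fadd (if i = j then \<alpha> else fzero) (fsc (-1) (tw i (cz j \<alpha>))) K p"
    unfolding Zvec_orthonormal[OF ij] by (simp add: fadd_def fsc_def fzero_def)
  finally show "cz j (tw i \<alpha>) K p = fadd (if i = j then \<alpha> else fzero) (fsc (-1) (tw i (cz j \<alpha>))) K p" .
qed

lemma tcoef_evalf: "tcoef \<alpha> I p = evalf \<alpha> (map Zvec (sorted_list_of_set I)) p"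
  by (simp add: tcoef_def Zfr_eq)

text \<open>The sign is left open: the vanishing for \<open>j\<close> outside the list is what
  separates different index sets.\<close>

lemma cz_thL:
  assumes "distinct is" "set is \<subseteq> {1..6}" "j \<in> {1..6}"
  shows "\<exists>c. cz j (thL is) = fsc c (thL (remove1 j is)) \<and> (j \<notin> set is \<longrightarrow> c = 0)"
  using assms(1,2)
proof (induction "is")
  case Nil
  then show ?case by (intro exI[of _ 0]) (simp add: ctr_one_form, simp add: fsc_def fzero_def)
next
  case (Cons i "is")
  then obtain c where c: "cz j (thL is) = fsc c (thL (remove1 j is))" "j \<notin> set is \<longrightarrow> c = 0" by auto
  have i: "i \<in> {1..6}" using Cons.prems by simp
  have "cz j (thL (i # is)) = fadd (if i = j then thL is else fzero) (fsc (-1) (tw i (fsc c (thL (remove1 j is)))))"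
    using cz_tw[OF i assms(3) fsup_thL] by (simp add: c(1))
  also have "\<dots> = fsc (if i = j then 1 else - c) (thL (remove1 j (i # is)))"
  proof (cases "i = j")
    case True
    then have "c = 0" using c(2) Cons.prems by auto
    then show ?thesis using True by (simp add: wedge_fsc_right) (simp add: fadd_def fsc_def)
  next
    case False
    then show ?thesis by (simp add: wedge_fsc_right) (simp add: fadd_def fsc_def fzero_def)
  qed
  finally show ?case using c(2) by (intro exI[of _ "if i = j then 1 else - c"]) auto
qed

lemma evalf_fsc: "evalf (fsc c \<alpha>) ws p = c * evalf \<alpha> ws p"
  by (simp add: evalf_def fsc_def sum_distrib_left mult_ac)

lemma thL_empty: "js \<noteq> [] \<Longrightarrow> set js \<subseteq> {1..6} \<Longrightarrow> thL js {} p = 0"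
  by (cases js) (auto simp: wedge_theta wedge_eb)

lemma evalf_thL_eq_zero:
  assumes "distinct is" "set is \<subseteq> {1..6}" "set js \<subseteq> {1..6}" "distinct js" "set is \<noteq> set js"
  shows "evalf (thL is) (map Zvec js) p = 0"
  using assms
proof (induction js arbitrary: "is")
  case Nil
  then show ?case by (auto simp: thL_empty)
next
  case (Cons j js)
  obtain c where c: "cz j (thL is) = fsc c (thL (remove1 j is))" "j \<notin> set is \<longrightarrow> c = 0"
    using cz_thL[of "is" j] Cons.prems by auto
  show ?case
  proof (cases "j \<in> set is")
    case True
    have "evalf (thL (remove1 j is)) (map Zvec js) p = 0"
      using Cons.prems True by (intro Cons.IH) (auto simp: set_remove1_eq)
    then show ?thesis by (simp add: evalf_Cons c(1) evalf_fsc)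
  next
    case False
    then show ?thesis by (simp add: evalf_Cons c evalf_fsc)
  qed
qed

lemma evalf_thL_self:
  assumes "distinct is" "set is \<subseteq> {1..6}"
  shows "evalf (thL is) (map Zvec is) p = 1"
  using assms
proof (induction "is")
  case Nil
  then show ?case by (simp add: one_form_def)
next
  case (Cons i "is")
  obtain c where "cz i (thL is) = fsc c (thL (remove1 i is))" "i \<notin> set is \<longrightarrow> c = 0"
    using cz_thL[of "is" i] Cons.prems by auto
  then have "cz i (thL is) = fzero" using Cons.prems by (simp add: fsc_def fzero_def)
  then have "cz i (thL (i # is)) = thL is"
    using cz_tw[of i i "thL is"] Cons.prems
    by (simp add: fsup_thL wedge_fzero_right) (simp add: fadd_def fsc_def fzero_def)
  then show ?case using Cons by (simp add: evalf_Cons)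
qed

text \<open>Duality of frame and coframe on all products; it lets \<open>tcoef\<close> read off
  coefficients with respect to \<open>thL\<close> and makes \<open>proj\<close> a
  projection.\<close>

lemma tcoef_thL:
  assumes "I \<subseteq> {1..6}" "J \<subseteq> {1..6}"
  shows "tcoef (thL (sorted_list_of_set I)) J p = (if I = J then 1 else 0)"
proof -
  have "finite I" "finite J" using assms finite_subset by auto
  then show ?thesis
    using assms evalf_thL_self[of "sorted_list_of_set I" p]
      evalf_thL_eq_zero[of "sorted_list_of_set I" "sorted_list_of_set J" p]
    by (auto simp: tcoef_evalf)
qed

lemma tcoef_sum: "tcoef (\<lambda>K p. \<Sum>i\<in>A. c i p * \<alpha> i K p) J p = (\<Sum>i\<in>A. c i p * tcoef (\<alpha> i) J p)"
  unfolding tcoef_def evalf_def sum_distrib_left sum_distrib_right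
  by (subst sum.swap) (simp add: mult_ac)

lemma tcoef_sum': "tcoef (\<lambda>K p. \<Sum>i\<in>A. \<alpha> i K p) J p = (\<Sum>i\<in>A. tcoef (\<alpha> i) J p)"
  using tcoef_sum[of "\<lambda>_ _. 1"] by simp

lemma tcoef_fadd: "tcoef (fadd \<alpha> \<beta>) J p = tcoef \<alpha> J p + tcoef \<beta> J p"
  by (simp add: tcoef_def evalf_def fadd_def distrib_right sum.distrib)

lemma tcoef_proj:
  assumes "J \<subseteq> {1..6}"
  shows "tcoef (proj a b \<alpha>) J p = (if J \<in> bitype a b then tcoef \<alpha> J p else 0)"
proof -
  have "tcoef (proj a b \<alpha>) J p = (\<Sum>I\<in>bitype a b. tcoef \<alpha> I p * tcoef (thL (sorted_list_of_set I)) J p)"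
    unfolding proj_def by (rule tcoef_sum)
  also have "\<dots> = (\<Sum>I\<in>bitype a b. if I = J then tcoef \<alpha> J p else 0)"
    using assms by (intro sum.cong) (auto simp: tcoef_thL bitype_def)
  also have "\<dots> = (if J \<in> bitype a b then tcoef \<alpha> J p else 0)"
    by (simp add: bitype_def)
  finally show ?thesis .
qed

section \<open>Type components of d and \<open>bdelta\<close>\<close>

lemma proj_proj: "proj a b (proj c d \<alpha>) = (if a = c \<and> b = d then proj c d \<alpha> else fzero)"
proof (intro ext)
  fix K p
  have "tcoef (proj c d \<alpha>) I p = (if a = c \<and> b = d then tcoef \<alpha> I p else 0)" if "I \<in> bitype a b" for I
    using that tcoef_proj[of I c d \<alpha> p] by (auto simp: bitype_def)
  then show "proj a b (proj c d \<alpha>) K p = (if a = c \<and> b = d then proj c d \<alpha> else fzero) K p"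
    unfolding proj_def[of a b] by (auto simp: fzero_def proj_def intro!: sum.cong)
qed

lemma bdelta_of_type:
  assumes "proj a b \<psi> = \<psi>" "a \<le> 3" "b \<le> 3"
  shows "bdelta \<psi> K x = proj a (b + 1) (dform \<psi>) K x + (if 1 \<le> b then proj (a + 2) (b - 1) (dform \<psi>) K x else 0)"
proof -
  have pr: "proj p q \<psi> = (if (p, q) = (a, b) then \<psi> else fzero)" for p q
    using proj_proj[of p q a b \<psi>] assms(1) by auto
  have z: "proj p q (dform fzero) K x = 0" for p q
    unfolding dform_fzero proj_fzero by (simp add: fzero_def)
  have "dbar \<psi> K x = (\<Sum>i\<in>{0..3} \<times> {0..3}. if i = (a, b) then proj a (b + 1) (dform \<psi>) K x else 0)"
    unfolding dbar_def by (rule sum.cong) (auto simp: pr z split: if_splits)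
  moreover have "mu \<psi> K x = (\<Sum>i\<in>{0..3} \<times> {1..3}. if i = (a, b) then proj (a + 2) (b - 1) (dform \<psi>) K x else 0)"
    unfolding mu_def by (rule sum.cong) (auto simp: pr z split: if_splits)
  ultimately show ?thesis using assms(2,3) by (simp add: bdelta_def fadd_def)
qed

text \<open>\<open>dbar\<close> raises the conjugate degree by one, so it has no component of type
  (a,0), and \<open>mu\<close> reaches that type from (a-2,1) alone.\<close>

lemma tcoef_bdelta_holomorphic:
  assumes I: "I \<in> bitype a 0"
  shows "tcoef (bdelta \<alpha>) I x = (if 2 \<le> a then tcoef (dform (proj (a - 2) 1 \<alpha>)) I x else 0)"
proof -
  have sub: "I \<subseteq> {1..6}" and b: "I \<in> bitype p q \<longleftrightarrow> p = a \<and> q = 0" for p q using I by (auto simp: bitype_def)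
  have a3: "a \<le> 3"
  proof -
    have "card (I \<inter> {1,2,3}) \<le> card {1,2,3::nat}" by (rule card_mono) auto
    with I show ?thesis by (simp add: bitype_def)
  qed
  have "tcoef (bdelta \<alpha>) I x = tcoef (dbar \<alpha>) I x + tcoef (mu \<alpha>) I x"
    by (simp add: bdelta_def tcoef_fadd)
  also have "tcoef (dbar \<alpha>) I x = (\<Sum>i\<in>{0..3} \<times> {0..3}. tcoef (proj (fst i) (snd i + 1) (dform (proj (fst i) (snd i) \<alpha>))) I x)"
    unfolding dbar_def split_beta by (rule tcoef_sum')
  also have "\<dots> = 0"
    by (rule sum.neutral) (simp add: tcoef_proj[OF sub] b)
  also have "tcoef (mu \<alpha>) I x = (\<Sum>i\<in>{0..3} \<times> {1..3}. tcoef (proj (fst i + 2) (snd i - 1) (dform (proj (fst i) (snd i) \<alpha>))) I x)"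
    unfolding mu_def split_beta by (rule tcoef_sum')
  \<comment> \<open>The test \<open>2 \<le> a\<close> guards against truncated subtraction: for
    smaller \<open>a\<close> no pair of degrees contributes.\<close>
  also have "\<dots> = (\<Sum>i\<in>{0..3} \<times> {1..3::nat}. if i = (a - 2, 1) then (if 2 \<le> a then tcoef (dform (proj (a - 2) 1 \<alpha>)) I x else 0) else 0)"
    by (rule sum.cong) (auto simp: tcoef_proj[OF sub] b)
  also have "\<dots> = (if 2 \<le> a then tcoef (dform (proj (a - 2) 1 \<alpha>)) I x else 0)"
    using a3 by auto
  finally show ?thesis by simp
qed

text \<open>Since the \<open>e^I\<close> are orthonormal, contraction with \<open>E_k\<close> is the
  pointwise adjoint of exterior multiplication by \<open>e^k\<close>.\<close>

lemma pairing_wedge_eb: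
  assumes "k \<in> {1..6}"
  shows "(\<Sum>K\<in>Pow {1..6}. \<alpha> K p * cnj (wedge (eb k) \<beta> K p)) = (\<Sum>L\<in>Pow {1..6}. ctr (uvec k) \<alpha> L p * cnj (\<beta> L p))"
proof -
  have cs: "cnj (esign l K) = esign l K" for l K by (simp add: esign_def)
  have "(\<Sum>K\<in>Pow {1..6}. \<alpha> K p * cnj (wedge (eb k) \<beta> K p))
      = (\<Sum>K\<in>{K\<in>Pow {1..6}. k \<in> K}. \<alpha> K p * (esign k K * cnj (\<beta> (K - {k}) p)))"
    by (rule sum.mono_neutral_cong_right) (auto simp: wedge_eb cs finite_subset)
  also have "\<dots> = (\<Sum>L\<in>{L\<in>Pow {1..6}. k \<notin> L}. esign k L * \<alpha> (insert k L) p * cnj (\<beta> L p))"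
    by (rule sum.reindex_bij_witness[where i = "insert k" and j = "\<lambda>K. K - {k}"])
      (use assms in \<open>auto simp: insert_absorb\<close>)
  also have "\<dots> = (\<Sum>L\<in>Pow {1..6}. ctr (uvec k) \<alpha> L p * cnj (\<beta> L p))"
  proof (rule sum.mono_neutral_cong_left)
    have *: "ctr (uvec k) \<alpha> L p = (if k \<notin> L then esign k L * \<alpha> (insert k L) p else 0)" for L
    proof -
      have "ctr (uvec k) \<alpha> L p = (\<Sum>l\<in>{1..6} - L. if l = k then esign k L * \<alpha> (insert k L) p else 0)"
        unfolding ctr_def by (rule sum.cong) auto
      then show ?thesis using assms by simp
    qed
    show "\<forall>L\<in>Pow {1..6} - {L \<in> Pow {1..6}. k \<notin> L}. ctr (uvec k) \<alpha> L p * cnj (\<beta> L p) = 0"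
      and "\<And>L. L \<in> {L \<in> Pow {1..6}. k \<notin> L} \<Longrightarrow>
        esign k L * \<alpha> (insert k L) p * cnj (\<beta> L p) = ctr (uvec k) \<alpha> L p * cnj (\<beta> L p)"
      by (auto simp: *)
  qed auto
  finally show ?thesis .
qed

lemma ctr_Zvec: "cz j \<alpha> L p = (\<Sum>k\<in>{1..6}. Zvec j k * ctr (uvec k) \<alpha> L p)"
proof -
  have "Zvec j l = (\<Sum>k\<in>{1..6}. Zvec j k * uvec k l)" for l
  proof -
    have "(\<Sum>k\<in>{1..6}. Zvec j k * uvec k l) = (\<Sum>k\<in>{1..6}. if k = l then Zvec j l else 0)"
      by (rule sum.cong) auto
    also have "\<dots> = Zvec j l" by (auto simp: Zvec_values)
    finally show ?thesis by simp
  qed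
  then have "Zvec j = (\<lambda>l. \<Sum>k\<in>{1..6}. Zvec j k * uvec k l)" by (rule ext)
  then have "cz j \<alpha> L p = ctr (\<lambda>l. \<Sum>k\<in>{1..6}. Zvec j k * uvec k l) \<alpha> L p"
    by (rule arg_cong[where f = "\<lambda>w. ctr w \<alpha> L p"])
  then show ?thesis by (simp only: ctr_vector_sum)
qed

lemma pairing_wedge_theta:
  assumes j: "j \<in> {1..6}"
  shows "(\<Sum>K\<in>Pow {1..6}. \<alpha> K p * cnj (tw j \<beta> K p)) = 2 * (\<Sum>L\<in>Pow {1..6}. cz j \<alpha> L p * cnj (\<beta> L p))"
proof -
  have "(\<Sum>K\<in>Pow {1..6}. \<alpha> K p * cnj (tw j \<beta> K p))
      = (\<Sum>k\<in>{1..6}. 2 * Zvec j k * (\<Sum>K\<in>Pow {1..6}. \<alpha> K p * cnj (wedge (eb k) \<beta> K p)))"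
    unfolding sum_distrib_left by (subst sum.swap) (simp add: wedge_theta[OF j] sum_distrib_left mult_ac)
  also have "\<dots> = (\<Sum>k\<in>{1..6}. 2 * Zvec j k * (\<Sum>L\<in>Pow {1..6}. ctr (uvec k) \<alpha> L p * cnj (\<beta> L p)))"
    by (simp add: pairing_wedge_eb)
  also have "\<dots> = 2 * (\<Sum>L\<in>Pow {1..6}. cz j \<alpha> L p * cnj (\<beta> L p))"
    unfolding sum_distrib_left ctr_Zvec sum_distrib_right
    by (subst sum.swap) (simp add: mult_ac)
  finally show ?thesis .
qed

text \<open>Peeling off the factors one by one, each contributes the squared length 2 of a covector
  \<open>theta j\<close>.\<close>

lemma pairing_thL:
  "set js \<subseteq> {1..6} \<Longrightarrow> (\<Sum>K\<in>Pow {1..6}. \<alpha> K p * cnj (thL js K p)) = 2 ^ length js * evalf \<alpha> (map Zvec js) p"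
proof (induction js arbitrary: \<alpha>)
  case Nil
  have "(\<Sum>K\<in>Pow {1..6}. \<alpha> K p * cnj (one_form K p)) = (\<Sum>K\<in>Pow {1..6::nat}. if K = {} then \<alpha> {} p else 0)"
    by (rule sum.cong) (auto simp: one_form_def)
  then show ?case by simp
next
  case (Cons j js)
  then show ?case by (simp add: pairing_wedge_theta evalf_Cons)
qed

definition Zderiv :: "nat \<Rightarrow> (pt \<Rightarrow> complex) \<Rightarrow> pt \<Rightarrow> complex" where
  "Zderiv j f p = (\<Sum>k\<in>{1..6}. Zvec j k * Ederiv k f p)"

lemma dform_fmul:
  assumes f: "smooth f" and sup: "fsup \<Theta>" and const: "fconst \<Theta>"
  shows "dform (fmul f \<Theta>) K p = (\<Sum>j\<in>{1..6}. Zderiv j f p * tw j \<Theta> K p) + f p * dconst \<Theta> K p"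
proof -
  have "Eop k (fmul f \<Theta>) = fmul (Ederiv k f) \<Theta>" for k
  proof (intro ext)
    fix K p
    have "\<Theta> K = (\<lambda>q. \<Theta> K p)" using const by (auto simp: fconst_def)
    then have "fmul f \<Theta> K = (\<lambda>q. \<Theta> K p * f q)" by (simp add: fmul_def fun_eq_iff mult.commute)
    then show "Eop k (fmul f \<Theta>) K p = fmul (Ederiv k f) \<Theta> K p"
      using Ederiv_cmult[OF f, of k "\<Theta> K p" p] by (simp add: Eop_def fmul_def mult.commute)
  qed
  moreover have "dconst (fmul f \<Theta>) = fmul f (dconst \<Theta>)"
    by (simp add: dconst_def ctr_fmul wedge_fmul_right) (simp add: fmul_def fadd_def distrib_left)
  ultimately have "dform (fmul f \<Theta>) K p = (\<Sum>k\<in>{1..6}. Ederiv k f p * wedge (eb k) \<Theta> K p) + f p * dconst \<Theta> K p"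
    using dform_formula[of "fmul f \<Theta>"] sup by (simp add: fsup_simps wedge_fmul_right) (simp add: fmul_def)
  also have "(\<Sum>k\<in>{1..6}. Ederiv k f p * wedge (eb k) \<Theta> K p) = (\<Sum>k\<in>{1..6}. \<Sum>j\<in>{1..6}. Ederiv k f p * (Zvec j k * tw j \<Theta> K p))"
    by (simp add: wedge_eb_theta sum_distrib_left)
  also have "\<dots> = (\<Sum>j\<in>{1..6}. Zderiv j f p * tw j \<Theta> K p)"
    unfolding Zderiv_def sum_distrib_right by (subst sum.swap) (simp add: mult_ac)
  finally show ?thesis .
qed

lemma dform_sum:
  assumes "\<And>i K. i \<in> A \<Longrightarrow> smooth (\<alpha> i K)"
  shows "dform (\<lambda>K p. \<Sum>i\<in>A. \<alpha> i K p) K p = (\<Sum>i\<in>A. dform (\<alpha> i) K p)"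
proof -
  have "dform (\<lambda>K p. \<Sum>i\<in>A. \<alpha> i K p) K p
     = (\<Sum>k\<in>{1..6}. \<Sum>I\<in>Pow {1..6}. \<Sum>i\<in>A. Eop k (\<alpha> i) I p * wedge (eb k) (eL (sorted_list_of_set I)) K p)
    + (\<Sum>I\<in>Pow {1..6}. \<Sum>i\<in>A. \<alpha> i I p * dL (sorted_list_of_set I) K p)"
    using assms by (simp add: dform_eq Eop_def Ederiv_sum sum_distrib_right)
  also have "\<dots> = (\<Sum>i\<in>A. dform (\<alpha> i) K p)"
    unfolding dform_eq sum.distrib
    by (subst (2) sum.swap, subst sum.swap, subst (3) sum.swap) simp
  finally show ?thesis .
qed

lemma tcoef_Aall:
  assumes "\<alpha> \<in> Aall" "finite J"
  shows "smooth (tcoef \<alpha> J)" "ginv (tcoef \<alpha> J)"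
proof -
  have eq: "tcoef \<alpha> J = (\<lambda>p. \<Sum>L\<in>{L\<in>Pow {1..6}. card L = card J}.
      detm (sorted_list_of_set L) (map Zvec (sorted_list_of_set J)) * \<alpha> L p)"
    by (intro ext) (simp add: tcoef_eq_sum[OF assms(2)] mult.commute)
  show "smooth (tcoef \<alpha> J)" "ginv (tcoef \<alpha> J)"
    unfolding eq using assms(1)
    by (auto simp: Aall_iff intro!: smooth_sum smooth_cmult ginv_sum ginv_mult ginv_const)
qed

lemma tcoef_dform_fmul:
  assumes f: "smooth f" and sup: "fsup \<Theta>" and const: "fconst \<Theta>"
  shows "tcoef (dform (fmul f \<Theta>)) J p
    = (\<Sum>j\<in>{1..6}. Zderiv j f p * tcoef (tw j \<Theta>) J p) + f p * tcoef (dconst \<Theta>) J p"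
proof -
  \<comment> \<open>The second term is written as a sum over a singleton to fit
    \<open>tcoef_sum\<close>, which pulls out point-dependent scalars.\<close>
  have "dform (fmul f \<Theta>)
      = fadd (\<lambda>K p. \<Sum>j\<in>{1..6}. Zderiv j f p * tw j \<Theta> K p) (\<lambda>K p. \<Sum>i\<in>{0::nat}. f p * dconst \<Theta> K p)"
    by (intro ext) (simp add: dform_fmul[OF assms] fadd_def)
  then show ?thesis by (simp only: tcoef_fadd tcoef_sum) simp
qed

lemma finite_bitype: "finite (bitype a b)" and bitype_finite: "I \<in> bitype a b \<Longrightarrow> finite I"
  and bitype_subset: "I \<in> bitype a b \<Longrightarrow> I \<subseteq> {1..6}"
  by (auto simp: bitype_def intro: finite_subset)

lemma tcoef_dform_proj:
  assumes "\<alpha> \<in> Aall"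
  shows "tcoef (dform (proj a b \<alpha>)) J p = (\<Sum>I\<in>bitype a b.
    (\<Sum>j\<in>{1..6}. Zderiv j (tcoef \<alpha> I) p * tcoef (thL (j # sorted_list_of_set I)) J p)
     + tcoef \<alpha> I p * tcoef (dconst (thL (sorted_list_of_set I))) J p)"
proof -
  let ?\<beta> = "\<lambda>I. fmul (tcoef \<alpha> I) (thL (sorted_list_of_set I))"
  have "smooth (?\<beta> I K)" if "I \<in> bitype a b" for I K
  proof -
    have "thL (sorted_list_of_set I) K = (\<lambda>q. thL (sorted_list_of_set I) K 0)"
      using fconst_thL[of "sorted_list_of_set I"] by (auto simp: fconst_def)
    then have "?\<beta> I K = (\<lambda>p. thL (sorted_list_of_set I) K 0 * tcoef \<alpha> I p)"
      by (simp add: fmul_def fun_eq_iff mult.commute)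
    then show ?thesis
      using tcoef_Aall(1)[OF assms bitype_finite[OF that]] by (simp add: smooth_cmult)
  qed
  then have "dform (\<lambda>K p. \<Sum>I\<in>bitype a b. ?\<beta> I K p) = (\<lambda>K p. \<Sum>I\<in>bitype a b. dform (?\<beta> I) K p)"
    by (intro ext dform_sum) auto
  moreover have "proj a b \<alpha> = (\<lambda>K p. \<Sum>I\<in>bitype a b. ?\<beta> I K p)"
    by (simp add: proj_def fmul_def)
  ultimately have "tcoef (dform (proj a b \<alpha>)) J p = (\<Sum>I\<in>bitype a b. tcoef (dform (?\<beta> I)) J p)"
    by (simp only: tcoef_sum')
  then show ?thesis
    by (simp add: tcoef_dform_fmul tcoef_Aall(1)[OF assms] bitype_finite fsup_thL fconst_thL)
qed

lemma proj_combination: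
  assumes "\<psi> = (\<lambda>K p. \<Sum>I\<in>bitype a b. g I p * thL (sorted_list_of_set I) K p)"
  shows "proj a b \<psi> = \<psi>"
proof -
  have "tcoef \<psi> J p = g J p" if "J \<in> bitype a b" for J p
  proof -
    have "tcoef \<psi> J p = (\<Sum>I\<in>bitype a b. g I p * tcoef (thL (sorted_list_of_set I)) J p)"
      unfolding assms by (rule tcoef_sum)
    also have "\<dots> = (\<Sum>I\<in>bitype a b. if I = J then g J p else 0)"
      using that by (intro sum.cong) (auto simp: tcoef_thL bitype_subset)
    finally show ?thesis using that by (simp add: finite_bitype)
  qed
  then show ?thesis by (subst (2) assms) (simp add: proj_def)
qed

text \<open>As \<open>\<psi>\<close> has conjugate degree 0, \<open>bdelta\<close> acts on it as
  \<open>dbar\<close> alone, so each (n,1)-coefficient of its exterior derivative yields one scalar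
  first-order equation.\<close>

lemma dbar_equations:
  assumes \<psi>: "\<psi> \<in> Apq n 0" and n: "n \<le> 3" and z: "bdelta \<psi> = fzero" and I: "I \<in> bitype n 1"
  shows "(\<Sum>J\<in>bitype n 0. (\<Sum>j\<in>{1..6}. Zderiv j (tcoef \<psi> J) p * tcoef (thL (j # sorted_list_of_set J)) I p)
     + tcoef \<psi> J p * tcoef (dconst (thL (sorted_list_of_set J))) I p) = 0"
proof -
  have A: "\<psi> \<in> Aall" and pr: "proj n 0 \<psi> = \<psi>" using \<psi> by (auto simp: Apq_def)
  have "bdelta \<psi> = proj n 1 (dform \<psi>)"
    by (intro ext) (simp add: bdelta_of_type[OF pr n])
  then have "tcoef (dform \<psi>) I p = tcoef fzero I p"
    using tcoef_proj[OF bitype_subset[OF I], of n 1 "dform \<psi>" p] I z by simp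
  also have "\<dots> = 0" by (simp add: tcoef_def evalf_def fzero_def)
  finally have "tcoef (dform (proj n 0 \<psi>)) I p = 0" by (simp add: pr)
  then show ?thesis by (simp add: tcoef_dform_proj[OF A])
qed

text \<open>Expanding \<open>\<psi>\<close> in the products \<open>thL\<close>, each of squared
  length \<open>2 ^ n\<close>, makes the pairing see only the (n,0)-coefficients of
  \<open>\<beta>\<close>.\<close>

lemma l2_holomorphic:
  assumes \<psi>: "\<psi> \<in> Apq n 0"
  shows "l2 \<beta> \<psi> = integral fdom (\<lambda>p. \<Sum>J\<in>bitype n 0. cnj (tcoef \<psi> J p) * (2 ^ n * tcoef \<beta> J p))"
  unfolding l2_def
proof (rule Henstock_Kurzweil_Integration.integral_cong)
  fix p
  have pr: "proj n 0 \<psi> = \<psi>" using \<psi> by (auto simp: Apq_def)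
  have card: "card J = n" if "J \<in> bitype n 0" for J
  proof -
    have "J = (J \<inter> {1,2,3}) \<union> (J \<inter> {4,5,6})" using bitype_subset[OF that] unfolding atLeast1_atMost6 by auto
    moreover have "J \<inter> {4,5,6} = {}" using that bitype_finite[OF that] by (auto simp: bitype_def)
    ultimately show ?thesis using that by (simp add: bitype_def)
  qed
  have "(\<Sum>K\<in>Pow {1..6}. \<beta> K p * cnj (\<psi> K p))
      = (\<Sum>K\<in>Pow {1..6}. \<Sum>J\<in>bitype n 0. cnj (tcoef \<psi> J p) * (\<beta> K p * cnj (thL (sorted_list_of_set J) K p)))"
    by (subst pr[symmetric]) (simp add: proj_def sum_distrib_left mult_ac)
  also have "\<dots> = (\<Sum>J\<in>bitype n 0. cnj (tcoef \<psi> J p) * (\<Sum>K\<in>Pow {1..6}. \<beta> K p * cnj (thL (sorted_list_of_set J) K p)))"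
    unfolding sum_distrib_left by (rule sum.swap)
  also have "\<dots> = (\<Sum>J\<in>bitype n 0. cnj (tcoef \<psi> J p) * (2 ^ n * tcoef \<beta> J p))"
    using bitype_subset bitype_finite card
    by (intro sum.cong refl arg_cong2[where f = "(*)"]) (simp add: pairing_thL tcoef_evalf)
  finally show "(\<Sum>I\<in>Pow {1..6}. \<beta> I p * cnj (\<psi> I p)) = (\<Sum>J\<in>bitype n 0. cnj (tcoef \<psi> J p) * (2 ^ n * tcoef \<beta> J p))" .
qed

section \<open>Structure constants in the complex coframe\<close>

lemma bitype_1_0: "bitype 1 0 = {{1},{2},{3}}"
  and bitype_2_0: "bitype 2 0 = {{1,2},{1,3},{2,3}}"
  and bitype_3_0: "bitype 3 0 = {{1,2,3}}"
  and bitype_0_1: "bitype 0 1 = {{4},{5},{6}}"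
proof -
  have P: "Pow {1,2,3::nat} = {{}, {1}, {2}, {3}, {1,2}, {1,3}, {2,3}, {1,2,3}}"
    by (auto simp: Pow_insert)
  have Q: "Pow {4,5,6::nat} = {{}, {4}, {5}, {6}, {4,5}, {4,6}, {5,6}, {4,5,6}}"
    by (auto simp: Pow_insert)
  have a: "bitype a 0 = {I \<in> Pow {1,2,3::nat}. card I = a}" for a
  proof (intro Set.set_eqI iffI)
    fix I assume I: "I \<in> bitype a 0"
    then have "I \<inter> {4,5,6} = {}" using bitype_finite[OF I] by (auto simp: bitype_def)
    then have "I \<subseteq> {1,2,3}" using bitype_subset[OF I] unfolding atLeast1_atMost6 by blast
    then show "I \<in> {I \<in> Pow {1,2,3::nat}. card I = a}" using I by (simp add: bitype_def Int_absorb2)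
  next
    fix I assume I: "I \<in> {I \<in> Pow {1,2,3::nat}. card I = a}"
    then have s: "I \<subseteq> {1,2,3}" by simp
    have "I \<inter> {4,5,6} = {}" using s by auto
    moreover have "I \<inter> {1,2,3} = I" using s by (rule Int_absorb2)
    moreover have "I \<subseteq> {1..6}" by (rule order_trans[OF s]) auto
    ultimately show "I \<in> bitype a 0" using I by (simp add: bitype_def)
  qed
  have b: "bitype 0 b = {I \<in> Pow {4,5,6::nat}. card I = b}" for b
  proof (intro Set.set_eqI iffI)
    fix I assume I: "I \<in> bitype 0 b"
    then have "I \<inter> {1,2,3} = {}" using bitype_finite[OF I] by (auto simp: bitype_def)
    then have "I \<subseteq> {4,5,6}" using bitype_subset[OF I] unfolding atLeast1_atMost6 by blast
    then show "I \<in> {I \<in> Pow {4,5,6::nat}. card I = b}" using I by (simp add: bitype_def Int_absorb2)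
  next
    fix I assume I: "I \<in> {I \<in> Pow {4,5,6::nat}. card I = b}"
    then have s: "I \<subseteq> {4,5,6}" by simp
    have "I \<inter> {1,2,3} = {}" using s by auto
    moreover have "I \<inter> {4,5,6} = I" using s by (rule Int_absorb2)
    moreover have "I \<subseteq> {1..6}" by (rule order_trans[OF s]) auto
    ultimately show "I \<in> bitype 0 b" using I by (simp add: bitype_def)
  qed
  have filter: "{I \<in> insert A B. R I} = (if R A then insert A {I \<in> B. R I} else {I \<in> B. R I})"
    for A :: "nat set" and B and R by auto
  show "bitype 1 0 = {{1},{2},{3}}" "bitype 2 0 = {{1,2},{1,3},{2,3}}" "bitype 3 0 = {{1,2,3}}"
    unfolding a P filter by simp_all
  show "bitype 0 1 = {{4},{5},{6}}"
    unfolding b Q filter by simp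
qed

text \<open>Translates \<open>dconst\<close> to the complex frame through
  \<open>E_5 = i (Z_2 - Z_5)\<close> and \<open>E_6 = i (Z_1 - Z_4)\<close>.\<close>

lemma ctr_uvec:
  "ctr (uvec 5) \<alpha> = fadd (fsc \<i> (cz 2 \<alpha>)) (fsc (-\<i>) (cz 5 \<alpha>))"
  "ctr (uvec 6) \<alpha> = fadd (fsc \<i> (cz 1 \<alpha>)) (fsc (-\<i>) (cz 4 \<alpha>))"
  by (intro ext, simp add: fadd_def fsc_def ctr_Zvec, simp add: atLeast1_atMost6 Zvec_values algebra_simps)+

lemma wedge_eb_theta_explicit:
  "wedge (eb 1) \<alpha> = fsc (1/2) (fadd (tw 1 \<alpha>) (tw 4 \<alpha>))"
  "wedge (eb 2) \<alpha> = fsc (1/2) (fadd (tw 2 \<alpha>) (tw 5 \<alpha>))"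
  "wedge (eb 3) \<alpha> = fsc (1/2) (fadd (tw 3 \<alpha>) (tw 6 \<alpha>))"
  "wedge (eb 4) \<alpha> = fsc (-\<i>/2) (fadd (tw 3 \<alpha>) (fsc (-1) (tw 6 \<alpha>)))"
  by (intro ext, subst wedge_eb_theta, simp, simp add: fadd_def fsc_def,
      simp add: atLeast1_atMost6 Zvec_values field_simps)+

lemma fadd_fsc_fzero [simp]:
  "fadd fzero \<alpha> = \<alpha>" "fadd \<alpha> fzero = \<alpha>" "fsc c fzero = fzero" "fsc c (fsc d \<alpha>) = fsc (c * d) \<alpha>"
  "fsc c (fadd \<alpha> \<beta>) = fadd (fsc c \<alpha>) (fsc c \<beta>)"
  by (simp_all add: fadd_def fsc_def fzero_def algebra_simps)

lemma form_at_empty: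
  "fadd \<alpha> \<beta> K p = \<alpha> K p + \<beta> K p" "fsc c \<alpha> K p = c * \<alpha> K p" "fzero K p = 0"
  "j \<in> {1..6} \<Longrightarrow> tw j \<alpha> {} p = 0" "one_form {} p = 1"
  by (simp_all add: fadd_def fsc_def fzero_def one_form_def wedge_theta wedge_eb)

text \<open>The rewriting that evaluates a coefficient: contractions move through the factors
  \<open>theta j\<close>; at the empty set a remaining exterior product gives 0 and
  \<open>one_form\<close> gives 1.\<close>

lemmas exterior_simps = evalf_Cons ctr_fadd ctr_fsc ctr_fzero ctr_one_form cz_tw
  wedge_fadd_right wedge_fsc_right wedge_fzero_right fsup_wedge fsup_theta fsup_simps form_at_empty

lemmas dconst_simps = dconst_def ctr_uvec wedge_de wedge_eb_theta_explicit

section \<open>Harmonic (p,0)-forms\<close>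

lemma Zderiv_bar:
  "Zderiv 4 f p = (Ederiv 1 f p + \<i> * Ederiv 6 f p) / 2"
  "Zderiv 5 f p = (Ederiv 2 f p + \<i> * Ederiv 5 f p) / 2"
  "Zderiv 6 f p = (Ederiv 3 f p + \<i> * Ederiv 4 f p) / 2"
  by (simp_all add: Zderiv_def atLeast1_atMost6 Zvec_values add_divide_distrib)

lemma Zderiv_add:
  "smooth f \<Longrightarrow> smooth g \<Longrightarrow> Zderiv j (\<lambda>p. f p + c * g p) p = Zderiv j f p + c * Zderiv j g p"
  by (simp add: Zderiv_def Ederiv_add Ederiv_cmult smooth_cmult distrib_left sum.distrib sum_distrib_left mult_ac)

lemma Zderiv_const [simp]: "Zderiv j (\<lambda>p. c) p = 0"
  by (simp add: Zderiv_def)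

lemma holomorphic_imp_constant:
  assumes f: "smooth f" "ginv f"
    and z: "\<And>p. Zderiv 4 f p = 0" "\<And>p. Zderiv 5 f p = 0" "\<And>p. Zderiv 6 f p = 0"
  shows "f p = f q"
proof (rule constant_of_Ederiv_eq_zero[OF f(1)])
  fix k :: nat and p assume k: "k \<in> {1..6}"
  have CR: "Ederiv 1 f p + \<i> * Ederiv 6 f p = 0" "Ederiv 2 f p + \<i> * Ederiv 5 f p = 0"
    "Ederiv 3 f p + \<i> * Ederiv 4 f p = 0" for p
    using z[of p] by (simp_all add: Zderiv_bar)
  have "Ederiv 1 f p = 0" "Ederiv 6 f p = 0" "Ederiv 2 f p = 0" "Ederiv 5 f p = 0" "Ederiv 3 f p = 0" "Ederiv 4 f p = 0"
    by (rule Ederiv_eq_zero_of_CR[OF f _ CR(1)] Ederiv_eq_zero_of_CR[OF f _ CR(2)] Ederiv_eq_zero_of_CR[OF f _ CR(3)], simp)+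
  then show "Ederiv k f p = 0" using k unfolding atLeast1_atMost6 by (elim insertE) simp_all
qed

lemma Zderiv_constant_eq_zero:
  assumes f: "smooth f" "ginv f" and c: "\<And>p. Zderiv j f p = c"
  shows "c = 0"
proof -
  have int: "Ederiv k f integrable_on fdom" if "k \<in> {1..6}" for k
    by (intro integrable_on_fdom smooth_continuous smooth_Ederiv f that)
  have "integral fdom (\<lambda>p. \<Sum>k\<in>{1..6}. Zvec j k * Ederiv k f p) = (\<Sum>k\<in>{1..6}. Zvec j k * integral fdom (Ederiv k f))"
    using int by (subst integral_sum) (auto simp: integrable_on_mult_right)
  also have "\<dots> = 0" by (simp add: integral_Ederiv[OF f])
  finally have "integral fdom (\<lambda>p. c) = 0" using c by (simp add: Zderiv_def)
  then show ?thesis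
    by (simp add: fdom_eq_cbox content_Pair content_cbox_complex)
qed

lemma Aall_fmul:
  assumes g: "smooth g" "ginv g" and "fsup \<Theta>" "fconst \<Theta>"
  shows "fmul g \<Theta> \<in> Aall"
proof -
  have "fmul g \<Theta> K = (\<lambda>p. \<Theta> K 0 * g p)" for K
    using assms(4) by (auto simp: fmul_def fconst_def mult.commute)
  then show ?thesis using assms(3)
    by (auto simp: Aall_iff fsup_def g intro!: smooth_cmult ginv_mult ginv_const)
qed

lemma proj_fmul_thL:
  assumes "I \<in> bitype a b"
  shows "proj a b (fmul g (thL (sorted_list_of_set I))) = fmul g (thL (sorted_list_of_set I))"
proof (rule proj_combination[where g = "\<lambda>J p. if J = I then g p else 0"], intro ext)
  fix K p
  have "(\<Sum>J\<in>bitype a b. (if J = I then g p else 0) * thL (sorted_list_of_set J) K p)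
      = (\<Sum>J\<in>bitype a b. if J = I then g p * thL (sorted_list_of_set I) K p else 0)"
    by (rule sum.cong) auto
  then show "fmul g (thL (sorted_list_of_set I)) K p
      = (\<Sum>J\<in>bitype a b. (if J = I then g p else 0) * thL (sorted_list_of_set J) K p)"
    using assms by (simp add: finite_bitype fmul_def)
qed

text \<open>Definiteness of \<open>l2\<close>, applied to the 0-form with coefficient
  \<open>g\<close>.\<close>

lemma integral_cnj_mult_self_eq_zero:
  assumes g: "smooth g" "ginv g" and int: "integral fdom (\<lambda>p. cnj (g p) * g p) = 0"
  shows "g p = 0"
proof -
  have "fmul g one_form \<in> Aall"
    by (rule Aall_fmul[OF g]) (simp_all add: fsup_simps fconst_simps)
  moreover have "l2 (fmul g one_form) (fmul g one_form) = 0"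
  proof -
    have "(\<Sum>I\<in>Pow {1..6}. fmul g one_form I p * cnj (fmul g one_form I p))
        = (\<Sum>I\<in>Pow {1..6::nat}. if I = {} then cnj (g p) * g p else 0)" for p
      by (rule sum.cong) (auto simp: fmul_def one_form_def)
    then show ?thesis using int by (simp add: l2_def)
  qed
  ultimately have "fmul g one_form {} p = fzero {} p"
    using l2_self_eq_zero by metis
  then show ?thesis by (simp add: fmul_def one_form_def fzero_def)
qed

lemma harm_1_sub:
  assumes "\<psi> \<in> harm 1"
  shows "\<exists>c. \<psi> = fsc c (thL [3])"
proof -
  have \<psi>: "\<psi> \<in> Apq 1 0" "bdelta \<psi> = fzero" using assms by (auto simp: harm_iff)
  then have A: "\<psi> \<in> Aall" and pr: "proj 1 0 \<psi> = \<psi>" by (auto simp: Apq_def)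
  define f where "f j = tcoef \<psi> {j}" for j
  have sm: "smooth (f j)" and gi: "ginv (f j)" for j
    unfolding f_def by (auto intro: tcoef_Aall A)
  have mem: "{a, b} \<in> bitype 1 1" if "a \<in> {1,2,3}" "b \<in> {4,5,6}" for a b
    using that by (auto simp: bitype_def)
  have eq: "(\<Sum>J\<in>{{1},{2},{3}}. (\<Sum>j\<in>{1..6}. Zderiv j (tcoef \<psi> J) p * tcoef (thL (j # sorted_list_of_set J)) {a,b} p)
     + tcoef \<psi> J p * tcoef (dconst (thL (sorted_list_of_set J))) {a,b} p) = 0" if "a \<in> {1,2,3}" "b \<in> {4,5,6}" for a b p
    using dbar_equations[OF \<psi>(1) _ \<psi>(2) mem[OF that], of p] unfolding bitype_1_0 by simp
  \<comment> \<open>Rewriting with \<open>tcoef_evalf\<close> and \<open>evalf_Cons\<close> also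
    unfolds the coefficients of \<open>\<psi>\<close> into contractions; \<open>F\<close> folds them
    back.\<close>
  have F: "cz j \<psi> {} p = f j p" for j p by (simp add: f_def tcoef_evalf evalf_Cons)
  note S = tcoef_evalf dconst_simps exterior_simps atLeast1_atMost6 f_def[symmetric] F
  have e14: "Zderiv 4 (f 1) p = 0" for p
    using eq[of 1 4 p] by (simp add: S)
  have e15: "Zderiv 5 (f 1) p = 0" for p
    using eq[of 1 5 p] by (simp add: S)
  have e16: "Zderiv 6 (f 1) p = (f 1 p - \<i> * f 2 p) / 4" for p
    using eq[of 1 6 p] by (simp add: S) (auto simp: field_simps)
  have e24: "Zderiv 4 (f 2) p = 0" for p
    using eq[of 2 4 p] by (simp add: S)
  have e25: "Zderiv 5 (f 2) p = 0" for p
    using eq[of 2 5 p] by (simp add: S)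
  have e26: "Zderiv 6 (f 2) p = - (\<i> * f 1 p + f 2 p) / 4" for p
  proof -
    have "- (4 * Zderiv 6 (f 2) p) = \<i> * f 1 p + f 2 p"
      using eq[of 2 6 p] by (simp add: S) (simp add: field_simps)
    then have "4 * Zderiv 6 (f 2) p = - (\<i> * f 1 p + f 2 p)" by (metis minus_minus)
    then show ?thesis by (simp add: eq_divide_eq mult.commute)
  qed
  have e34: "Zderiv 4 (f 3) p = (f 1 p + \<i> * f 2 p) / 4" for p
    using eq[of 3 4 p] by (simp add: S) (auto simp: field_simps)
  have e35: "Zderiv 5 (f 3) p = (\<i> * f 1 p - f 2 p) / 4" for p
    using eq[of 3 5 p] by (simp add: S) (auto simp: field_simps)
  have e36: "Zderiv 6 (f 3) p = 0" for p
    using eq[of 3 6 p] by (simp add: S)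
  \<comment> \<open>The right-hand sides of \<open>e16\<close> and \<open>e26\<close> are
    \<open>g / 4\<close> and \<open>- \<i> * g / 4\<close>, which cancel in the derivative of
    \<open>g\<close> along \<open>Z_6\<close>.\<close>
  define g where "g p = f 1 p + - \<i> * f 2 p" for p
  have smg: "smooth g" and gig: "ginv g"
    unfolding g_def by (intro smooth_add smooth_cmult sm ginv_add ginv_mult ginv_const gi)+
  have Zg: "Zderiv j g p = Zderiv j (f 1) p + - \<i> * Zderiv j (f 2) p" for j p
    unfolding g_def by (rule Zderiv_add[OF sm sm])
  have gc: "g p = g 0" for p
    by (rule holomorphic_imp_constant[OF smg gig]) (simp_all add: Zg e14 e15 e16 e24 e25 e26 field_simps)
  have "g 0 / 4 = 0"
  proof (rule Zderiv_constant_eq_zero[OF sm gi])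
    show "Zderiv 6 (f 1) p = g 0 / 4" for p
      using gc[of p] by (simp add: e16 g_def)
  qed
  then have g0: "f 1 p = \<i> * f 2 p" for p using gc[of p] by (simp add: g_def)
  have c1: "f 1 p = f 1 0" for p
    by (rule holomorphic_imp_constant[OF sm gi]) (simp_all add: e14 e15 e16 g0)
  \<comment> \<open>With \<open>f 1 = \<i> * f 2\<close> the two terms of \<open>e34\<close> add up
    instead of cancelling, so the constant \<open>f 1 / 2\<close> is a derivative of
    \<open>f 3\<close>.\<close>
  have "f 1 0 / 2 = 0"
  proof (rule Zderiv_constant_eq_zero[OF sm gi])
    show "Zderiv 4 (f 3) p = f 1 0 / 2" for p
      using c1[of p] g0[of p] by (simp add: e34)
  qed
  then have f1: "f 1 p = 0" for p using c1 by simp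
  then have f2: "f 2 p = 0" for p using g0[of p] by simp
  have c3: "f 3 p = f 3 0" for p
    by (rule holomorphic_imp_constant[OF sm gi]) (simp_all add: e34 e35 e36 f1 f2)
  have "\<psi> K p = fsc (f 3 0) (thL [3]) K p" for K p
  proof -
    have "\<psi> K p = proj 1 0 \<psi> K p" by (simp add: pr)
    also have "\<dots> = f 3 p * thL [3] K p"
      unfolding proj_def bitype_1_0 using f1 f2 by (simp add: f_def)
    finally show ?thesis using c3[of p] by (simp add: fsc_def)
  qed
  then show ?thesis by blast
qed

lemma harm_2_sub:
  assumes "\<psi> \<in> harm 2"
  shows "\<exists>c. \<psi> = fsc c (fadd (fsc \<i> (thL [1,3])) (thL [2,3]))"
proof -
  have \<psi>: "\<psi> \<in> Apq 2 0" "bdelta \<psi> = fzero" and orth: "\<And>\<alpha>. \<alpha> \<in> Aall \<Longrightarrow> l2 (bdelta \<alpha>) \<psi> = 0"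
    using assms by (auto simp: harm_iff)
  then have A: "\<psi> \<in> Aall" and pr: "proj 2 0 \<psi> = \<psi>" by (auto simp: Apq_def)
  define f where "f i j = tcoef \<psi> {i, j}" for i j
  have sm: "smooth (f i j)" and gi: "ginv (f i j)" for i j
    unfolding f_def by (auto intro: tcoef_Aall A)
  define g where "g p = f 1 3 p + - \<i> * f 2 3 p" for p
  have smg: "smooth g" and gig: "ginv g"
    unfolding g_def by (intro smooth_add smooth_cmult sm ginv_add ginv_mult ginv_const gi)+
  have "g p = 0" for p
  proof (rule integral_cnj_mult_self_eq_zero[OF smg gig])
    \<comment> \<open>For the test form \<open>g\<close> times \<open>theta 4\<close> the
      (2,0)-coefficients of \<open>bdelta\<close> are \<open>g / 4\<close> at 13 and
      \<open>\<i> * g / 4\<close> at 23. Pairing with \<open>\<psi>\<close> gives \<open>g\<close>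
      times the conjugate of \<open>f 1 3 - \<i> * f 2 3\<close>, which is why \<open>g\<close> is
      this combination.\<close>
    define \<alpha> where "\<alpha> = fmul g (thL (sorted_list_of_set {4}))"
    have "{4} \<in> bitype 0 1" by (simp add: bitype_0_1)
    from proj_fmul_thL[OF this] have pr: "proj 0 1 \<alpha> = \<alpha>" by (simp add: \<alpha>_def)
    have "\<alpha> \<in> Aall" unfolding \<alpha>_def by (intro Aall_fmul smg gig fsup_thL fconst_thL)
    then have "0 = l2 (bdelta \<alpha>) \<psi>" by (simp add: orth)
    also have "\<dots> = integral fdom (\<lambda>p. \<Sum>J\<in>bitype 2 0. cnj (tcoef \<psi> J p) * (2 ^ 2 * tcoef (bdelta \<alpha>) J p))"
      by (rule l2_holomorphic[OF \<psi>(1)])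
    also have "\<dots> = integral fdom (\<lambda>p. \<Sum>J\<in>bitype 2 0. cnj (tcoef \<psi> J p) * (2 ^ 2 * tcoef (dform \<alpha>) J p))"
      by (intro Henstock_Kurzweil_Integration.integral_cong sum.cong refl) (simp add: tcoef_bdelta_holomorphic pr)
    also have "\<dots> = integral fdom (\<lambda>p. cnj (g p) * g p)"
    proof (rule Henstock_Kurzweil_Integration.integral_cong)
      fix p
      have D: "tcoef (dform \<alpha>) J p = (\<Sum>j\<in>{1..6}. Zderiv j g p * tcoef (thL [j, 4]) J p) + g p * tcoef (dconst (thL [4])) J p" for J
        using tcoef_dform_fmul[OF smg fsup_thL fconst_thL, of "[4]" J p] by (simp add: \<alpha>_def)
      \<comment> \<open>The derivative terms carry the factor \<open>theta 4\<close> and have no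
        component of type (2,0).\<close>
      have v: "tcoef (dform \<alpha>) {1,2} p = 0" "tcoef (dform \<alpha>) {1,3} p = g p / 4" "tcoef (dform \<alpha>) {2,3} p = \<i> / 4 * g p"
        unfolding D by (simp_all add: tcoef_evalf dconst_simps exterior_simps atLeast1_atMost6)
      show "(\<Sum>J\<in>bitype 2 0. cnj (tcoef \<psi> J p) * (2 ^ 2 * tcoef (dform \<alpha>) J p)) = cnj (g p) * g p"
        unfolding bitype_2_0
        by (simp add: v doubleton_eq_iff f_def[symmetric]) (simp add: g_def algebra_simps)
    qed
    finally show "integral fdom (\<lambda>p. cnj (g p) * g p) = 0" by simp
  qed
  then have f13: "f 1 3 p = \<i> * f 2 3 p" for p by (simp add: g_def)
  have mem: "{a, b, c} \<in> bitype 2 1" if "a \<in> {1,2,3}" "b \<in> {1,2,3}" "a \<noteq> b" "c \<in> {4,5,6}" for a b c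
    using that by (auto simp: bitype_def)
  have eq: "(\<Sum>J\<in>{{1,2},{1,3},{2,3}}. (\<Sum>j\<in>{1..6}. Zderiv j (tcoef \<psi> J) p * tcoef (thL (j # sorted_list_of_set J)) {a,b,c} p)
     + tcoef \<psi> J p * tcoef (dconst (thL (sorted_list_of_set J))) {a,b,c} p) = 0"
    if "a \<in> {1,2,3}" "b \<in> {1,2,3}" "a \<noteq> b" "c \<in> {4,5,6}" for a b c p
    using dbar_equations[OF \<psi>(1) _ \<psi>(2) mem[OF that], of p] unfolding bitype_2_0 by simp
  have F: "cz 2 (cz 1 \<psi>) {} p = f 1 2 p" "cz 3 (cz 1 \<psi>) {} p = f 1 3 p" "cz 3 (cz 2 \<psi>) {} p = f 2 3 p" for p
    by (simp_all add: f_def tcoef_evalf evalf_Cons)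
  note S = tcoef_evalf dconst_simps exterior_simps atLeast1_atMost6 doubleton_eq_iff f_def[symmetric] F
  have e12: "Zderiv j (f 1 2) p = 0" if "j \<in> {4,5,6}" for p j
    using that eq[of 1 2 4 p] eq[of 1 2 5 p] eq[of 1 2 6 p] by (auto simp: S)
  have c12: "f 1 2 p = f 1 2 0" for p
    by (rule holomorphic_imp_constant[OF sm gi]) (simp_all add: e12)
  have e134: "Zderiv 4 (f 1 3) p = \<i> / 4 * f 1 2 p" for p
    using eq[of 1 3 4 p] by (simp add: S)
  \<comment> \<open>Up to a factor, the now constant \<open>f 1 2\<close> is a derivative of
    \<open>f 1 3\<close>.\<close>
  have "\<i> / 4 * f 1 2 0 = 0"
  proof (rule Zderiv_constant_eq_zero[OF sm gi])
    show "Zderiv 4 (f 1 3) p = \<i> / 4 * f 1 2 0" for p using c12[of p] by (simp add: e134)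
  qed
  then have f12: "f 1 2 p = 0" for p using c12[of p] by simp
  have e135: "Zderiv 5 (f 1 3) p = 0" for p
    using eq[of 1 3 5 p] f12 by (simp add: S)
  \<comment> \<open>The zeroth-order term is a multiple of \<open>f 1 3 - \<i> * f 2 3\<close>, so
    the relation obtained from mu* cancels it.\<close>
  have e136: "Zderiv 6 (f 1 3) p = 0" for p
    using eq[of 1 3 6 p] f13[of p] by (simp add: S)
  have c13: "f 1 3 p = f 1 3 0" for p
    by (rule holomorphic_imp_constant[OF sm gi]) (simp_all add: e134 e135 e136 f12)
  then have c23: "f 2 3 p = f 2 3 0" for p using f13[of p] f13[of 0] by simp
  have "\<psi> K p = fsc (f 2 3 0) (fadd (fsc \<i> (thL [1,3])) (thL [2,3])) K p" for K p
  proof -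
    have "\<psi> K p = proj 2 0 \<psi> K p" by (simp add: pr)
    also have "\<dots> = f 1 3 p * thL [1,3] K p + f 2 3 p * thL [2,3] K p"
      unfolding proj_def bitype_2_0 using f12[of p] by (simp add: f_def doubleton_eq_iff)
    finally show ?thesis using c23[of p] f13[of p] by (simp add: fsc_def fadd_def algebra_simps)
  qed
  then show ?thesis by blast
qed

lemma harm_3_sub:
  assumes "\<psi> \<in> harm 3"
  shows "\<psi> = fzero"
proof -
  have \<psi>: "\<psi> \<in> Apq 3 0" and orth: "\<And>\<alpha>. \<alpha> \<in> Aall \<Longrightarrow> l2 (bdelta \<alpha>) \<psi> = 0"
    using assms by (auto simp: harm_iff)
  then have A: "\<psi> \<in> Aall" and pr: "proj 3 0 \<psi> = \<psi>" by (auto simp: Apq_def)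
  define f where "f = tcoef \<psi> {1, 2, 3}"
  have sm: "smooth f" and gi: "ginv f"
    unfolding f_def by (auto intro: tcoef_Aall A)
  have f: "f p = 0" for p
  proof (rule integral_cnj_mult_self_eq_zero[OF sm gi])
    \<comment> \<open>\<open>mu\<close> sends the product of \<open>theta 2\<close> and
      \<open>theta 4\<close> to 1/4 of the product of \<open>theta 1\<close>,
      \<open>theta 2\<close>, \<open>theta 3\<close>. The factor 1/2 balances this against the norm
      factor \<open>2 ^ 3\<close>, so that the pairing is exactly |f|^2.\<close>
    define \<alpha> where "\<alpha> = fmul (\<lambda>p. 1 / 2 * f p) (thL (sorted_list_of_set {2, 4}))"
    have sm2: "smooth (\<lambda>p. 1 / 2 * f p)" by (intro smooth_cmult sm)
    have gi2: "ginv (\<lambda>p. 1 / 2 * f p)" by (intro ginv_mult ginv_const gi)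
    have "{2, 4} \<in> bitype 1 1" by (simp add: bitype_def)
    from proj_fmul_thL[OF this] have pr: "proj 1 1 \<alpha> = \<alpha>" by (simp add: \<alpha>_def)
    have "\<alpha> \<in> Aall" unfolding \<alpha>_def by (intro Aall_fmul sm2 gi2 fsup_thL fconst_thL)
    then have "0 = l2 (bdelta \<alpha>) \<psi>" by (simp add: orth)
    also have "\<dots> = integral fdom (\<lambda>p. \<Sum>J\<in>bitype 3 0. cnj (tcoef \<psi> J p) * (2 ^ 3 * tcoef (bdelta \<alpha>) J p))"
      by (rule l2_holomorphic[OF \<psi>(1)])
    also have "\<dots> = integral fdom (\<lambda>p. \<Sum>J\<in>bitype 3 0. cnj (tcoef \<psi> J p) * (2 ^ 3 * tcoef (dform \<alpha>) J p))"
    proof (intro Henstock_Kurzweil_Integration.integral_cong sum.cong refl)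
      fix p J assume J: "J \<in> bitype 3 0"
      have "(3::nat) - 2 = 1" by simp
      then show "cnj (tcoef \<psi> J p) * (2 ^ 3 * tcoef (bdelta \<alpha>) J p) = cnj (tcoef \<psi> J p) * (2 ^ 3 * tcoef (dform \<alpha>) J p)"
        unfolding tcoef_bdelta_holomorphic[OF J] by (simp only: pr) simp
    qed
    also have "\<dots> = integral fdom (\<lambda>p. cnj (f p) * f p)"
    proof (rule Henstock_Kurzweil_Integration.integral_cong)
      fix p
      have D: "tcoef (dform \<alpha>) J p = (\<Sum>j\<in>{1..6}. Zderiv j (\<lambda>p. 1 / 2 * f p) p * tcoef (thL [j, 2, 4]) J p)
          + 1 / 2 * f p * tcoef (dconst (thL [2, 4])) J p" for J
        using tcoef_dform_fmul[OF sm2 fsup_thL fconst_thL, of "[2, 4]" J p] by (simp add: \<alpha>_def)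
      have v: "tcoef (dform \<alpha>) {1,2,3} p = f p / 8"
        unfolding D by (simp add: tcoef_evalf dconst_simps exterior_simps atLeast1_atMost6)
      show "(\<Sum>J\<in>bitype 3 0. cnj (tcoef \<psi> J p) * (2 ^ 3 * tcoef (dform \<alpha>) J p)) = cnj (f p) * f p"
        unfolding bitype_3_0 by (simp add: v f_def[symmetric])
    qed
    finally show "integral fdom (\<lambda>p. cnj (f p) * f p) = 0" by simp
  qed
  have "\<psi> K p = proj 3 0 \<psi> K p" for K p by (simp add: pr)
  also have "\<dots> K p = fzero K p" for K p
    unfolding proj_def bitype_3_0 using f[of p] by (simp add: f_def fzero_def)
  finally show ?thesis by blast
qed

section \<open>Harmonicity of the generators, and the dimensions\<close>

lemma tw_anticommute:
  assumes "i \<in> {1..6}" "j \<in> {1..6}"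
  shows "tw i (tw j \<alpha>) = fsc (-1) (tw j (tw i \<alpha>))"
proof (intro ext)
  have expand: "tw i (tw j \<alpha>) K p = (\<Sum>k\<in>{1..6}. \<Sum>l\<in>{1..6}. 2 * cnj (Zvec i k) * (2 * cnj (Zvec j l)) * wedge (eb k) (wedge (eb l) \<alpha>) K p)"
    if ij: "i \<in> {1..6}" "j \<in> {1..6}" for i j K p
  proof -
    have "tw j \<alpha> = (\<lambda>K p. \<Sum>l\<in>{1..6}. 2 * cnj (Zvec j l) * wedge (eb l) \<alpha> K p)"
      by (intro ext wedge_theta ij)
    then have "wedge (eb k) (tw j \<alpha>) K p = (\<Sum>l\<in>{1..6}. 2 * cnj (Zvec j l) * wedge (eb k) (wedge (eb l) \<alpha>) K p)" for k
      by (simp only: wedge_sum_right)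
    then show ?thesis unfolding wedge_theta[OF ij(1)] by (simp add: sum_distrib_left mult.assoc)
  qed
  fix K p
  have "tw i (tw j \<alpha>) K p = (\<Sum>k\<in>{1..6}. \<Sum>l\<in>{1..6}. - (2 * cnj (Zvec j l) * (2 * cnj (Zvec i k)) * wedge (eb l) (wedge (eb k) \<alpha>) K p))"
    unfolding expand[OF assms] by (intro sum.cong refl) (subst wedge_eb_anticommute, simp)
  also have "\<dots> = - tw j (tw i \<alpha>) K p"
    unfolding expand[OF assms(2,1)] by (subst sum.swap) (simp add: sum_negf)
  finally show "tw i (tw j \<alpha>) K p = fsc (-1) (tw j (tw i \<alpha>)) K p" by (simp add: fsc_def)
qed

lemma wedge_one_form: "fsup \<alpha> \<Longrightarrow> wedge \<alpha> one_form = \<alpha>"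
proof (intro ext)
  fix K p assume sup: "fsup \<alpha>"
  show "wedge \<alpha> one_form K p = \<alpha> K p"
  proof (cases "finite K")
    case True
    have w: "wsign K {} = 1" by (simp add: wsign_def)
    have "wedge \<alpha> one_form K p = (\<Sum>I\<in>Pow K. if I = K then \<alpha> K p else 0)"
      unfolding wedge_def by (rule sum.cong) (auto simp: one_form_def w)
    then show ?thesis using True by simp
  next
    case False
    then have "\<not> K \<subseteq> {1..6}" using finite_subset by blast
    with sup False show ?thesis by (simp add: fsup_def)
  qed
qed

lemma thL_explicit: "thL [3] = theta 3" "psi0 = fadd (fsc \<i> (thL [1,3])) (thL [2,3])"
  by (simp_all add: psi0_def wedge_one_form fsup_theta)

lemma Aall_constant: "fsup \<alpha> \<Longrightarrow> fconst \<alpha> \<Longrightarrow> \<alpha> \<in> Aall"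
  using Aall_fmul[OF smooth_const ginv_const, of \<alpha> 1] by (simp add: fmul_def)

lemma dform_constant: "fsup \<alpha> \<Longrightarrow> fconst \<alpha> \<Longrightarrow> dform \<alpha> = dconst \<alpha>"
  using dform_fmul[where f = "\<lambda>_. 1" and \<Theta> = \<alpha>, OF smooth_const] by (intro ext) (simp add: fmul_def)

text \<open>\<open>e^3 + i e^4\<close> is closed, and the image of \<open>bdelta\<close> has no
  (1,0)-component, so orthogonality holds at once.\<close>

lemma theta3_harm: "theta 3 \<in> harm 1"
proof -
  have pr: "proj 1 0 (theta 3) = theta 3"
    using proj_fmul_thL[of "{3}" 1 0 "\<lambda>_. 1"] by (simp add: bitype_1_0 fmul_def wedge_one_form fsup_theta)
  have A: "theta 3 \<in> Apq 1 0"
    using pr by (simp add: Apq_def Aall_constant fsup_theta fconst_theta)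
  have "dform (theta 3) = fzero"
  proof -
    have "dconst (thL [3]) = fzero" by (simp add: dconst_simps exterior_simps)
    then show ?thesis
      using dform_constant[OF fsup_thL fconst_thL, of "[3]"] unfolding thL_explicit by simp
  qed
  then have "bdelta (theta 3) = fzero"
    by (intro ext) (simp add: bdelta_of_type[OF pr] proj_fzero)
  moreover have "l2 (bdelta \<alpha>) (theta 3) = 0" for \<alpha>
    unfolding l2_holomorphic[OF A] by (simp add: tcoef_bdelta_holomorphic)
  ultimately show ?thesis using A by (simp add: harm_iff)
qed

lemma psi0_const: "fsup psi0" "fconst psi0"
  unfolding thL_explicit by (intro fsup_simps fsup_thL fconst_simps fconst_thL)+

text \<open>Contracting \<open>psi0\<close> with \<open>E_5\<close> and \<open>E_6\<close> gives
  \<open>i phi^3\<close> and \<open>- phi^3\<close>, so its derivative is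
  \<open>i de^5 - de^6\<close> times \<open>phi^3\<close>. That two-form equals
  \<open>e^2 - i e^1\<close> times \<open>phi^3\<close>, and the square of \<open>phi^3\<close>
  vanishes.\<close>

lemma psi0_harm: "psi0 \<in> harm 2"
proof -
  have pr: "proj 2 0 psi0 = psi0"
    by (rule proj_combination[where g = "\<lambda>J p. if J = {1,3} then \<i> else if J = {2,3} then 1 else 0"])
      (simp add: bitype_2_0 doubleton_eq_iff thL_explicit fadd_def fsc_def)
  have A: "psi0 \<in> Apq 2 0" using pr by (simp add: Apq_def Aall_constant psi0_const)
  have t33: "tw 3 (tw 3 one_form) = fzero"
    using tw_anticommute[of 3 3 one_form] by (auto simp: fsc_def fzero_def fun_eq_iff)
  have "dconst psi0 = fzero"
  proof -
    have "ctr (uvec 5) psi0 = fsc \<i> (tw 3 one_form)" "ctr (uvec 6) psi0 = fsc (-1) (tw 3 one_form)"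
      unfolding thL_explicit(2) by (simp_all add: ctr_uvec exterior_simps)
    then have "dconst psi0 = fadd (wedge (de 5) (fsc \<i> (tw 3 one_form))) (wedge (de 6) (fsc (-1) (tw 3 one_form)))"
      by (simp only: dconst_def)
    also have "\<dots> = fzero"
      by (simp add: wedge_de wedge_eb_theta_explicit wedge_fsc_right wedge_fadd_right t33 wedge_fzero_right)
        (simp add: fadd_def fsc_def fzero_def)
    finally show ?thesis .
  qed
  then have "bdelta psi0 = fzero"
    by (intro ext) (simp add: bdelta_of_type[OF pr] dform_constant[OF psi0_const] proj_fzero)
  moreover have "l2 (bdelta \<alpha>) psi0 = 0" if \<alpha>: "\<alpha> \<in> Aall" for \<alpha>
  proof -
    have "(\<Sum>J\<in>bitype 2 0. cnj (tcoef psi0 J p) * (2 ^ 2 * tcoef (bdelta \<alpha>) J p)) = 0" for p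
    proof -
      have b: "tcoef (bdelta \<alpha>) J p = tcoef (dform (proj 0 1 \<alpha>)) J p" if "J \<in> bitype 2 0" for J
        using tcoef_bdelta_holomorphic[OF that, of \<alpha> p] by simp
      have v: "tcoef psi0 {1,2} p = 0" "tcoef psi0 {1,3} p = \<i>" "tcoef psi0 {2,3} p = 1"
        unfolding thL_explicit(2) by (simp_all add: tcoef_evalf exterior_simps)
      \<comment> \<open>The second value is \<open>\<i>\<close> times the first, so the conjugated
        coefficients \<open>- \<i>\<close> and 1 of \<open>psi0\<close> make the two contributions
        cancel.\<close>
      have w: "tcoef (dform (proj 0 1 \<alpha>)) {1,3} p = (tcoef \<alpha> {4} p + \<i> * tcoef \<alpha> {5} p) / 4"
        "tcoef (dform (proj 0 1 \<alpha>)) {2,3} p = (\<i> * tcoef \<alpha> {4} p - tcoef \<alpha> {5} p) / 4"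
        unfolding tcoef_dform_proj[OF \<alpha>] bitype_0_1
        by (simp_all add: tcoef_evalf dconst_simps exterior_simps atLeast1_atMost6 add_divide_distrib)
      have "tcoef (bdelta \<alpha>) {1,3} p = (tcoef \<alpha> {4} p + \<i> * tcoef \<alpha> {5} p) / 4"
        "tcoef (bdelta \<alpha>) {2,3} p = (\<i> * tcoef \<alpha> {4} p - tcoef \<alpha> {5} p) / 4"
        using w b by (simp_all add: bitype_2_0)
      note x = this
      show ?thesis
        unfolding bitype_2_0 by (simp add: doubleton_eq_iff v x) (simp add: field_simps)
    qed
    then show ?thesis unfolding l2_holomorphic[OF A] by simp
  qed
  ultimately show ?thesis using A by (simp add: harm_iff)
qed

lemma harm_fsc:
  assumes n: "n \<le> 3" and \<psi>: "\<psi> \<in> harm n"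
  shows "fsc c \<psi> \<in> harm n"
proof -
  have A: "\<psi> \<in> Aall" and pr: "proj n 0 \<psi> = \<psi>" and z: "bdelta \<psi> = fzero"
    and orth: "\<And>\<alpha>. \<alpha> \<in> Aall \<Longrightarrow> l2 (bdelta \<alpha>) \<psi> = 0"
    using \<psi> by (auto simp: harm_iff Apq_def)
  have proj_fsc: "proj a b (fsc c \<beta>) = fsc c (proj a b \<beta>)" for a b \<beta>
    by (intro ext) (simp add: proj_def tcoef_evalf evalf_fsc, simp add: fsc_def proj_def tcoef_evalf sum_distrib_left mult_ac)
  have "Eop k (fsc c \<psi>) = fsc c (Eop k \<psi>)" for k
    using A by (intro ext) (simp add: Eop_def fsc_def Ederiv_cmult Aall_iff)
  then have d: "dform (fsc c \<psi>) = fsc c (dform \<psi>)"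
    by (intro ext) (simp add: dform_eq, simp add: fsc_def dform_eq distrib_left sum_distrib_left mult_ac)
  have pr': "proj n 0 (fsc c \<psi>) = fsc c \<psi>" by (simp add: proj_fsc pr)
  have "bdelta (fsc c \<psi>) = fsc c (bdelta \<psi>)"
    by (intro ext) (simp add: bdelta_of_type[OF pr' n] d proj_fsc, simp add: fsc_def bdelta_of_type[OF pr n])
  moreover have "l2 \<beta> (fsc c \<psi>) = cnj c * l2 \<beta> \<psi>" for \<beta>
  proof -
    have "l2 \<beta> (fsc c \<psi>) = integral fdom (\<lambda>p. cnj c * (\<Sum>I\<in>Pow {1..6}. \<beta> I p * cnj (\<psi> I p)))"
      by (simp add: l2_def fsc_def sum_distrib_left mult_ac)
    then show ?thesis by (simp add: l2_def)
  qed
  ultimately show ?thesis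
    using A pr' orth z by (simp add: harm_iff Apq_def Aall_fsc)
qed

lemma harm_1_eq: "harm 1 = {fsc c (theta 3) | c. True}"
  using harm_1_sub harm_fsc[of 1, OF _ theta3_harm] unfolding thL_explicit by fastforce

lemma harm_2_eq: "harm 2 = {fsc c psi0 | c. True}"
  using harm_2_sub harm_fsc[of 2, OF _ psi0_harm] unfolding thL_explicit(2)[symmetric] by fastforce

lemma fzero_harm: "fzero \<in> harm 3"
proof -
  have "fzero \<in> Apq 3 0" by (simp add: Apq_def Aall_fzero proj_fzero)
  then show ?thesis by (simp add: harm_iff bdelta_fzero)
qed

interpretation form_space: vector_space fsc
  by unfold_locales (simp_all add: fsc_def fun_eq_iff algebra_simps)

lemma dim_line:
  assumes "v \<noteq> fzero"
  shows "vector_space.dim fsc {fsc c v | c. True} = 1"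
proof -
  have "v \<noteq> 0" using assms by (simp add: fzero_def zero_fun_def)
  moreover have "{fsc c v | c. True} = form_space.span {v}"
    by (auto simp: form_space.span_singleton)
  ultimately show ?thesis
    by (simp add: form_space.dim_eq_card_independent)
qed

theorem mainTheorem10:
  shows "hdim 1 = 1 \<and> hdim 2 = 1 \<and> psi0 \<in> harm 2 \<and> harm 2 = {fsc c psi0 | c. True}
         \<and> hdim 3 = 0"
proof (intro conjI)
  have "theta 3 {3} 0 = 1" by (simp add: theta_def fadd_def fsc_def eb_def)
  then have "theta 3 \<noteq> fzero" by (auto simp: fzero_def)
  then show "hdim 1 = 1" unfolding hdim_def harm_1_eq by (rule dim_line)
  have "tcoef psi0 {2,3} 0 = 1"
    unfolding thL_explicit(2) by (simp add: tcoef_evalf exterior_simps)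
  moreover have "tcoef fzero {2,3} 0 = 0" by (simp add: tcoef_def evalf_def fzero_def)
  ultimately have "psi0 \<noteq> fzero" by auto
  then show "hdim 2 = 1" unfolding hdim_def harm_2_eq by (rule dim_line)
  show "psi0 \<in> harm 2" by (rule psi0_harm)
  show "harm 2 = {fsc c psi0 | c. True}" by (rule harm_2_eq)
  have "harm 3 = {fzero}" using harm_3_sub fzero_harm by blast
  moreover have "fzero = 0" by (simp add: fzero_def zero_fun_def)
  ultimately have "harm 3 = {0}" by simp
  then show "hdim 3 = 0"
    using form_space.dim_eq_card[of "{}" "{0}"] by (simp add: hdim_def form_space.independent_empty)
qed

end
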